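(* Let $0<p<1$ and $r,m\in\mathbb{N}$ with $r<m$. There is a constant $C$, independent of $f$ and $n$, such that the following holds. Let $f$ be a function on $[0,1]$ such that $f^{(r-1)}\in AC[0,1]$ and $$\sum_{\nu=1}^\infty\nu^{-p}\mathcal{E}_{m-r,\nu}(f^{(r)})_p^p<\infty ,$$ and let $S_n\in\mathcal{S}_{m,n}$, $n\in\mathbb{N}$, be such that $\|f-S_n\|_p=\mathcal{E}_{m,n}(f)_p$. Then for any $n\in\mathbb{N}$, $$\|f^{(r)}-S_n^{(r)}\|_p\le C\left(\mathcal{E}_{m-r,n}(f^{(r)})_p+n^{1-\frac1p}\left(\sum_{\nu=n+1}^\infty\nu^{-p}\mathcal{E}_{m-r,\nu}(f^{(r)})_p^p\right)^{\frac1p}\right).$$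
   Context: $\|f\|_p=\left(\int_0^1|f(x)|^p\,dx\right)^{1/p}$. $AC[0,1]$ is the set of absolutely continuous functions on $[0,1]$; when $f^{(r-1)}\in AC[0,1]$, $f^{(r)}$ denotes the (a.e. defined, integrable) derivative of $f^{(r-1)}$. For $m,n\in\mathbb{N}$, $\mathcal{S}_{m,n}$ is the set of all splines of degree $m-1$ with knots $t_j=j/n$, $j=0,\dots,n$: $S\in\mathcal{S}_{m,n}$ if $S\in C^{m-2}[0,1]$ and $S$ coincides with an algebraic polynomial of degree (at most) $m-1$ on each interval $(t_{j-1},t_j)$, $j=1,\dots,n$ (for $m=1$ no continuity is required). Derivatives of splines are taken piecewise (defined off the knots). $\mathcal{E}_{m,n}(f)_p=\inf_{S\in\mathcal{S}_{m,n}}\|f-S\|_p$. *)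

theory Defs
  imports "HOL-Analysis.Analysis" "HOL-Computational_Algebra.Polynomial"
begin

text \<open>
  Functions on \<open>[0,1]\<close> are represented by functions of type \<open>real \<Rightarrow> real\<close>; every notion below
  depends only on their values on \<open>[0,1]\<close>.
\<close>

text \<open>
  The Bochner integral returns 0 for a non-integrable integrand. The functions measured here
  (splines, integrable functions, and their differences) all have an integrable \<open>p\<close>-th power
  for \<open>0 < p < 1\<close>.
\<close>

definition Lp_norm01 :: "real \<Rightarrow> (real \<Rightarrow> real) \<Rightarrow> real" where
  "Lp_norm01 p f = (LINT x:{0..1}|lebesgue. \<bar>f x\<bar> powr p) powr (1 / p)"

text \<open>
  The derivative relative to \<open>[0,1]\<close>, hence one-sided at the end points. At points of
  non-differentiability the value is unspecified; whenever \<open>deriv01 k f\<close> is integrated below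
  (an absolutely continuous \<open>(k-1)\<close>-st derivative, or a spline off its knots) these points form
  a null set. Since the value at a point depends only on the function near that point,
  iterating this operator on a spline gives the piecewise derivative on each open knot interval.
\<close>

definition deriv01 :: "nat \<Rightarrow> (real \<Rightarrow> real) \<Rightarrow> real \<Rightarrow> real" where
  "deriv01 k f = ((\<lambda>g x. vector_derivative g (at x within {0..1})) ^^ k) f"

definition differentiable_times01 :: "nat \<Rightarrow> (real \<Rightarrow> real) \<Rightarrow> bool" where
  "differentiable_times01 k f \<longleftrightarrow> (\<forall>j<k. deriv01 j f differentiable_on {0..1})"

definition Ck01 :: "nat \<Rightarrow> (real \<Rightarrow> real) \<Rightarrow> bool" where
  "Ck01 k f \<longleftrightarrow> differentiable_times01 k f \<and> continuous_on {0..1} (deriv01 k f)"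

definition AC01 :: "(real \<Rightarrow> real) \<Rightarrow> bool" where
  "AC01 f \<longleftrightarrow> (\<forall>\<epsilon>>0. \<exists>\<delta>>0. \<forall>I :: (real \<times> real) set.
     finite I \<and> (\<forall>(u, v)\<in>I. 0 \<le> u \<and> u < v \<and> v \<le> 1) \<and>
     disjoint_family_on (\<lambda>(u, v). {u<..<v}) I \<and> (\<Sum>(u, v)\<in>I. v - u) < \<delta>
     \<longrightarrow> (\<Sum>(u, v)\<in>I. \<bar>f v - f u\<bar>) < \<epsilon>)"

text \<open>
  The condition \<open>S \<in> C\<^sup>m\<^sup>-\<^sup>2[0,1]\<close> is void for \<open>m = 1\<close>; the guard is needed because subtraction on
  \<^typ>\<open>nat\<close> is truncated. Only \<open>m, n \<ge> 1\<close> are meaningful.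
\<close>

definition splines :: "nat \<Rightarrow> nat \<Rightarrow> (real \<Rightarrow> real) set" where
  "splines m n = {S.
     (2 \<le> m \<longrightarrow> Ck01 (m - 2) S) \<and>
     (\<forall>j\<in>{1..n}. \<exists>q :: real poly. degree q \<le> m - 1 \<and>
        (\<forall>x\<in>{(real j - 1) / real n <..< real j / real n}. S x = poly q x))}"

definition spline_err :: "nat \<Rightarrow> nat \<Rightarrow> (real \<Rightarrow> real) \<Rightarrow> real \<Rightarrow> real" where
  "spline_err m n f p = (INF S\<in>splines m n. Lp_norm01 p (\<lambda>x. f x - S x))"

end

theory Submission
  imports Defs
begin

text \<open>
  Write \<open>k = m - r\<close> and \<open>g = f\<^sup>(\<^sup>r\<^sup>)\<close>, and let \<open>E\<^sub>\<nu>\<close> be the best error for \<open>g\<close> by splines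
  of order \<open>k\<close> with \<open>\<nu>\<close> cells. For \<open>0 < p < 1\<close> the \<open>L\<^sub>p\<close> size of \<open>g\<close> says nothing about \<open>f\<close>, but
  its \<open>L\<^sub>1\<close> size does; the theorem is a comparison of the two on the cells of the mesh \<open>1/n\<close>. All
  quantities are measured by \<open>energy\<close>, the \<open>p\<close>-th power of the quasinorm, because this power obeys
  the triangle inequality with constant 1 and is additive over cells.

  Fix a nearly best \<open>T\<close> of order \<open>k\<close> with \<open>n\<close> cells, put \<open>G = g - T\<close>, and let \<open>B\<^sub>i\<close> be the
  \<open>L\<^sub>1\<close> norm of \<open>G\<close> on the \<open>i\<close>-th cell. Three estimates give the theorem.

  First (\<open>cell_L1_spline_error\<close>), \<open>\<Sum> B\<^sub>i\<^sup>p\<close> is at most a constant times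
  \<open>n\<^sup>1\<^sup>-\<^sup>p\<close> \<open>\<parallel>g - T\<parallel>\<^sup>p\<close> \<open>+\<close> \<open>\<Sum>\<close> \<open>\<nu>\<^sup>-\<^sup>p E\<^sub>\<nu>\<^sup>p\<close>, the last sum over \<open>\<nu> > n\<close>. The function \<open>G\<close> is a telescoping
  sum of piecewise polynomials on finer and finer meshes, and on one cell of length \<open>h\<close> the
  \<open>L\<^sub>1\<close> norm of a polynomial is at most \<open>C h\<^sup>1\<^sup>-\<^sup>1\<^sup>/\<^sup>p\<close> times its \<open>L\<^sub>p\<close> quasinorm
  (\<open>poly_nikolskii\<close>). The difficulty is that equidistant knots are not nested and that \<open>E\<^sub>\<nu>\<close> is not
  monotone, not even up to a constant: a spline with \<open>N\<close> cells has \<open>E\<^sub>N = 0\<close> and usually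
  \<open>E\<^sub>N\<^sub>+\<^sub>1 > 0\<close>. So no single neighbour bounds a chosen \<open>E\<^sub>\<nu>\<close>. However, an interval
  of length \<open>1/(16a)\<close> contains a knot \<open>q/\<nu>\<close> only for a limited proportion of the \<open>\<nu>\<close> between
  \<open>a\<close> and \<open>4a\<close>; on such an interval one takes the polynomial piece of the spline with the best
  among the remaining \<open>\<nu>\<close>. This yields a discontinuous piecewise polynomial on the mesh \<open>1/(16a)\<close> whose
  error is at most a constant times the average of the errors \<open>E\<^sub>\<nu>\<^sup>p\<close>, \<open>a < \<nu> \<le> 4a\<close>
  (\<open>knot_free_or_shift\<close>, \<open>spline_mixing\<close>). The windows with \<open>a = n 4\<^sup>j\<close> partition the integers
  above \<open>n\<close>, and these meshes are nested.

  Secondly (\<open>iter_int_spline_approximation\<close>), the error of the best spline of order \<open>m\<close> for \<open>f\<close>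
  satisfies \<open>E\<^sup>p \<le> C n\<^sup>-\<^sup>r\<^sup>p n\<^sup>p\<^sup>-\<^sup>1 \<Sum> B\<^sub>i\<^sup>p\<close>. Let \<open>R\<close> be the \<open>r\<close>-fold primitive of \<open>T\<close> with the initial data
  of \<open>f\<close>; it is a spline of order \<open>m\<close>. Then \<open>f - R\<close> is the \<open>r\<close>-fold primitive of \<open>G\<close>, a
  sum of contributions of the single cells. Such a contribution vanishes to the left of its cell
  and is a polynomial of degree \<open>< r\<close> to the right of it; a spline that agrees with this
  polynomial after \<open>m - 1\<close> further knots turns it into a function supported on \<open>m\<close> cells.

  Thirdly (\<open>derivative_error_local\<close>), on a cell \<open>T - S\<^sub>n\<^sup>(\<^sup>r\<^sup>)\<close> is the \<open>r\<close>-th derivative of the polynomial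
  \<open>R + \<Lambda> - S\<^sub>n\<close> for every \<open>\<Lambda>\<close> of degree \<open>< r\<close>. With \<open>\<Lambda>\<close> the Taylor polynomial of \<open>f - R\<close> at
  the left end point, Markov's inequality bounds it by \<open>n\<^sup>r\<close> times \<open>f - S\<^sub>n\<close> plus a remainder that involves
  \<open>B\<^sub>i\<close> only. As \<open>\<parallel>f - S\<^sub>n\<parallel>\<close> is the best error for \<open>f\<close>, the second and then the first estimate finish the proof.

  The primitives above require that \<open>f\<^sup>(\<^sup>r\<^sup>-\<^sup>1\<^sup>)\<close> is the integral of its derivative, which exists almost
  everywhere. This Lebesgue theory of absolutely continuous functions is developed at the start,
  with differentiability from Vitali's covering theorem and integration by a gauge argument.
\<close>


section \<open>Variation over finite families of intervals\<close>

text \<open>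
  Divisions are the form in which covering theorems and gauge integrals deliver families of
  intervals. Degenerate intervals are allowed in them and contribute nothing.
\<close>

lemma AC01_division:
  assumes "AC01 F" "e > 0"
  obtains d where "d > 0"
    "\<And>D. D division_of \<Union>D \<Longrightarrow> \<Union>D \<subseteq> {0..1} \<Longrightarrow> (\<Sum>k\<in>D. Sup k - Inf k) < d \<Longrightarrow>
       (\<Sum>k\<in>D. \<bar>F (Sup k) - F (Inf k)\<bar>) < e"
proof -
  obtain d where d: "d > 0" and
    dI: "\<And>I :: (real \<times> real) set.
     finite I \<Longrightarrow> (\<forall>(u, v)\<in>I. 0 \<le> u \<and> u < v \<and> v \<le> 1) \<Longrightarrow>
     disjoint_family_on (\<lambda>(u, v). {u<..<v}) I \<Longrightarrow> (\<Sum>(u, v)\<in>I. v - u) < d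
     \<Longrightarrow> (\<Sum>(u, v)\<in>I. \<bar>F v - F u\<bar>) < e"
    using assms unfolding AC01_def by meson
  show thesis
  proof (rule that[OF d])
    fix D :: "real set set"
    assume D: "D division_of \<Union>D" and sub: "\<Union>D \<subseteq> {0..1}" and small: "(\<Sum>k\<in>D. Sup k - Inf k) < d"
    define E where "E = {k\<in>D. Inf k < Sup k}"
    have form: "\<exists>a b. k = {a..b} \<and> a \<le> b" if "k \<in> D" for k
      using division_ofD(3,4)[OF D that] by (auto simp: atLeastatMost_empty_iff)
    have finD: "finite D" using D by auto
    have le: "Inf k \<le> Sup k" if "k \<in> D" for k
      using form[OF that] by auto
    have inj: "inj_on (\<lambda>k. (Inf k, Sup k)) E"
    proof (rule inj_onI)
      fix k l assume "k \<in> E" "l \<in> E" "(Inf k, Sup k) = (Inf l, Sup l)"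
      then show "k = l" using form[of k] form[of l] by (auto simp: E_def)
    qed
    have sumeq: "(\<Sum>k\<in>E. f k) = (\<Sum>k\<in>D. f k)" if "\<And>k. k \<in> D \<Longrightarrow> Inf k = Sup k \<Longrightarrow> f k = 0" for f :: "real set \<Rightarrow> real"
      by (rule sum.mono_neutral_left) (use finD that le in \<open>force simp: E_def\<close>)+
    define I where "I = (\<lambda>k. (Inf k, Sup k)) ` E"
    have 1: "finite I" using finD by (simp add: I_def E_def)
    have 2: "\<forall>(u, v)\<in>I. 0 \<le> u \<and> u < v \<and> v \<le> 1"
    proof clarify
      fix u v assume "(u,v) \<in> I"
      then obtain k where k: "k \<in> D" "u = Inf k" "v = Sup k" "u < v" by (auto simp: I_def E_def)
      obtain a b where ab: "k = {a..b}" "a \<le> b" using form k by blast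
      have "k \<subseteq> {0..1}" using sub k by auto
      then show "0 \<le> u \<and> u < v \<and> v \<le> 1" using k ab by auto
    qed
    have 3: "disjoint_family_on (\<lambda>(u, v). {u<..<v}) I"
      unfolding disjoint_family_on_def
    proof (intro ballI impI)
      fix x y assume "x \<in> I" "y \<in> I" "x \<noteq> y"
      then obtain k l where kl: "k \<in> D" "l \<in> D" "x = (Inf k, Sup k)" "y = (Inf l, Sup l)" "k \<noteq> l"
        by (auto simp: I_def E_def)
      obtain a b where ab: "k = {a..b}" "a \<le> b" using form kl by blast
      obtain a' b' where ab': "l = {a'..b'}" "a' \<le> b'" using form kl by blast
      have "interior k \<inter> interior l = {}" using division_ofD(5)[OF D] kl by blast
      then show "(case x of (u, v) \<Rightarrow> {u<..<v}) \<inter> (case y of (u, v) \<Rightarrow> {u<..<v}) = {}"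
        using kl ab ab' by (simp add: interior_atLeastAtMost_real)
    qed
    have "(\<Sum>(u, v)\<in>I. v - u) = (\<Sum>k\<in>E. Sup k - Inf k)"
      unfolding I_def by (subst sum.reindex[OF inj]) simp
    also have "\<dots> = (\<Sum>k\<in>D. Sup k - Inf k)" by (rule sumeq) simp
    finally have 4: "(\<Sum>(u, v)\<in>I. v - u) < d" using small by simp
    have "(\<Sum>(u, v)\<in>I. \<bar>F v - F u\<bar>) = (\<Sum>k\<in>E. \<bar>F (Sup k) - F (Inf k)\<bar>)"
      unfolding I_def by (subst sum.reindex[OF inj]) simp
    also have "\<dots> = (\<Sum>k\<in>D. \<bar>F (Sup k) - F (Inf k)\<bar>)" by (rule sumeq) simp
    finally show "(\<Sum>k\<in>D. \<bar>F (Sup k) - F (Inf k)\<bar>) < e" using dI[OF 1 2 3 4] by simp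
  qed
qed

lemma AC01_continuous:
  assumes "AC01 F" shows "continuous_on {0..1} F"
proof -
  have "uniformly_continuous_on {0..1} F"
    unfolding uniformly_continuous_on_def
  proof (intro allI impI)
    fix e :: real assume "e > 0"
    from AC01_division[OF assms this] obtain d where d: "d > 0" and
    D: "\<And>D. D division_of \<Union>D \<Longrightarrow> \<Union>D \<subseteq> {0..1} \<Longrightarrow> (\<Sum>k\<in>D. Sup k - Inf k) < d \<Longrightarrow>
       (\<Sum>k\<in>D. \<bar>F (Sup k) - F (Inf k)\<bar>) < e" by blast
    have *: "\<bar>F v - F u\<bar> < e" if "u \<in> {0..1}" "v \<in> {0..1}" "u \<le> v" "v - u < d" for u v
    proof -
      have "{{u..v}} division_of \<Union>{{u..v}}"
        using division_of_self[of u v] that by (auto simp: box_real)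
      from D[OF this] show ?thesis using that by auto
    qed
    show "\<exists>d>0. \<forall>x\<in>{0..1}. \<forall>x'\<in>{0..1}. dist x' x < d \<longrightarrow> dist (F x') (F x) < e"
    proof (intro exI[of _ d] conjI d ballI impI)
      fix x x' assume "x \<in> {0..1}" "x' \<in> {0..1::real}" "dist x' x < d"
      then show "dist (F x') (F x) < e"
        using *[of x x'] *[of x' x] by (cases "x \<le> x'") (auto simp: dist_real_def abs_minus_commute)
    qed
  qed
  then show ?thesis by (rule uniformly_continuous_imp_continuous)
qed

lemma division_telescope:
  fixes F :: "real \<Rightarrow> real"
  assumes "a \<le> b" "q division_of {a..b}"
  shows "(\<Sum>k\<in>q. F (Sup k) - F (Inf k)) = F b - F a"
proof -
  let ?p = "(\<lambda>k. (Inf k, k)) ` q"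
  have form: "\<exists>a b. k = {a..b} \<and> a \<le> b" if "k \<in> q" for k
    using division_ofD(3,4)[OF assms(2) that] by (auto simp: atLeastatMost_empty_iff)
  have inj: "inj_on (\<lambda>k. (Inf k, k)) q" by (auto simp: inj_on_def)
  have "?p tagged_division_of {a..b}"
  proof (rule tagged_division_ofI)
    show "finite ?p" using assms(2) by auto
    fix x K assume "(x,K) \<in> ?p"
    then have K: "K \<in> q" "x = Inf K" by auto
    then show "x \<in> K" using form by fastforce
    show "K \<subseteq> {a..b}" "\<exists>a b. K = cbox a b" using division_ofD(2,4)[OF assms(2)] K by auto
    fix x' K' assume "(x',K') \<in> ?p" "(x,K) \<noteq> (x',K')"
    then show "interior K \<inter> interior K' = {}" using division_ofD(5)[OF assms(2)] K by blast
  next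
    show "\<Union>{K. \<exists>x. (x, K) \<in> ?p} = {a..b}"
      using division_ofD(6)[OF assms(2)] by (auto simp: image_iff)
  qed
  from additive_tagged_division_1[OF assms(1) this, of F]
  show ?thesis by (simp add: sum.reindex[OF inj])
qed

text \<open>
  Vitali's theorem gives countably many disjoint intervals that cover almost all of \<open>E\<close>; finitely
  many of them already cover all but an arbitrarily small part.
\<close>

lemma Vitali_finite:
  fixes E :: "real set"
  assumes E: "E \<in> lmeasurable" and "e > 0"
    and K: "\<And>u v. (u,v) \<in> K \<Longrightarrow> u < v"
    and cov: "\<And>x d. x \<in> E \<Longrightarrow> 0 < d \<Longrightarrow> \<exists>u v. (u,v) \<in> K \<and> x \<in> {u..v} \<and> v - u < d"
  obtains C where "finite C" "C \<subseteq> (\<lambda>(u,v). {u..v}) ` K" "C division_of \<Union>C" "disjoint C"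
    "measure lebesgue E - e < measure lebesgue (E \<inter> \<Union>C)"
proof -
  let ?a = "\<lambda>(u,v). (u+v)/2 :: real" and ?r = "\<lambda>(u,v). (v-u)/2 :: real"
  let ?i = "\<lambda>(u,v). {u..v} :: real set"
  have cb: "cball (?a i) (?r i) = ?i i" for i
    by (cases i) (auto simp: cball_eq_atLeastAtMost field_simps)
  obtain C where C: "countable C" "C \<subseteq> K"
     "pairwise (\<lambda>i j. disjnt (cball (?a i) (?r i)) (cball (?a j) (?r j))) C"
     "negligible(E - (\<Union>i \<in> C. cball (?a i) (?r i)))"
  proof (rule Vitali_covering_theorem_cballs[where K=K and S=E and a="?a" and r="?r"])
    show "0 < ?r i" if "i \<in> K" for i using K that by (cases i) auto
    show "\<exists>i. i \<in> K \<and> x \<in> cball (?a i) (?r i) \<and> ?r i < d" if x: "x \<in> E" "0 < d" for x d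
    proof -
      obtain u v where uv: "(u,v) \<in> K" "x \<in> {u..v}" "v - u < d"
        using cov[OF x] by blast
      then have "x \<in> cball (?a (u,v)) (?r (u,v))" "?r (u,v) < d"
        using K[OF uv(1)] unfolding cb by auto
      with uv show ?thesis by blast
    qed
  qed (use that in blast)
  let ?D = "(\<lambda>i. E \<inter> ?i i) ` C"
  have meas: "E \<inter> ?i i \<in> lmeasurable" for i
    by (cases i) (auto intro!: fmeasurable.Int E)
  obtain D' where D': "D' \<subseteq> ?D" "finite D'" "measure lebesgue (\<Union>?D) - e < measure lebesgue (\<Union>D')"
  proof (rule measure_countable_Union_approachable[of ?D e "measure lebesgue E"])
    show "countable ?D" using C by auto
    show "d \<in> lmeasurable" if "d \<in> ?D" for d using that meas by auto
    show "measure lebesgue (\<Union>D') \<le> measure lebesgue E" if "D' \<subseteq> ?D" "finite D'" for D'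
    proof (rule measure_mono_fmeasurable)
      show "\<Union>D' \<subseteq> E" using that by auto
      show "\<Union>D' \<in> sets lebesgue" using that meas by (intro sets.finite_Union) (auto intro: fmeasurableD)
    qed (rule E)
  qed (use \<open>e > 0\<close> that in blast)+
  obtain C' where C': "C' \<subseteq> C" "finite C'" "D' = (\<lambda>i. E \<inter> ?i i) ` C'"
    using finite_subset_image[OF D'(2,1)] by blast
  have UD: "\<Union>?D = E \<inter> (\<Union>i\<in>C. ?i i)" by auto
  have "E - E \<inter> (\<Union>i\<in>C. ?i i) = E - (\<Union>i\<in>C. cball (?a i) (?r i))" unfolding cb by auto
  then have neg: "negligible (E - E \<inter> (\<Union>i\<in>C. ?i i))" using C(4) by simp
  have "measure lebesgue (E \<inter> (\<Union>i\<in>C. ?i i)) = measure lebesgue E"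
    by (rule measure_negligible_symdiff[OF E, symmetric, THEN sym])
       (use neg in \<open>auto simp: Int_Un_distrib Diff_Int intro: negligible_subset\<close>)
  then have big: "measure lebesgue E - e < measure lebesgue (E \<inter> \<Union>(?i ` C'))"
  proof -
    have "\<Union>D' = E \<inter> \<Union>(?i ` C')" unfolding C'(3) by blast
    then show ?thesis using D'(3) \<open>measure lebesgue (E \<inter> (\<Union>i\<in>C. ?i i)) = measure lebesgue E\<close> unfolding UD by metis
  qed
  have disj: "disjoint (?i ` C')"
  proof (rule disjointI)
    fix k l assume "k \<in> ?i ` C'" "l \<in> ?i ` C'" "k \<noteq> l"
    then obtain i j where ij: "i \<in> C" "j \<in> C" "k = ?i i" "l = ?i j" "i \<noteq> j" using C'(1) by blast
    then have "disjnt (?i i) (?i j)" using C(3) unfolding pairwise_def cb by blast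
    then show "k \<inter> l = {}" unfolding ij(3,4) disjnt_def .
  qed
  have ne: "?i i \<noteq> {}" if "i \<in> C'" for i
    using that C'(1) C(2) K by (cases i) fastforce
  have "?i ` C' division_of \<Union>(?i ` C')"
  proof (rule division_ofI)
    fix k assume k: "k \<in> ?i ` C'"
    show "k \<noteq> {}" using k ne by auto
    show "\<exists>a b. k = cbox a b" using k by (auto simp: box_real)
    fix l assume "l \<in> ?i ` C'" "k \<noteq> l"
    then have "k \<inter> l = {}" using disjointD[OF disj k] by blast
    then show "interior k \<inter> interior l = {}" using interior_subset by blast
  qed (use C' in auto)
  with that[of "?i ` C'"] big disj C' C(2) show thesis by blast
qed


text \<open>
  The family \<open>G\<close> consists of the gaps that \<open>C2\<close> leaves in the intervals of \<open>C1\<close>. Increments telescope,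
  so the increment of every function over \<open>C1\<close> splits into those over \<open>C2\<close> and over the gaps.
\<close>

lemma division_refine:
  fixes C1 C2 :: "real set set"
  assumes C1: "C1 division_of \<Union>C1" "disjoint C1"
    and C2: "C2 division_of \<Union>C2" "\<And>k. k \<in> C2 \<Longrightarrow> \<exists>J\<in>C1. k \<subseteq> J"
  obtains G where "G division_of \<Union>G" "\<Union>G \<subseteq> \<Union>C1"
    "\<And>F :: real \<Rightarrow> real. (\<Sum>k\<in>C1. F (Sup k) - F (Inf k)) = (\<Sum>k\<in>C2. F (Sup k) - F (Inf k)) + (\<Sum>k\<in>G. F (Sup k) - F (Inf k))"
proof -
  define P where "P J = {k\<in>C2. k \<subseteq> J}" for J
  have fin: "finite C1" "finite C2" using C1 C2 by auto
  have form: "\<exists>a b. J = {a..b} \<and> a \<le> b" if "J \<in> C1" for J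
    using division_ofD(3,4)[OF C1(1) that] by (auto simp: atLeastatMost_empty_iff)
  have "\<exists>q. P J \<subseteq> q \<and> q division_of J" if "J \<in> C1" for J
  proof -
    obtain a b where J: "J = cbox a b" using form \<open>J \<in> C1\<close> by (metis box_real(2))
    have "P J division_of \<Union>(P J)" by (rule division_of_subset[OF C2(1)]) (auto simp: P_def)
    moreover have "\<Union>(P J) \<subseteq> cbox a b" using J by (auto simp: P_def)
    ultimately show ?thesis using partial_division_extend_interval J by metis
  qed
  then obtain q where q: "\<And>J. J \<in> C1 \<Longrightarrow> P J \<subseteq> q J" "\<And>J. J \<in> C1 \<Longrightarrow> q J division_of J"
    by metis
  define G where "G = (\<Union>J\<in>C1. q J - P J)"
  have ne: "k \<noteq> {}" "k \<subseteq> J" if "k \<in> q J" "J \<in> C1" for k J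
    using division_ofD(2,3)[OF q(2)] that by auto
  have disJ: "J = J'" if "k \<subseteq> J" "k \<subseteq> J'" "J \<in> C1" "J' \<in> C1" "k \<noteq> {}" for k J J'
    using disjointD[OF C1(2) that(3,4)] that by blast
  have disq: "q J \<inter> q J' = {}" if "J \<in> C1" "J' \<in> C1" "J \<noteq> J'" for J J'
    using ne disJ that by (metis disjoint_iff)
  have finq: "finite (q J)" if "J \<in> C1" for J using q(2)[OF that] by auto
  show thesis
  proof (rule that[of G])
    show "\<Union>G \<subseteq> \<Union>C1" unfolding G_def using ne by blast
    show "G division_of \<Union>G"
    proof (rule division_ofI)
      show "finite G" using fin finq by (auto simp: G_def)
      fix k assume "k \<in> G"
      then obtain J where J: "J \<in> C1" "k \<in> q J" by (auto simp: G_def)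
      show "k \<noteq> {}" "\<exists>a b. k = cbox a b" using division_ofD(3,4)[OF q(2)] J by auto
      fix l assume "l \<in> G" "k \<noteq> l"
      then obtain J' where J': "J' \<in> C1" "l \<in> q J'" by (auto simp: G_def)
      show "interior k \<inter> interior l = {}"
      proof (cases "J = J'")
        case True then show ?thesis using division_ofD(5)[OF q(2)] J J' \<open>k \<noteq> l\<close> by blast
      next
        case False
        then have "J \<inter> J' = {}" using disjointD[OF C1(2)] J J' by blast
        then show ?thesis using ne J J' interior_subset by blast
      qed
    qed auto
    fix F :: "real \<Rightarrow> real"
    let ?f = "\<lambda>k. F (Sup k) - F (Inf k)"
    have tel: "sum ?f (q J) = ?f J" if "J \<in> C1" for J
      using form[OF that] division_telescope q(2)[OF that] by auto
    have "(\<Sum>J\<in>C1. ?f J) = (\<Sum>J\<in>C1. sum ?f (P J) + sum ?f (q J - P J))"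
    proof (rule sum.cong[OF refl])
      fix J assume "J \<in> C1"
      then show "?f J = sum ?f (P J) + sum ?f (q J - P J)"
        using tel[of J] sum.subset_diff[OF q(1) finq, of J ?f] by simp
    qed
    also have "\<dots> = (\<Sum>J\<in>C1. sum ?f (P J)) + (\<Sum>J\<in>C1. sum ?f (q J - P J))"
      by (rule sum.distrib)
    also have "(\<Sum>J\<in>C1. sum ?f (q J - P J)) = sum ?f G"
      unfolding G_def by (rule sum.UNION_disjoint[symmetric]) (use fin finq disq in \<open>auto; blast\<close>)+
    also have "(\<Sum>J\<in>C1. sum ?f (P J)) = sum ?f (\<Union>J\<in>C1. P J)"
    proof (rule sum.UNION_disjoint[symmetric])
      show "\<forall>i\<in>C1. \<forall>j\<in>C1. i \<noteq> j \<longrightarrow> P i \<inter> P j = {}" using q(1) disq by blast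
    qed (use fin in \<open>auto simp: P_def\<close>)
    also have "(\<Union>J\<in>C1. P J) = C2" using C2(2) by (auto simp: P_def)
    finally show "(\<Sum>k\<in>C1. ?f k) = (\<Sum>k\<in>C2. ?f k) + (\<Sum>k\<in>G. ?f k)" .
  qed
qed

lemma division_length_eq_measure:
  fixes C :: "real set set"
  assumes "C division_of \<Union>C"
  shows "(\<Sum>k\<in>C. Sup k - Inf k) = measure lebesgue (\<Union>C)"
proof -
  have "measure lebesgue (\<Union>C) = (\<Sum>k\<in>C. measure lebesgue k)" using content_division[OF assms] by simp
  also have "\<dots> = (\<Sum>k\<in>C. Sup k - Inf k)"
  proof (rule sum.cong[OF refl])
    fix k assume "k \<in> C"
    then have "k \<noteq> {}" "\<exists>a b. k = cbox a b" using division_ofD(3,4)[OF assms] by auto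
    then obtain a b where "k = {a..b}" "a \<le> b"
      by (auto simp: atLeastatMost_empty_iff)
    then show "measure lebesgue k = Sup k - Inf k" by simp
  qed
  finally show ?thesis by simp
qed

section \<open>Differentiability almost everywhere\<close>

text \<open>
  The set where difference quotients over arbitrarily short intervals come to lie in \<open>T\<close>. Dini
  derivatives are avoided: a point where \<open>F\<close> fails to be differentiable is one where the
  quotients hit both \<open>{..<\<alpha>}\<close> and \<open>{\<beta><..}\<close> for some \<open>\<alpha> < \<beta>\<close>, or are unbounded.
\<close>

definition slopes_hit :: "(real \<Rightarrow> real) \<Rightarrow> real set \<Rightarrow> real set" where
  "slopes_hit F T = {x\<in>{0<..<1}. \<forall>d>0. \<exists>h. h \<noteq> 0 \<and> \<bar>h\<bar> < d \<and> x + h \<in> {0<..<1} \<and> (F (x + h) - F x) / h \<in> T}"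

text \<open>
  For a continuous \<open>F\<close> and a fixed step \<open>h\<close> the condition on the quotient is open in the base point, hence
  the set is a countable intersection of open sets.
\<close>

lemma slopes_hit_measurable:
  assumes F: "continuous_on {0..1} F" and T: "open T"
  shows "slopes_hit F T \<in> lmeasurable"
proof -
  define A where "A n h = {x \<in> {0<..<1} \<inter> {-h<..<1-h}. (F (x + h) - F x) / h \<in> T}" for n :: nat and h :: real
  let ?H = "\<lambda>n. {h. h \<noteq> 0 \<and> \<bar>h\<bar> < inverse (real (Suc n))}"
  have op: "open (A n h)" if "h \<noteq> 0" for n h
  proof -
    have "continuous_on ({0<..<1} \<inter> {-h<..<1-h}) (\<lambda>x. (F (x + h) - F x) / h)"
      by (intro continuous_intros continuous_on_compose2[OF F]) (use that in auto)
    from continuous_open_preimage[OF this _ T]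
    have "open (({0<..<1} \<inter> {-h<..<1-h}) \<inter> (\<lambda>x. (F (x + h) - F x) / h) -` T)" by (metis open_Int open_greaterThanLessThan)
    also have "({0<..<1} \<inter> {-h<..<1-h}) \<inter> (\<lambda>x. (F (x + h) - F x) / h) -` T = A n h" by (auto simp: A_def)
    finally show ?thesis .
  qed
  have eq: "slopes_hit F T = (\<Inter>n. \<Union>h\<in>?H n. A n h)"
  proof (intro equalityI subsetI)
    fix x assume "x \<in> slopes_hit F T"
    then have x: "x \<in> {0<..<1}" "\<And>d. d > 0 \<Longrightarrow> \<exists>h. h \<noteq> 0 \<and> \<bar>h\<bar> < d \<and> x + h \<in> {0<..<1} \<and> (F (x + h) - F x) / h \<in> T"
      by (auto simp: slopes_hit_def)
    show "x \<in> (\<Inter>n. \<Union>h\<in>?H n. A n h)"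
    proof
      fix n
      obtain h where "h \<noteq> 0" "\<bar>h\<bar> < inverse (real (Suc n))" "x + h \<in> {0<..<1}" "(F (x + h) - F x) / h \<in> T"
        using x(2)[of "inverse (real (Suc n))"] by auto
      then show "x \<in> (\<Union>h\<in>?H n. A n h)" using x(1) by (auto simp: A_def)
    qed
  next
    fix x assume x: "x \<in> (\<Inter>n. \<Union>h\<in>?H n. A n h)"
    show "x \<in> slopes_hit F T" unfolding slopes_hit_def
    proof (intro CollectI conjI allI impI)
      show "x \<in> {0<..<1}" using x by (auto simp: A_def)
      fix d :: real assume "d > 0"
      then obtain n where n: "inverse (real (Suc n)) < d" using reals_Archimedean by blast
      obtain h where "h \<in> ?H n" "x \<in> A n h" using x by blast
      then show "\<exists>h. h \<noteq> 0 \<and> \<bar>h\<bar> < d \<and> x + h \<in> {0<..<1} \<and> (F (x + h) - F x) / h \<in> T"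
        using n by (intro exI[of _ h]) (auto simp: A_def)
    qed
  qed
  have "open (\<Union>h\<in>?H n. A n h)" for n by (intro open_UN ballI op) auto
  then have "(\<Union>h\<in>?H n. A n h) \<in> sets lebesgue" for n
    by (metis borel_open sets_completionI_sets sets_lborel)
  then have "slopes_hit F T \<in> sets lebesgue" unfolding eq by (intro sets.countable_INT) auto
  moreover have "slopes_hit F T \<subseteq> {0..1}" by (auto simp: slopes_hit_def)
  ultimately show ?thesis by (metis bounded_set_imp_lmeasurable bounded_closed_interval bounded_subset)
qed

lemma slopes_hit_interval:
  assumes "x \<in> slopes_hit F T" "open V" "x \<in> V" "d > 0"
  obtains u v where "u < v" "{u..v} \<subseteq> V" "{u..v} \<subseteq> {0<..<1}" "x \<in> {u..v}" "v - u < d" "(F v - F u) / (v - u) \<in> T"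
proof -
  obtain e where e: "e > 0" "ball x e \<subseteq> V" using assms open_contains_ball by blast
  obtain h where h: "h \<noteq> 0" "\<bar>h\<bar> < min d e" "x + h \<in> {0<..<1}" "(F (x + h) - F x) / h \<in> T"
  proof -
    have "\<forall>d>0. \<exists>h. h \<noteq> 0 \<and> \<bar>h\<bar> < d \<and> x + h \<in> {0<..<1} \<and> (F (x + h) - F x) / h \<in> T"
      using assms(1) by (simp add: slopes_hit_def)
    moreover have "min d e > 0" using assms(4) e(1) by simp
    ultimately show thesis using that by blast
  qed
  have x: "x \<in> {0<..<1}" using assms(1) by (auto simp: slopes_hit_def)
  show thesis
  proof (cases "h > 0")
    case True
    show thesis
      by (rule that[of x "x+h"]) (use True h x e in \<open>auto simp: subset_iff dist_real_def\<close>)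
  next
    case False
    have "(F x - F (x + h)) / (x - (x+h)) = (F (x + h) - F x) / h" using h(1) by (simp add: field_simps)
    then have "(F x - F (x + h)) / (x - (x+h)) \<in> T" using h by simp
    then show thesis
      by (intro that[of "x+h" x]) (use False h x e in \<open>auto simp: subset_iff dist_real_def\<close>)
  qed
qed


text \<open>
  Cover the set \<open>E\<close> by disjoint intervals \<open>C1\<close> with slopes below \<open>\<alpha>\<close>, and then cover \<open>E\<close> again inside
  these by disjoint intervals \<open>C2\<close> with slopes above \<open>\<beta>\<close>. Both families have total length close to
  the measure of \<open>E\<close>, so the gaps between them are short and, by absolute continuity, the increments over
  \<open>C1\<close> and \<open>C2\<close> nearly agree. This forces \<open>\<beta> |E| \<le> \<alpha> |E|\<close>.
\<close>

lemma slopes_hit_two_negligible: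
  assumes F: "AC01 F" and ab: "\<alpha> < \<beta>"
  shows "negligible (slopes_hit F {..<\<alpha>} \<inter> slopes_hit F {\<beta><..})"
proof -
  let ?\<mu> = "measure lebesgue"
  define E where "E = slopes_hit F {..<\<alpha>} \<inter> slopes_hit F {\<beta><..}"
  have cont: "continuous_on {0..1} F" by (rule AC01_continuous[OF F])
  have Em: "E \<in> lmeasurable" unfolding E_def
    by (intro fmeasurable.Int slopes_hit_measurable cont) auto
  have sub01: "E \<subseteq> {0<..<1}" by (auto simp: E_def slopes_hit_def)
  let ?L = "\<lambda>C. \<Sum>k\<in>C. Sup k - Inf k :: real" and ?D = "\<lambda>C. \<Sum>k\<in>C. F (Sup k) - F (Inf k)"
  have key: "(\<beta> - \<alpha>) * ?\<mu> E \<le> 2 * (\<bar>\<alpha>\<bar> + \<bar>\<beta>\<bar>) * \<epsilon> + \<eta>" if "\<eta> > 0" and e: "\<epsilon> > 0" for \<eta> \<epsilon> :: real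
  proof -
    obtain d where d: "d > 0" and
      AC: "\<And>D. D division_of \<Union>D \<Longrightarrow> \<Union>D \<subseteq> {0..1} \<Longrightarrow> (\<Sum>k\<in>D. Sup k - Inf k) < d \<Longrightarrow>
       (\<Sum>k\<in>D. \<bar>F (Sup k) - F (Inf k)\<bar>) < \<eta>"
      using AC01_division[OF F \<open>\<eta> > 0\<close>] by blast
    \<comment> \<open>The gaps will have total length below \<open>3 t\<close>, which must not exceed \<open>d\<close>.\<close>
    define t where "t = min \<epsilon> (d / 4)"
    have t: "t > 0" "t \<le> \<epsilon>" "4 * t \<le> d" using d e by (auto simp: t_def)
    obtain U where U: "open U" "E \<subseteq> U" "U - E \<in> lmeasurable" "emeasure lebesgue (U - E) < ennreal t"
      using sets_lebesgue_outer_open[OF _ t(1)] Em fmeasurableD by metis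
    define V where "V = U \<inter> {0<..<1}"
    have V: "open V" "E \<subseteq> V" "V \<subseteq> {0<..<1}" using U sub01 by (auto simp: V_def)
    have "V \<subseteq> {0..1}" using V(3) by auto
    then have Vm: "V \<in> lmeasurable"
      by (intro lmeasurable_open V(1)) (rule bounded_subset[OF bounded_closed_interval])
    have "?\<mu> V \<le> ?\<mu> (E \<union> (U - E))"
      by (rule measure_mono_fmeasurable) (use V Vm fmeasurableD fmeasurable.Un[OF Em U(3)] in \<open>auto simp: V_def\<close>)
    also have "\<dots> \<le> ?\<mu> E + ?\<mu> (U - E)"
      by (rule measure_Un_le) (use Em U(3) fmeasurableD in auto)
    also have "?\<mu> (U - E) < t"
      using U(3,4) t(1) by (simp add: emeasure_eq_measure2 ennreal_less_iff)
    finally have muV: "?\<mu> V < ?\<mu> E + t" by simp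
    define K1 where "K1 = {(u,v). u < v \<and> {u..v} \<subseteq> V \<and> F v - F u < \<alpha> * (v - u)}"
    obtain C1 where C1: "finite C1" "C1 \<subseteq> (\<lambda>(u,v). {u..v}) ` K1" "C1 division_of \<Union>C1" "disjoint C1"
      "?\<mu> E - t < ?\<mu> (E \<inter> \<Union>C1)"
    proof (rule Vitali_finite[OF Em t(1), of K1])
      fix x d assume x: "x \<in> E" and d: "(d::real) > 0"
      have x': "x \<in> slopes_hit F {..<\<alpha>}" "x \<in> V" using x V by (auto simp: E_def)
      obtain u v where "u < v" "{u..v} \<subseteq> V" "{u..v} \<subseteq> {0<..<1}" "x \<in> {u..v}" "v - u < d" "(F v - F u) / (v - u) \<in> {..<\<alpha>}"
        by (rule slopes_hit_interval[OF x'(1) V(1) x'(2) d])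
      then show "\<exists>u v. (u,v) \<in> K1 \<and> x \<in> {u..v} \<and> v - u < d"
        by (intro exI[of _ u] exI[of _ v]) (auto simp: K1_def field_simps)
    qed (auto simp: K1_def)
    have C1k: "\<exists>u v. k = {u..v} \<and> u < v \<and> {u..v} \<subseteq> V \<and> F v - F u < \<alpha> * (v - u)" if "k \<in> C1" for k
      using C1(2) that by (auto simp: K1_def)
    have UC1: "\<Union>C1 \<subseteq> V" using C1k by blast
    \<comment> \<open>The second covering takes place in the open interiors, so that its intervals fit into those of \<open>C1\<close>.\<close>
    define W where "W = (\<Union>k\<in>C1. interior k)"
    have oW: "open W" by (auto simp: W_def)
    have Wm: "E \<inter> W \<in> lmeasurable"
      by (intro fmeasurable_Int_fmeasurable Em) (metis oW borel_open sets_completionI_sets sets_lborel)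
    have "\<Union>C1 - W \<subseteq> Inf ` C1 \<union> Sup ` C1"
    proof
      fix x assume "x \<in> \<Union>C1 - W"
      then obtain k where k: "k \<in> C1" "x \<in> k" "x \<notin> interior k" by (auto simp: W_def)
      obtain u v where uv: "k = {u..v}" "u < v" using C1k[OF k(1)] by blast
      then have "x = Inf k \<or> x = Sup k" using k(2,3) by (auto simp: interior_atLeastAtMost_real)
      then show "x \<in> Inf ` C1 \<union> Sup ` C1" using k(1) by auto
    qed
    then have negW: "negligible (\<Union>C1 - W)"
      using C1(1) by (meson finite_UnI finite_imageI negligible_finite negligible_subset)
    have "?\<mu> (E \<inter> W) = ?\<mu> (E \<inter> \<Union>C1)"
    proof (rule measure_negligible_symdiff[OF Wm, symmetric])
      have "W \<subseteq> \<Union>C1" using interior_subset by (auto simp: W_def)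
      then show "negligible (E \<inter> W - E \<inter> \<Union>C1 \<union> (E \<inter> \<Union>C1 - E \<inter> W))"
        by (intro negligible_subset[OF negW]) auto
    qed
    then have muW: "?\<mu> E - t < ?\<mu> (E \<inter> W)" using C1(5) by simp
    define K2 where "K2 = {(u,v). u < v \<and> (\<exists>k\<in>C1. {u..v} \<subseteq> k) \<and> \<beta> * (v - u) < F v - F u}"
    obtain C2 where C2: "finite C2" "C2 \<subseteq> (\<lambda>(u,v). {u..v}) ` K2" "C2 division_of \<Union>C2" "disjoint C2"
      "?\<mu> (E \<inter> W) - t < ?\<mu> (E \<inter> W \<inter> \<Union>C2)"
    proof (rule Vitali_finite[OF Wm t(1), of K2])
      fix x d assume x: "x \<in> E \<inter> W" and d: "(d::real) > 0"
      then obtain k where k: "k \<in> C1" "x \<in> interior k" by (auto simp: W_def)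
      have x': "x \<in> slopes_hit F {\<beta><..}" using x by (auto simp: E_def)
      obtain u v where "u < v" "{u..v} \<subseteq> interior k" "{u..v} \<subseteq> {0<..<1}" "x \<in> {u..v}" "v - u < d" "(F v - F u) / (v - u) \<in> {\<beta><..}"
        by (rule slopes_hit_interval[OF x' open_interior k(2) d])
      then show "\<exists>u v. (u,v) \<in> K2 \<and> x \<in> {u..v} \<and> v - u < d"
        using k(1) interior_subset[of k] by (intro exI[of _ u] exI[of _ v]) (auto simp: K2_def field_simps; blast)
    qed (auto simp: K2_def)
    have C2k: "\<exists>u v. k = {u..v} \<and> u < v \<and> (\<exists>J\<in>C1. k \<subseteq> J) \<and> \<beta> * (v - u) < F v - F u" if "k \<in> C2" for k
    proof -
      have "k \<in> (\<lambda>(u,v). {u..v}) ` K2" using C2(2) that by blast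
      then obtain u v where uv: "k = {u..v}" "(u,v) \<in> K2" by auto
      then show ?thesis unfolding K2_def by blast
    qed
    have ex: "\<exists>J\<in>C1. k \<subseteq> J" if "k \<in> C2" for k using C2k[OF that] by blast
    obtain G where G: "G division_of \<Union>G" "\<Union>G \<subseteq> \<Union>C1"
      "\<And>F :: real \<Rightarrow> real. (\<Sum>k\<in>C1. F (Sup k) - F (Inf k)) = (\<Sum>k\<in>C2. F (Sup k) - F (Inf k)) + (\<Sum>k\<in>G. F (Sup k) - F (Inf k))"
      by (rule division_refine[OF C1(3,4) C2(3) ex]) (assumption | rule that)+
    have sC2: "\<Union>C2 \<subseteq> \<Union>C1" using C2k by blast
    have mC: "\<Union>C1 \<in> sets lebesgue" "\<Union>C2 \<in> sets lebesgue"
      using C1(3) C2(3) lmeasurable_division fmeasurableD by blast+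
    have L1: "?L C1 \<le> ?\<mu> V"
      unfolding division_length_eq_measure[OF C1(3)] by (rule measure_mono_fmeasurable[OF UC1 mC(1) Vm])
    have L2: "?\<mu> (E \<inter> W \<inter> \<Union>C2) \<le> ?L C2"
      unfolding division_length_eq_measure[OF C2(3)]
      by (rule measure_mono_fmeasurable) (use mC Wm fmeasurableD C2(3) lmeasurable_division in blast)+
    have L12: "?L C1 = ?L C2 + ?L G" using G(3)[of "\<lambda>x. x"] .
    have Ggood: "\<bar>?D G\<bar> < \<eta>"
    proof -
      have "?L G < d" using L12 L1 L2 muV muW C2(5) t by linarith
      then have "(\<Sum>k\<in>G. \<bar>F (Sup k) - F (Inf k)\<bar>) < \<eta>"
        using AC[OF G(1)] G(2) UC1 V(3) by (meson greaterThanLessThan_subseteq_atLeastAtMost_iff order_refl order_trans)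
      then show ?thesis using sum_abs[of "\<lambda>k. F (Sup k) - F (Inf k)" G] by linarith
    qed
    have "?L G \<ge> 0" unfolding division_length_eq_measure[OF G(1)] by simp
    then have L: "\<bar>?L C1 - ?\<mu> E\<bar> \<le> 2 * t" "\<bar>?L C2 - ?\<mu> E\<bar> \<le> 2 * t"
      using L12 L1 L2 muV muW C2(5) t by linarith+
    have "?D C1 \<le> (\<Sum>k\<in>C1. \<alpha> * (Sup k - Inf k))"
    proof (rule sum_mono)
      fix k assume "k \<in> C1" then show "F (Sup k) - F (Inf k) \<le> \<alpha> * (Sup k - Inf k)"
        using C1k[of k] by auto
    qed
    then have D1: "?D C1 \<le> \<alpha> * ?L C1" by (simp add: sum_distrib_left)
    have "(\<Sum>k\<in>C2. \<beta> * (Sup k - Inf k)) \<le> ?D C2"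
    proof (rule sum_mono)
      fix k assume "k \<in> C2" then show "\<beta> * (Sup k - Inf k) \<le> F (Sup k) - F (Inf k)"
        using C2k[of k] by auto
    qed
    then have D2: "\<beta> * ?L C2 \<le> ?D C2" by (simp add: sum_distrib_left)
    have "\<beta> * ?L C2 \<le> \<alpha> * ?L C1 + \<eta>" using D1 D2 G(3)[of F] Ggood by linarith
    moreover have "\<bar>\<alpha> * (?L C1 - ?\<mu> E)\<bar> \<le> \<bar>\<alpha>\<bar> * (2 * t)" "\<bar>\<beta> * (?L C2 - ?\<mu> E)\<bar> \<le> \<bar>\<beta>\<bar> * (2 * t)"
      unfolding abs_mult by (intro mult_left_mono L abs_ge_zero)+
    moreover have "\<bar>\<alpha>\<bar> * (2 * t) + \<bar>\<beta>\<bar> * (2 * t) \<le> 2 * (\<bar>\<alpha>\<bar> + \<bar>\<beta>\<bar>) * \<epsilon>"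
    proof -
      have "(\<bar>\<alpha>\<bar> + \<bar>\<beta>\<bar>) * (2 * t) \<le> (\<bar>\<alpha>\<bar> + \<bar>\<beta>\<bar>) * (2 * \<epsilon>)" using t by (intro mult_left_mono) auto
      then show ?thesis by (simp add: algebra_simps)
    qed
    ultimately show ?thesis by (simp add: algebra_simps abs_le_iff)
  qed
  have "(\<beta> - \<alpha>) * ?\<mu> E \<le> 0 + e" if "e > 0" for e
  proof -
    define q where "q = \<bar>\<alpha>\<bar> + \<bar>\<beta>\<bar>"
    have "q > 0" using ab by (auto simp: q_def)
    then show ?thesis using key[of "e/2" "e / (4 * q)"] that unfolding q_def[symmetric] by (simp add: field_simps)
  qed
  then have "(\<beta> - \<alpha>) * ?\<mu> E \<le> 0" by (rule field_le_epsilon)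
  then have "?\<mu> E = 0" using ab measure_nonneg[of lebesgue E] by (simp add: mult_le_0_iff)
  then show ?thesis using Em unfolding E_def[symmetric] by (simp add: negligible_iff_measure)
qed

text \<open>
  On an interval so short that all families inside it have variation below 1, intervals whose slope has modulus at
  least \<open>n\<close> have total length at most \<open>1/n\<close>. Negligibility is a local property.
\<close>

lemma slopes_hit_unbounded_negligible:
  assumes F: "AC01 F"
  shows "negligible (\<Inter>n. slopes_hit F {y. \<bar>y\<bar> > real n})" (is "negligible ?S")
proof -
  let ?\<mu> = "measure lebesgue"
  have cont: "continuous_on {0..1} F" by (rule AC01_continuous[OF F])
  obtain d where d: "d > 0" and
    AC: "\<And>D. D division_of \<Union>D \<Longrightarrow> \<Union>D \<subseteq> {0..1} \<Longrightarrow> (\<Sum>k\<in>D. Sup k - Inf k) < d \<Longrightarrow>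
       (\<Sum>k\<in>D. \<bar>F (Sup k) - F (Inf k)\<bar>) < 1"
    using AC01_division[OF F zero_less_one] by blast
  have op: "open {y::real. \<bar>y\<bar> > real n}" for n by (intro open_Collect_less continuous_intros)
  have Em: "slopes_hit F {y. \<bar>y\<bar> > real n} \<in> lmeasurable" for n
    by (intro slopes_hit_measurable cont op)
  have loc: "negligible (?S \<inter> {a<..<b})" if ab: "b - a < d" for a b
  proof -
    define E where "E n = slopes_hit F {y. \<bar>y\<bar> > real n} \<inter> {a<..<b}" for n
    have EM: "E n \<in> lmeasurable" for n unfolding E_def by (intro fmeasurable.Int Em) simp
    have key: "real n * ?\<mu> (E n) \<le> 1 + real n * t" if t: "t > 0" for n and t :: real
    proof -
      define K where "K = {(u,v). u < v \<and> {u..v} \<subseteq> {a<..<b} \<and> {u..v} \<subseteq> {0<..<1} \<and> \<bar>F v - F u\<bar> > real n * (v - u)}"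
      obtain C where C: "finite C" "C \<subseteq> (\<lambda>(u,v). {u..v}) ` K" "C division_of \<Union>C" "disjoint C"
      "?\<mu> (E n) - t < ?\<mu> (E n \<inter> \<Union>C)"
      proof (rule Vitali_finite[OF EM t, where K=K])
        fix x d assume x: "x \<in> E n" and d: "(d::real) > 0"
        obtain u v where "u < v" "{u..v} \<subseteq> {a<..<b}" "{u..v} \<subseteq> {0<..<1}" "x \<in> {u..v}" "v - u < d" "(F v - F u) / (v - u) \<in> {y. \<bar>y\<bar> > real n}"
          by (rule slopes_hit_interval[OF _ open_greaterThanLessThan _ d, of x F "{y. \<bar>y\<bar> > real n}" a b]) (use x in \<open>auto simp: E_def\<close>)
        then show "\<exists>u v. (u,v) \<in> K \<and> x \<in> {u..v} \<and> v - u < d"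
          by (intro exI[of _ u] exI[of _ v]) (auto simp: K_def field_simps abs_divide)
      qed (auto simp: K_def)
      have Ck: "\<exists>u v. k = {u..v} \<and> u < v \<and> {u..v} \<subseteq> {a<..<b} \<and> {u..v} \<subseteq> {0<..<1} \<and> \<bar>F v - F u\<bar> > real n * (v - u)" if "k \<in> C" for k
        using C(2) that by (auto simp: K_def)
      have s: "\<Union>C \<subseteq> {a<..<b}" "\<Union>C \<subseteq> {0..1}" using Ck by fastforce+
      have mC: "\<Union>C \<in> lmeasurable" using C(3) lmeasurable_division by blast
      show ?thesis
      proof (cases "C = {}")
        case True
        then have "?\<mu> (E n) < t" using C(5) by simp
        then show ?thesis by (smt (verit, best) mult_left_mono of_nat_0_le_iff)
      next
        case False
        then have "a < b" using Ck by fastforce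
        have "?\<mu> (\<Union>C) \<le> ?\<mu> {a<..<b}"
          by (rule measure_mono_fmeasurable[OF s(1)]) (use mC fmeasurableD in auto)
        then have "?\<mu> (\<Union>C) < d" using \<open>a < b\<close> ab by simp
        then have 1: "(\<Sum>k\<in>C. \<bar>F (Sup k) - F (Inf k)\<bar>) < 1"
          using AC[OF C(3) s(2)] division_length_eq_measure[OF C(3)] by simp
        have "(\<Sum>k\<in>C. real n * (Sup k - Inf k)) \<le> (\<Sum>k\<in>C. \<bar>F (Sup k) - F (Inf k)\<bar>)"
        proof (rule sum_mono)
          fix k assume "k \<in> C" then show "real n * (Sup k - Inf k) \<le> \<bar>F (Sup k) - F (Inf k)\<bar>" using Ck[of k] by auto
        qed
        then have "real n * ?\<mu> (\<Union>C) \<le> 1"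
          using 1 division_length_eq_measure[OF C(3)] by (simp add: sum_distrib_left[symmetric])
        moreover have "?\<mu> (E n \<inter> \<Union>C) \<le> ?\<mu> (\<Union>C)"
          by (rule measure_mono_fmeasurable) (use mC EM fmeasurableD in auto)
        moreover have "real n * ?\<mu> (E n) \<le> real n * (?\<mu> (\<Union>C) + t)"
          by (rule mult_left_mono) (use calculation(2) C(5) in auto)
        ultimately show ?thesis by (simp add: algebra_simps)
      qed
    qed
    have key2: "real n * ?\<mu> (E n) \<le> 1" for n
    proof (rule field_le_epsilon)
      fix e :: real assume "e > 0"
      then show "real n * ?\<mu> (E n) \<le> 1 + e"
        using key[of "e / (real n + 1)" n] by (smt (verit) divide_pos_pos mult.commute mult_left_mono nonzero_eq_divide_eq of_nat_0_le_iff)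
    qed
    have Sm: "?S \<inter> {a<..<b} \<in> sets lebesgue"
      using fmeasurableD[OF Em] by (intro sets.Int sets.countable_INT) auto
    have sub: "?S \<inter> {a<..<b} \<subseteq> E n" for n by (auto simp: E_def)
    have Sm': "?S \<inter> {a<..<b} \<in> lmeasurable" by (rule fmeasurableI2[OF EM sub Sm])
    have le: "real n * ?\<mu> (?S \<inter> {a<..<b}) \<le> 1" for n
    proof -
      have "?\<mu> (?S \<inter> {a<..<b}) \<le> ?\<mu> (E n)" by (rule measure_mono_fmeasurable[OF sub Sm EM])
      then show ?thesis using key2[of n] by (meson mult_left_mono of_nat_0_le_iff order_trans)
    qed
    have "?\<mu> (?S \<inter> {a<..<b}) = 0"
    proof (rule ccontr)
      assume "?\<mu> (?S \<inter> {a<..<b}) \<noteq> 0"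
      then have pos: "?\<mu> (?S \<inter> {a<..<b}) > 0" using measure_nonneg[of lebesgue "?S \<inter> {a<..<b}"] by linarith
      then obtain n where "1 < real n * ?\<mu> (?S \<inter> {a<..<b})" using reals_Archimedean3 by blast
      then show False using le[of n] by simp
    qed
    then show ?thesis using Sm' by (simp add: negligible_iff_measure)
  qed
  show ?thesis
  proof (subst locally_negligible_alt, intro ballI)
    fix x assume x: "x \<in> ?S"
    show "\<exists>U. openin (top_of_set ?S) U \<and> x \<in> U \<and> negligible U"
    proof (intro exI conjI)
      show "openin (top_of_set ?S) (?S \<inter> {x - d/4<..<x + d/4})" by (intro openin_open_Int) auto
      show "x \<in> ?S \<inter> {x - d/4<..<x + d/4}" using x d by auto
      show "negligible (?S \<inter> {x - d/4<..<x + d/4})" by (rule loc) (use d in auto)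
    qed
  qed
qed


lemma tendsto_if_no_oscillation:
  fixes q :: "'a \<Rightarrow> real"
  assumes ne: "Fl \<noteq> bot"
    and osc: "\<And>a b. a < b \<Longrightarrow> eventually (\<lambda>h. a \<le> q h) Fl \<or> eventually (\<lambda>h. q h \<le> b) Fl"
    and bd: "eventually (\<lambda>h. \<bar>q h\<bar> \<le> B) Fl"
  shows "\<exists>l. (q \<longlongrightarrow> l) Fl"
proof -
  define A where "A = {a. eventually (\<lambda>h. a \<le> q h) Fl}"
  have ub: "a \<le> B" if "a \<in> A" for a
  proof -
    have "eventually (\<lambda>h. a \<le> B) Fl"
      using bd that[unfolded A_def mem_Collect_eq] by eventually_elim auto
    then show ?thesis using ne by (simp add: eventually_const)
  qed
  then have bdd: "bdd_above A" by (meson bdd_above.I)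
  have "-B \<in> A" unfolding A_def using bd by (auto elim: eventually_mono)
  then have neA: "A \<noteq> {}" by auto
  have "(q \<longlongrightarrow> Sup A) Fl"
  proof (rule order_tendstoI)
    fix a assume "a < Sup A"
    then obtain a' where "a' \<in> A" "a < a'" using less_cSup_iff[OF neA bdd] by blast
    then show "eventually (\<lambda>h. a < q h) Fl" by (auto simp: A_def elim: eventually_mono)
  next
    fix a assume a: "Sup A < a"
    define b c where "b = (2 * Sup A + a) / 3" and "c = (Sup A + 2 * a) / 3"
    have bc: "Sup A < b" "b < c" "c < a" using a by (auto simp: b_def c_def)
    then have "b \<notin> A" using cSup_upper[OF _ bdd] by force
    then have "eventually (\<lambda>h. q h \<le> c) Fl" using osc[OF bc(2)] by (auto simp: A_def)
    then show "eventually (\<lambda>h. q h < a) Fl" by eventually_elim (use bc in auto)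
  qed
  then show ?thesis by blast
qed

lemma not_slopes_hit_eventually:
  assumes "x \<in> {0<..<1}" "x \<notin> slopes_hit F T"
  shows "eventually (\<lambda>h. (F (x + h) - F x) / h \<notin> T) (at 0)"
proof -
  obtain d where d: "d > 0" "\<And>h. h \<noteq> 0 \<Longrightarrow> \<bar>h\<bar> < d \<Longrightarrow> x + h \<in> {0<..<1} \<Longrightarrow> (F (x + h) - F x) / h \<notin> T"
    using assms unfolding slopes_hit_def by blast
  have "eventually (\<lambda>h. dist h 0 < min d (min x (1 - x)) \<and> h \<noteq> 0) (at 0)"
    unfolding eventually_at using assms(1) d(1) by (intro exI[of _ "min d (min x (1 - x))"]) auto
  then show ?thesis
  proof eventually_elim
    case (elim h)
    then have "x + h \<in> {0<..<1}" using assms(1) by auto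
    then show ?case using d(2)[of h] elim by auto
  qed
qed

text \<open>
  Rational thresholds suffice to detect an oscillation of the difference quotients, so the exceptional set is a
  countable union of negligible sets.
\<close>

theorem AC01_differentiable_ae:
  assumes F: "AC01 F"
  obtains N where "negligible N" "\<And>x. x \<in> {0..1} - N \<Longrightarrow> F differentiable (at x)"
proof -
  define N where "N = {0,1} \<union> (\<Inter>n. slopes_hit F {y. \<bar>y\<bar> > real n})
     \<union> (\<Union>(a,b)\<in>{(a,b). a \<in> \<rat> \<and> b \<in> \<rat> \<and> a < b}. slopes_hit F {..<a} \<inter> slopes_hit F {b<..})"
  have "countable {(a,b). a \<in> \<rat> \<and> b \<in> \<rat> \<and> a < (b::real)}"
    by (rule countable_subset[of _ "\<rat> \<times> \<rat>"]) (auto simp: countable_rat)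
  then have "negligible N" unfolding N_def
    by (intro negligible_Un slopes_hit_unbounded_negligible[OF F] negligible_countable_Union countable_image)
       (auto intro: slopes_hit_two_negligible[OF F])
  moreover have "F differentiable (at x)" if x: "x \<in> {0..1} - N" for x
  proof -
    have x01: "x \<in> {0<..<1}" using x by (auto simp: N_def order_less_le)
    obtain n where n: "x \<notin> slopes_hit F {y. \<bar>y\<bar> > real n}" using x by (auto simp: N_def)
    have "\<exists>l. ((\<lambda>h. (F (x + h) - F x) / h) \<longlongrightarrow> l) (at 0)"
    proof (rule tendsto_if_no_oscillation)
      show "\<forall>\<^sub>F h in at 0. \<bar>(F (x + h) - F x) / h\<bar> \<le> real n"
        using not_slopes_hit_eventually[OF x01 n] by eventually_elim auto
      fix a b :: real assume "a < b"
      obtain a' where a': "a' \<in> \<rat>" "a < a'" "a' < b" using Rats_dense_in_real[OF \<open>a < b\<close>] by blast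
      obtain b' where b': "b' \<in> \<rat>" "a' < b'" "b' < b" using Rats_dense_in_real[OF a'(3)] by blast
      have "x \<notin> slopes_hit F {..<a'} \<or> x \<notin> slopes_hit F {b'<..}"
        using x a' b' unfolding N_def by blast
      then show "(\<forall>\<^sub>F h in at 0. a \<le> (F (x + h) - F x) / h) \<or> (\<forall>\<^sub>F h in at 0. (F (x + h) - F x) / h \<le> b)"
      proof
        assume "x \<notin> slopes_hit F {..<a'}"
        from not_slopes_hit_eventually[OF x01 this] have "\<forall>\<^sub>F h in at 0. a \<le> (F (x + h) - F x) / h"
          by eventually_elim (use a' in auto)
        then show ?thesis ..
      next
        assume "x \<notin> slopes_hit F {b'<..}"
        from not_slopes_hit_eventually[OF x01 this] have "\<forall>\<^sub>F h in at 0. (F (x + h) - F x) / h \<le> b"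
          by eventually_elim (use b' in auto)
        then show ?thesis ..
      qed
    qed auto
    then obtain l where "((\<lambda>h. (F (x + h) - F x) / h) \<longlongrightarrow> l) (at 0)" by blast
    then show ?thesis unfolding DERIV_def[symmetric] by (auto simp: real_differentiable_def)
  qed
  ultimately show thesis by (rule that)
qed


section \<open>The fundamental theorem of calculus for absolutely continuous functions\<close>

text \<open>
  In a tagged division distinct tags may carry the same degenerate interval; its increment is zero, so the
  sum over tags equals the sum over the underlying intervals.
\<close>

lemma tagged_sum_lt:
  fixes F :: "real \<Rightarrow> real"
  assumes d: "d > 0" and AC: "\<And>D. D division_of \<Union>D \<Longrightarrow> \<Union>D \<subseteq> {0..1} \<Longrightarrow> (\<Sum>k\<in>D. Sup k - Inf k) < d \<Longrightarrow>
       (\<Sum>k\<in>D. \<bar>F (Sup k) - F (Inf k)\<bar>) < e"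
    and p: "p tagged_partial_division_of {a..b}" and ab: "{a..b} \<subseteq> {0..1}"
    and T: "T \<in> lmeasurable" "measure lebesgue T < d" "\<And>x k. (x,k) \<in> p \<Longrightarrow> k \<subseteq> T"
  shows "(\<Sum>(x,k)\<in>p. \<bar>F (Sup k) - F (Inf k)\<bar>) < e"
proof -
  let ?g = "\<lambda>k. if k = {} then 0 else \<bar>F (Sup k) - F (Inf k)\<bar>"
  have p': "p tagged_division_of \<Union>(snd ` p)"
    using tagged_partial_division_of_Union_self[OF p] .
  have D: "snd ` p division_of \<Union>(snd ` p)" by (rule division_of_tagged_division[OF p'])
  have sub: "\<Union>(snd ` p) \<subseteq> T" using T(3) by clarsimp (meson subsetD)
  have sub1: "\<Union>(snd ` p) \<subseteq> {0..1}" using tagged_partial_division_ofD(3)[OF p] ab by fastforce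
  have "measure lebesgue (\<Union>(snd ` p)) \<le> measure lebesgue T"
    by (rule measure_mono_fmeasurable[OF sub]) (use T D lmeasurable_division fmeasurableD in blast)+
  then have "(\<Sum>k\<in>snd ` p. \<bar>F (Sup k) - F (Inf k)\<bar>) < e"
    using AC[OF D sub1] T(2) division_length_eq_measure[OF D] by simp
  also have "(\<Sum>k\<in>snd ` p. \<bar>F (Sup k) - F (Inf k)\<bar>) = sum ?g (snd ` p)"
    by (rule sum.cong) (use division_ofD(3)[OF D] in auto)
  also have "sum ?g (snd ` p) = (\<Sum>(x,k)\<in>p. ?g k)"
    by (rule sum.over_tagged_division_lemma[OF p', symmetric]) (auto simp: box_real)
  also have "\<dots> = (\<Sum>(x,k)\<in>p. \<bar>F (Sup k) - F (Inf k)\<bar>)"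
    by (rule sum.cong) (use tagged_partial_division_ofD(2)[OF p] in fastforce)+
  finally show ?thesis .
qed

text \<open>
  The gauge forces an interval whose tag lies in the null set \<open>N\<close> into an open set so small that
  absolute continuity controls all these increments together; every other interval is controlled by the derivative at its tag.
\<close>

theorem AC01_FTC:
  assumes F: "AC01 F" and N: "negligible N"
    and F': "\<And>x. x \<in> {0..1} - N \<Longrightarrow> (F has_vector_derivative F' x) (at x within {0..1})"
    and ab: "0 \<le> a" "a \<le> b" "b \<le> 1"
  shows "(F' has_integral F b - F a) {a..b}"
proof -
  define f where "f x = (if x \<in> N then 0 else F' x)" for x
  have "(f has_integral F b - F a) {a..b}"
    unfolding has_integral_real
  proof (intro allI impI)
    fix e :: real assume e: "e > 0"
    then have "e / 2 > 0" by simp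
    from AC01_division[OF F this] obtain d where d: "d > 0" and
      AC: "\<And>D. D division_of \<Union>D \<Longrightarrow> \<Union>D \<subseteq> {0..1} \<Longrightarrow> (\<Sum>k\<in>D. Sup k - Inf k) < d \<Longrightarrow>
       (\<Sum>k\<in>D. \<bar>F (Sup k) - F (Inf k)\<bar>) < e/2"
      by blast
    have Nl: "N \<in> sets lebesgue" using N by (simp add: negligible_imp_sets)
    obtain T where T: "open T" "N \<subseteq> T" "T - N \<in> lmeasurable" "emeasure lebesgue (T - N) < ennreal d"
      using sets_lebesgue_outer_open[OF Nl d] by metis
    have NT: "negligible (T - N \<union> N - (T - N))" by (rule negligible_subset[OF N]) auto
    have TN: "T = (T - N) \<union> N" using T(2) by auto
    have Nm: "N \<in> lmeasurable" "measure lebesgue N = 0" using N by (auto simp: negligible_iff_measure)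
    have Tm: "T \<in> lmeasurable" by (subst TN) (intro fmeasurable.Un T(3) Nm)
    have "measure lebesgue T \<le> measure lebesgue (T - N) + measure lebesgue N"
      by (subst TN) (rule measure_Un_le, use T(3) Nm fmeasurableD in auto)
    also have "measure lebesgue (T - N) < d"
      using T(3,4) d by (simp add: emeasure_eq_measure2 ennreal_less_iff)
    finally have Td: "measure lebesgue T < d" using Nm(2) by simp
    have "\<exists>r>0. \<forall>y\<in>{0..1}. \<bar>y - x\<bar> < r \<longrightarrow> \<bar>F y - F x - F' x * (y - x)\<bar> \<le> e/4 * \<bar>y - x\<bar>" if "x \<in> {0..1} - N" for x
      using F'[OF that] e unfolding has_vector_derivative_def has_derivative_within_alt
      by (auto simp: mult.commute dest!: spec[of _ "e/4"])
    then obtain r where r: "\<And>x. x \<in> {0..1} - N \<Longrightarrow> r x > 0"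
      "\<And>x y. x \<in> {0..1} - N \<Longrightarrow> y \<in> {0..1} \<Longrightarrow> \<bar>y - x\<bar> < r x \<Longrightarrow> \<bar>F y - F x - F' x * (y - x)\<bar> \<le> e/4 * \<bar>y - x\<bar>"
      by metis
    \<comment> \<open>At points outside \<open>[0,1]\<close>, which are never tags, the gauge is arbitrary.\<close>
    define \<gamma> where "\<gamma> x = (if x \<in> N then T else if x \<in> {0..1} then ball x (r x) else UNIV)" for x
    have g: "gauge \<gamma>" unfolding gauge_def \<gamma>_def using T r(1) by auto
    have main: "norm ((\<Sum>(x, k)\<in>p. measure lborel k *\<^sub>R f x) - (F b - F a)) < e"
      if p: "p tagged_division_of {a..b}" and fine: "\<gamma> fine p" for p
    proof -
      have finp: "finite p" using p by auto
      define A where "A = {(x,k)\<in>p. x \<in> N}"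
      have Ap: "A \<subseteq> p" by (auto simp: A_def)
      have pk: "\<exists>u v. k = {u..v} \<and> u \<le> v \<and> x \<in> k \<and> {u..v} \<subseteq> {a..b}" if "(x,k) \<in> p" for x k
        using tagged_division_ofD(2,3,4)[OF p that] by (auto simp: box_real)
      have tel: "(\<Sum>(x, k)\<in>p. F (Sup k) - F (Inf k)) = F b - F a"
        by (rule additive_tagged_division_1[OF ab(2) p])
      have tel2: "(\<Sum>(x, k)\<in>p. Sup k - Inf k) = b - a"
        by (rule additive_tagged_division_1[OF ab(2) p])
      let ?h = "\<lambda>(x,k). measure lborel k *\<^sub>R f x - (F (Sup k) - F (Inf k))"
      have "(\<Sum>(x, k)\<in>p. measure lborel k *\<^sub>R f x) - (F b - F a) = sum ?h p"
        unfolding tel[symmetric] by (simp add: sum_subtractf split_def)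
      also have "\<dots> = sum ?h A + sum ?h (p - A)"
        using sum.subset_diff[OF Ap finp, of ?h] by simp
      finally have eq: "(\<Sum>(x, k)\<in>p. measure lborel k *\<^sub>R f x) - (F b - F a) = sum ?h A + sum ?h (p - A)" .
      have "\<bar>sum ?h A\<bar> \<le> (\<Sum>(x,k)\<in>A. \<bar>F (Sup k) - F (Inf k)\<bar>)"
        by (rule order_trans[OF sum_abs]) (rule sum_mono, auto simp: A_def f_def)
      also have "\<dots> < e/2"
      proof (rule tagged_sum_lt[OF d AC _ _ Tm Td])
        show "A tagged_partial_division_of {a..b}"
          using p Ap tagged_partial_division_subset unfolding tagged_division_of_def by blast
        show "k \<subseteq> T" if "(x,k) \<in> A" for x k
          using fineD[OF fine, of x k] that by (auto simp: A_def \<gamma>_def)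
      qed (use ab in auto)
      finally have s1: "\<bar>sum ?h A\<bar> < e/2" .
      have "\<bar>sum ?h (p - A)\<bar> \<le> (\<Sum>(x,k)\<in>p - A. e/4 * (Sup k - Inf k))"
      proof (rule order_trans[OF sum_abs], rule sum_mono)
        fix z assume z: "z \<in> p - A"
        obtain x k where xk: "z = (x,k)" by (cases z)
        then have zp: "(x,k) \<in> p" "x \<notin> N" using z by (auto simp: A_def)
        obtain u v where uv: "k = {u..v}" "u \<le> v" "x \<in> k" "{u..v} \<subseteq> {a..b}" using pk[OF zp(1)] by blast
        then have x01: "x \<in> {0..1}" "u \<in> {0..1}" "v \<in> {0..1}" using ab by auto
        have "k \<subseteq> ball x (r x)" using fineD[OF fine zp(1)] zp(2) x01 by (auto simp: \<gamma>_def)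
        moreover have "u \<in> k" "v \<in> k" using uv by auto
        ultimately have "u \<in> ball x (r x)" "v \<in> ball x (r x)" by blast+
        then have "\<bar>u - x\<bar> < r x" "\<bar>v - x\<bar> < r x" by (auto simp: dist_real_def)
        then have "\<bar>F u - F x - F' x * (u - x)\<bar> \<le> e/4 * \<bar>u - x\<bar>" "\<bar>F v - F x - F' x * (v - x)\<bar> \<le> e/4 * \<bar>v - x\<bar>"
          using r(2) x01 zp(2) by auto
        moreover have "\<bar>u - x\<bar> = x - u" "\<bar>v - x\<bar> = v - x" using uv by auto
        ultimately have A: "\<bar>F u - F x - F' x * (u - x)\<bar> \<le> e/4 * (x - u)" "\<bar>F v - F x - F' x * (v - x)\<bar> \<le> e/4 * (v - x)"
          by simp_all
        have eq: "(v - u) * F' x - (F v - F u) = (F u - F x - F' x * (u - x)) - (F v - F x - F' x * (v - x))"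
          by (simp add: algebra_simps)
        have "\<bar>(v - u) * F' x - (F v - F u)\<bar> \<le> \<bar>F u - F x - F' x * (u - x)\<bar> + \<bar>F v - F x - F' x * (v - x)\<bar>"
          unfolding eq by (rule abs_triangle_ineq4)
        also have "\<dots> \<le> e/4 * (x - u) + e/4 * (v - x)" by (rule add_mono[OF A])
        also have "\<dots> = e/4 * (v - u)" by (simp only: distrib_left[symmetric]) simp
        finally have "\<bar>(v - u) * F' x - (F v - F u)\<bar> \<le> e/4 * (v - u)" .
        then show "\<bar>?h z\<bar> \<le> (case z of (x,k) \<Rightarrow> e/4 * (Sup k - Inf k))"
          using xk uv zp(2) by (simp add: f_def)
      qed
      also have "\<dots> \<le> (\<Sum>(x,k)\<in>p. e/4 * (Sup k - Inf k))"
      proof (rule sum_mono2[OF finp])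
        fix z assume "z \<in> p - (p - A)"
        then obtain x k where xk: "z = (x,k)" "(x,k) \<in> p" by (cases z) auto
        then obtain u v where "k = {u..v}" "u \<le> v" using pk by blast
        then show "0 \<le> (case z of (x,k) \<Rightarrow> e/4 * (Sup k - Inf k))" using xk e by simp
      qed auto
      also have "\<dots> = e/4 * (b - a)" unfolding tel2[symmetric] by (simp add: sum_distrib_left split_def)
      also have "\<dots> \<le> e/4 * 1" using ab e by (intro mult_left_mono) auto
      finally have s2: "\<bar>sum ?h (p - A)\<bar> \<le> e/4" by simp
      have "norm (sum ?h A + sum ?h (p - A)) \<le> \<bar>sum ?h A\<bar> + \<bar>sum ?h (p - A)\<bar>"
        unfolding real_norm_def by (rule abs_triangle_ineq)
      also have "\<dots> < e" using s1 s2 e by linarith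
      finally show ?thesis unfolding eq .
    qed
    show "\<exists>\<gamma>. gauge \<gamma> \<and> (\<forall>p. p tagged_division_of {a..b} \<and> \<gamma> fine p \<longrightarrow>
       norm ((\<Sum>(x, k)\<in>p. measure lborel k *\<^sub>R f x) - (F b - F a)) < e)"
      by (rule exI[of _ \<gamma>], rule conjI[OF g], intro allI impI, elim conjE, rule main)
  qed
  then show ?thesis by (rule has_integral_spike[OF N, rotated]) (auto simp: f_def)
qed

text \<open>
  On intervals shorter than the \<open>\<delta>\<close> that belongs to \<open>\<epsilon> = 1\<close> the indefinite integral has
  variation below 1, and finitely many such intervals make up \<open>[0,1]\<close>.
\<close>

theorem AC01_derivative_absolutely_integrable:
  assumes F: "AC01 F" and F': "\<And>a b. 0 \<le> a \<Longrightarrow> a \<le> b \<Longrightarrow> b \<le> 1 \<Longrightarrow> (F' has_integral F b - F a) {a..b}"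
  shows "F' absolutely_integrable_on {0..1}"
proof -
  obtain d where d: "d > 0" and
    AC: "\<And>D. D division_of \<Union>D \<Longrightarrow> \<Union>D \<subseteq> {0..1} \<Longrightarrow> (\<Sum>k\<in>D. Sup k - Inf k) < d \<Longrightarrow>
       (\<Sum>k\<in>D. \<bar>F (Sup k) - F (Inf k)\<bar>) < 1"
    using AC01_division[OF F zero_less_one] by blast
  have short: "F' absolutely_integrable_on {a..b}" if ab: "0 \<le> a" "a \<le> b" "b \<le> 1" "b - a < d" for a b
    unfolding box_real[symmetric]
  proof (rule bounded_variation_absolutely_integrable_interval)
    show "F' integrable_on cbox a b" using F'[OF ab(1-3)] by (auto simp: has_integral_iff)
    fix D assume D: "D division_of cbox a b"
    have U: "\<Union>D = {a..b}" using division_ofD(6)[OF D] by auto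
    have "(\<Sum>k\<in>D. \<bar>F (Sup k) - F (Inf k)\<bar>) < 1"
    proof (rule AC)
      show "(\<Sum>k\<in>D. Sup k - Inf k) < d" using division_telescope[of a b D "\<lambda>x. x"] D ab by simp
    qed (use D U ab in auto)
    moreover have "(\<Sum>k\<in>D. norm (integral k F')) = (\<Sum>k\<in>D. \<bar>F (Sup k) - F (Inf k)\<bar>)"
    proof (rule sum.cong[OF refl])
      fix k assume k: "k \<in> D"
      obtain u v where uv: "k = {u..v}" "u \<le> v"
        using division_ofD(3,4)[OF D k] by (auto simp: atLeastatMost_empty_iff)
      have "{u..v} \<subseteq> {a..b}" using division_ofD(2)[OF D k] uv by auto
      then have "(F' has_integral F v - F u) {u..v}" using uv ab by (intro F') auto
      then show "norm (integral k F') = \<bar>F (Sup k) - F (Inf k)\<bar>" using uv by (simp add: integral_unique)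
    qed
    ultimately show "(\<Sum>k\<in>D. norm (integral k F')) \<le> 1" by simp
  qed
  obtain n where n: "1 / d < real n" using reals_Archimedean2 by blast
  have n0: "n > 0" using n d by (smt (verit) divide_pos_pos of_nat_0_less_iff)
  have "F' absolutely_integrable_on {0..real i / real n}" if "i \<le> n" for i
    using that
  proof (induction i)
    case 0
    then show ?case using short[of 0 0] d by simp
  next
    case (Suc i)
    have 1: "F' absolutely_integrable_on {real i / real n..real (Suc i) / real n}"
      using Suc.prems n0 n d by (intro short) (auto simp: field_simps)
    have 2: "F' absolutely_integrable_on {0..real i / real n}" using Suc by simp
    have 3: "real i / real n \<le> real (Suc i) / real n" by (simp add: divide_right_mono)
    have 4: "0 \<le> real i / real n" by simp
    show ?case by (rule absolutely_integrable_on_combine[OF 2 1 4 3])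
  qed
  from this[of n] show ?thesis using n0 by simp
qed


section \<open>Iterated primitives\<close>

text \<open>
  Integrals over \<open>{a..x}\<close> vanish for \<open>x < a\<close>, so this is the iterated primitive of the function that is cut off
  to the left of \<open>a\<close>. Differences of two such primitives therefore isolate the
  contribution of the part of \<open>h\<close> between the two base points.
\<close>

primrec iter_int :: "real \<Rightarrow> nat \<Rightarrow> (real \<Rightarrow> real) \<Rightarrow> real \<Rightarrow> real" where
  "iter_int a 0 h = h"
| "iter_int a (Suc s) h = (\<lambda>x. integral {a..x} (iter_int a s h))"

lemma iter_int_zero: "x \<le> a \<Longrightarrow> iter_int a (Suc s) h x = 0"
  by (cases "x = a") auto

lemma continuous_integral_from:
  fixes h :: "real \<Rightarrow> real"
  assumes "h integrable_on {0..1}" "0 \<le> a" "a \<le> 1"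
  shows "continuous_on {0..1} (\<lambda>x. integral {a..x} h)"
proof -
  have "h integrable_on {a..1}" by (rule integrable_subinterval_real[OF assms(1)]) (use assms in auto)
  then have 1: "continuous_on {a..1} (\<lambda>x. integral {a..x} h)" by (rule indefinite_integral_continuous_1)
  have 2: "continuous_on {0..a} (\<lambda>x. integral {a..x} h)"
  proof (subst continuous_on_cong[OF refl])
    show "integral {a..x} h = 0" if "x \<in> {0..a}" for x using that by (cases "x = a") auto
  qed auto
  have "continuous_on ({0..a} \<union> {a..1}) (\<lambda>x. integral {a..x} h)"
    by (rule continuous_on_closed_Un) (use 1 2 in auto)
  moreover have "{0..a} \<union> {a..1} = {0..1}" using assms by auto
  ultimately show ?thesis by simp
qed

lemma iter_int_integrable:
  assumes "h integrable_on {0..1}" "0 \<le> a" "a \<le> 1"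
  shows "iter_int a s h integrable_on {0..1}"
proof (induction s)
  case (Suc s)
  show ?case using continuous_integral_from[OF Suc assms(2,3)] by (simp add: integrable_continuous_real)
qed (use assms in simp)

lemma iter_int_continuous:
  assumes "h integrable_on {0..1}" "0 \<le> a" "a \<le> 1"
  shows "continuous_on {0..1} (iter_int a (Suc s) h)"
  using continuous_integral_from[OF iter_int_integrable[OF assms] assms(2,3)] by simp

lemma iter_int_bound:
  assumes h: "h absolutely_integrable_on {0..1}" and a: "0 \<le> a" and x: "a \<le> x" "x \<le> 1"
  shows "\<bar>iter_int a (Suc s) h x\<bar> \<le> (x - a) ^ s * integral {a..x} (\<lambda>t. \<bar>h t\<bar>)"
  using x
proof (induction s arbitrary: x)
  case 0
  have "h absolutely_integrable_on {a..x}"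
    by (rule absolutely_integrable_on_subinterval[OF h]) (use 0 a in auto)
  then have "h integrable_on {a..x}" "(\<lambda>t. \<bar>h t\<bar>) integrable_on {a..x}"
    by (auto simp: absolutely_integrable_on_def)
  from integral_norm_bound_integral[OF this] show ?case by simp
next
  case (Suc s)
  have hi: "h integrable_on {0..1}" using h by (simp add: absolutely_integrable_on_def)
  have ai: "(\<lambda>t. \<bar>h t\<bar>) integrable_on {a..y}" if "y \<le> 1" for y
    using absolutely_integrable_on_subinterval[OF h, of a y] that a by (auto simp: absolutely_integrable_on_def)
  let ?I = "integral {a..x} (\<lambda>t. \<bar>h t\<bar>)"
  have "norm (integral {a..x} (iter_int a (Suc s) h)) \<le> ((x - a) ^ s * ?I) * (x - a)"
  proof (rule integral_bound)
    show "continuous_on {a..x} (iter_int a (Suc s) h)"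
      by (rule continuous_on_subset[OF iter_int_continuous[OF hi a]]) (use Suc.prems a in auto)
    fix t assume t: "t \<in> {a..x}"
    have "\<bar>iter_int a (Suc s) h t\<bar> \<le> (t - a) ^ s * integral {a..t} (\<lambda>t. \<bar>h t\<bar>)"
      using Suc t by auto
    also have "\<dots> \<le> (x - a) ^ s * ?I"
    proof (intro mult_mono power_mono)
      show "integral {a..t} (\<lambda>t. \<bar>h t\<bar>) \<le> ?I"
        by (rule integral_subset_le) (use t ai Suc.prems in auto)
      show "0 \<le> integral {a..t} (\<lambda>t. \<bar>h t\<bar>)" by (rule integral_nonneg) (use t ai Suc.prems in auto)
    qed (use t Suc.prems in auto)
    finally show "norm (iter_int a (Suc s) h t) \<le> (x - a) ^ s * ?I" by simp
  qed (use Suc.prems in auto)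
  then show ?case by (simp add: algebra_simps)
qed

lemma has_integral_shifted_power:
  fixes b x :: real assumes "b \<le> x"
  shows "((\<lambda>t. (t - b) ^ l) has_integral (x - b) ^ Suc l / real (Suc l)) {b..x}"
proof -
  have "((\<lambda>t. (t - b) ^ l) has_integral (x - b) ^ Suc l / real (Suc l) - (b - b) ^ Suc l / real (Suc l)) {b..x}"
    by (rule fundamental_theorem_of_calculus[OF assms])
       (auto intro!: derivative_eq_intros simp: has_real_derivative_iff_has_vector_derivative[symmetric] simp del: of_nat_Suc power_Suc)
  then show ?thesis by simp
qed

text \<open>
  Taylor's formula at \<open>b\<close> for the primitives based at \<open>a\<close>, with the primitive based at \<open>b\<close> as remainder.
\<close>

lemma iter_int_taylor:
  assumes h: "h integrable_on {0..1}" and ab: "0 \<le> a" "a \<le> b" "b \<le> x" "x \<le> 1"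
  shows "iter_int a (Suc s) h x = (\<Sum>l\<le>s. iter_int a (Suc s - l) h b * (x - b) ^ l / fact l) + iter_int b (Suc s) h x"
  using ab(3,4)
proof (induction s arbitrary: x)
  case 0
  have "integral {a..x} h = integral {a..b} h + integral {b..x} h"
    by (rule Henstock_Kurzweil_Integration.integral_combine[symmetric])
       (use ab 0 in \<open>auto intro: integrable_subinterval_real[OF h]\<close>)
  then show ?case by simp
next
  case (Suc s)
  let ?c = "\<lambda>l. iter_int a (Suc s - l) h b"
  have I: "iter_int c s' h integrable_on {c'..y}" if "0 \<le> c" "c \<le> 1" "0 \<le> c'" "y \<le> 1" for c c' y s'
    by (rule integrable_subinterval_real[OF iter_int_integrable[OF h that(1,2)]]) (use that in auto)
  have P: "((\<lambda>t. \<Sum>l\<le>s. ?c l * (t - b) ^ l / fact l) has_integral (\<Sum>l\<le>s. ?c l * (x - b) ^ Suc l / fact (Suc l))) {b..x}"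
  proof (rule has_integral_sum)
    fix l
    have "((\<lambda>t. ?c l / fact l * (t - b) ^ l) has_integral ?c l / fact l * ((x - b) ^ Suc l / real (Suc l))) {b..x}"
      by (intro has_integral_mult_right has_integral_shifted_power Suc.prems)
    then show "((\<lambda>t. ?c l * (t - b) ^ l / fact l) has_integral ?c l * (x - b) ^ Suc l / fact (Suc l)) {b..x}"
      by (simp add: field_simps)
  qed simp
  have "iter_int a (Suc (Suc s)) h x = integral {a..b} (iter_int a (Suc s) h) + integral {b..x} (iter_int a (Suc s) h)"
    unfolding iter_int.simps(2)[of a "Suc s"]
    by (rule Henstock_Kurzweil_Integration.integral_combine[symmetric]; (intro I)?) (use ab Suc.prems in auto)
  also have "integral {b..x} (iter_int a (Suc s) h) = integral {b..x} (\<lambda>t. (\<Sum>l\<le>s. ?c l * (t - b) ^ l / fact l) + iter_int b (Suc s) h t)"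
    by (rule integral_cong) (use Suc in auto)
  also have "\<dots> = (\<Sum>l\<le>s. ?c l * (x - b) ^ Suc l / fact (Suc l)) + integral {b..x} (iter_int b (Suc s) h)"
    using P I[of b b x "Suc s"] ab Suc.prems
    by (subst Henstock_Kurzweil_Integration.integral_add) (auto simp: has_integral_iff)
  also have "integral {a..b} (iter_int a (Suc s) h) + \<dots> = (\<Sum>l\<le>Suc s. iter_int a (Suc (Suc s) - l) h b * (x - b) ^ l / fact l) + iter_int b (Suc (Suc s)) h x"
    by (subst sum.atMost_Suc_shift) simp
  finally show ?case .
qed


section \<open>Splines and their primitives\<close>

lemma deriv01_0 [simp]: "deriv01 0 f = f" by (simp add: deriv01_def)

lemma deriv01_Suc: "deriv01 (Suc k) f = (\<lambda>x. vector_derivative (deriv01 k f) (at x within {0..1}))"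
  by (simp add: deriv01_def)

lemma deriv01_Suc_shift: "deriv01 (Suc k) f = deriv01 k (deriv01 1 f)"
  by (induction k) (simp_all add: deriv01_Suc)

lemma deriv01_eqI:
  assumes "x \<in> {0..1}" "(deriv01 k f has_vector_derivative D) (at x within {0..1})"
  shows "deriv01 (Suc k) f x = D"
  unfolding deriv01_Suc using vector_derivative_within_cbox[of 0 1 x "deriv01 k f" D] assms by simp

lemma has_vector_derivative_deriv01:
  assumes "deriv01 k f differentiable_on {0..1}" "x \<in> {0..1}"
  shows "(deriv01 k f has_vector_derivative deriv01 (Suc k) f x) (at x within {0..1})"
  unfolding deriv01_Suc vector_derivative_works[symmetric] using assms by (auto simp: differentiable_on_def)

lemma deriv01_cong:
  assumes "\<And>x. x \<in> {0..1} \<Longrightarrow> f x = g x" "x \<in> {0..1}"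
  shows "deriv01 k f x = deriv01 k g x"
  using assms(2)
proof (induction k arbitrary: x)
  case (Suc k)
  have "(deriv01 k f has_vector_derivative D) (at x within {0..1}) \<longleftrightarrow> (deriv01 k g has_vector_derivative D) (at x within {0..1})" for D
    by (intro iffI; erule has_vector_derivative_transform[rotated 2]) (use Suc in auto)
  then show ?case unfolding deriv01_Suc vector_derivative_def by simp
qed (use assms in simp)

lemma Ck01_0: "Ck01 0 f \<longleftrightarrow> continuous_on {0..1} f"
  by (simp add: Ck01_def differentiable_times01_def)

text \<open>
  This recursion lets smoothness statements be proved by induction on the order.
\<close>

lemma Ck01_Suc: "Ck01 (Suc k) f \<longleftrightarrow> f differentiable_on {0..1} \<and> Ck01 k (deriv01 1 f)"
proof -
  have "(\<forall>j<Suc k. deriv01 j f differentiable_on {0..1}) \<longleftrightarrow> f differentiable_on {0..1} \<and> (\<forall>j<k. deriv01 (Suc j) f differentiable_on {0..1})"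
    by (auto simp: less_Suc_eq_0_disj)
  then show ?thesis unfolding Ck01_def differentiable_times01_def by (simp add: deriv01_Suc_shift[symmetric] conj_ac del: One_nat_def)
qed

lemma Ck01_cong:
  assumes "\<And>x. x \<in> {0..1} \<Longrightarrow> f x = g x" shows "Ck01 k f \<longleftrightarrow> Ck01 k g"
proof -
  have "deriv01 j f differentiable_on {0..1} \<longleftrightarrow> deriv01 j g differentiable_on {0..1}" for j
  proof -
    have *: "u differentiable_on {0..1} \<Longrightarrow> v differentiable_on {0..1}"
      if "\<And>x. x \<in> {0..1} \<Longrightarrow> v x = u x" for u v :: "real \<Rightarrow> real"
      unfolding differentiable_on_def differentiable_def using has_derivative_transform that by blast
    have e: "deriv01 j f x = deriv01 j g x" if "x \<in> {0..1}" for x by (rule deriv01_cong[OF assms that])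
    show ?thesis
    proof
      assume "deriv01 j f differentiable_on {0..1}"
      then show "deriv01 j g differentiable_on {0..1}" by (rule *[rotated]) (simp add: e)
    next
      assume "deriv01 j g differentiable_on {0..1}"
      then show "deriv01 j f differentiable_on {0..1}" by (rule *[rotated]) (simp add: e)
    qed
  qed
  moreover have "continuous_on {0..1} (deriv01 k f) \<longleftrightarrow> continuous_on {0..1} (deriv01 k g)"
    by (rule continuous_on_cong[OF refl]) (rule deriv01_cong[OF assms])
  ultimately show ?thesis unfolding Ck01_def differentiable_times01_def by simp
qed

lemma Ck01_continuous: "Ck01 k f \<Longrightarrow> continuous_on {0..1} f"
  by (cases k) (auto simp: Ck01_0 Ck01_Suc intro: differentiable_imp_continuous_on)

lemma Ck01_linear:
  assumes "Ck01 k f" "Ck01 k g" shows "Ck01 k (\<lambda>x. c * f x + d * g x)"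
  using assms
proof (induction k arbitrary: f g)
  case (Suc k)
  have D: "deriv01 1 (\<lambda>x. c * f x + d * g x) x = c * deriv01 1 f x + d * deriv01 1 g x" if "x \<in> {0..1}" for x
    unfolding One_nat_def
  proof (rule deriv01_eqI[OF that])
    show "(deriv01 0 (\<lambda>x. c * f x + d * g x) has_vector_derivative c * deriv01 (Suc 0) f x + d * deriv01 (Suc 0) g x) (at x within {0..1})"
      using has_vector_derivative_deriv01[of 0 f x] has_vector_derivative_deriv01[of 0 g x] Suc.prems that
      by (auto simp: Ck01_Suc intro!: derivative_intros has_vector_derivative_mult_right)
  qed
  have "Ck01 k (\<lambda>x. c * deriv01 1 f x + d * deriv01 1 g x)" using Suc by (simp add: Ck01_Suc)
  then have "Ck01 k (deriv01 1 (\<lambda>x. c * f x + d * g x))" using Ck01_cong[OF D] by simp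
  moreover have "(\<lambda>x. c * f x + d * g x) differentiable_on {0..1}"
    using Suc.prems unfolding Ck01_Suc differentiable_on_def by (auto intro!: derivative_intros)
  ultimately show ?case by (simp add: Ck01_Suc)
qed (auto simp: Ck01_0 intro!: continuous_intros)

lemma integral_has_derivative_from_0:
  fixes T :: "real \<Rightarrow> real"
  assumes "continuous_on {0..1} T" "x \<in> {0..1}"
  shows "((\<lambda>x. c + integral {0..x} T) has_vector_derivative T x) (at x within {0..1})"
proof -
  have "((\<lambda>x. integral {0..x} T) has_vector_derivative T x) (at x within {0..1})"
    by (rule integral_has_vector_derivative[OF assms])
  from has_vector_derivative_add[OF has_vector_derivative_const[of c] this] show ?thesis by (simp only: add_0)
qed

lemma Ck01_primitive:
  assumes "Ck01 k T" shows "Ck01 (Suc k) (\<lambda>x. c + integral {0..x} T)"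
proof -
  let ?P = "\<lambda>x. c + integral {0..x} T"
  have D: "(?P has_vector_derivative T x) (at x within {0..1})" if "x \<in> {0..1}" for x
    by (rule integral_has_derivative_from_0[OF Ck01_continuous[OF assms] that])
  have eq: "deriv01 1 ?P x = T x" if "x \<in> {0..1}" for x
    unfolding One_nat_def by (rule deriv01_eqI[OF that], unfold deriv01_0, rule D[OF that])
  have "?P differentiable_on {0..1}" unfolding differentiable_on_def
    using D differentiableI_vector by blast
  then show ?thesis using Ck01_cong[OF eq] assms by (simp add: Ck01_Suc)
qed

text \<open>
  The one-sided derivative relative to \<open>[0,1]\<close> is the ordinary one at interior points of a cell.
\<close>

lemma deriv01_piecewise_poly:
  assumes S: "\<And>x. x \<in> {a<..<b} \<Longrightarrow> S x = poly q x" and ab: "{a<..<b} \<subseteq> {0..1}" and x: "x \<in> {a<..<b}"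
  shows "deriv01 k S x = poly ((pderiv ^^ k) q) x"
  using x
proof (induction k arbitrary: x)
  case (Suc k)
  let ?q = "(pderiv ^^ k) q"
  have "(poly ?q has_vector_derivative poly (pderiv ?q) x) (at x)"
    using poly_DERIV[of ?q x] by (simp add: has_real_derivative_iff_has_vector_derivative)
  then have "(deriv01 k S has_vector_derivative poly (pderiv ?q) x) (at x)"
    by (rule has_vector_derivative_transform_within_open[OF _ open_greaterThanLessThan Suc.prems])
       (use Suc.IH in auto)
  from deriv01_eqI[OF _ has_vector_derivative_at_within[OF this]] show ?case using ab Suc.prems by auto
qed (use S in simp)

text \<open>
  A function and its polynomial pieces on the \<open>N\<close> equal cells of \<open>[0,1]\<close>, numbered from 0; the
  values at the knots are left free.
\<close>

definition pw_polys :: "nat \<Rightarrow> nat \<Rightarrow> (real \<Rightarrow> real) \<Rightarrow> (nat \<Rightarrow> real poly) \<Rightarrow> bool" where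
  "pw_polys k N T q \<longleftrightarrow> (\<forall>i<N. degree (q i) < k \<and> (\<forall>x\<in>{real i / real N<..<real (Suc i) / real N}. T x = poly (q i) x))"

lemma splines_iff:
  assumes "m \<ge> 1"
  shows "S \<in> splines m n \<longleftrightarrow> (2 \<le> m \<longrightarrow> Ck01 (m - 2) S) \<and> (\<exists>q. pw_polys m n S q)"
proof -
  have "(\<forall>j\<in>{1..n}. \<exists>q :: real poly. degree q \<le> m - 1 \<and>
        (\<forall>x\<in>{(real j - 1) / real n <..< real j / real n}. S x = poly q x)) \<longleftrightarrow>
    (\<forall>i<n. \<exists>q. degree q < m \<and> (\<forall>x\<in>{real i / real n<..<real (Suc i) / real n}. S x = poly q x))" (is "?L \<longleftrightarrow> ?R")
  proof
    assume L: ?L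
    show ?R
    proof (intro allI impI)
      fix i assume "i < n"
      then have "Suc i \<in> {1..n}" by auto
      from L[rule_format, OF this] obtain q where "degree q \<le> m - 1"
        "\<forall>x\<in>{(real (Suc i) - 1) / real n<..<real (Suc i) / real n}. S x = poly q x" by blast
      then show "\<exists>q. degree q < m \<and> (\<forall>x\<in>{real i / real n<..<real (Suc i) / real n}. S x = poly q x)"
        using assms by (intro exI[of _ q]) auto
    qed
  next
    assume R: ?R
    show ?L
    proof
      fix j assume "j \<in> {1..n}"
      then obtain i where i: "j = Suc i" "i < n" by (cases j) auto
      from R[rule_format, OF i(2)] obtain q where "degree q < m"
        "\<forall>x\<in>{real i / real n<..<real (Suc i) / real n}. S x = poly q x" by blast
      then show "\<exists>q. degree q \<le> m - 1 \<and> (\<forall>x\<in>{(real j - 1) / real n<..<real j / real n}. S x = poly q x)"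
        using assms i(1) by (intro exI[of _ q]) auto
    qed
  qed
  also have "?R \<longleftrightarrow> (\<exists>q. pw_polys m n S q)" unfolding pw_polys_def by metis
  finally show ?thesis unfolding splines_def by simp
qed

lemma cell_subset01: "i < N \<Longrightarrow> {real i / real N..real (Suc i) / real N} \<subseteq> {0..1}"
  by (auto simp: field_simps)

lemma splines_linear:
  assumes m: "m \<ge> 1" and S: "S \<in> splines m n" and T: "T \<in> splines m n"
  shows "(\<lambda>x. c * S x + d * T x) \<in> splines m n"
proof -
  obtain q where q: "pw_polys m n S q" using S splines_iff[OF m] by blast
  obtain q' where q': "pw_polys m n T q'" using T splines_iff[OF m] by blast
  have "pw_polys m n (\<lambda>x. c * S x + d * T x) (\<lambda>i. smult c (q i) + smult d (q' i))"
    unfolding pw_polys_def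
  proof (intro allI impI conjI)
    fix i assume "i < n"
    then show "degree (smult c (q i) + smult d (q' i)) < m" using q q' unfolding pw_polys_def
      by (meson degree_add_less degree_smult_le le_less_trans)
    show "\<forall>x\<in>{real i / real n<..<real (Suc i) / real n}. c * S x + d * T x = poly (smult c (q i) + smult d (q' i)) x"
      using q q' \<open>i < n\<close> unfolding pw_polys_def by simp
  qed
  then show ?thesis using S T Ck01_linear splines_iff[OF m] by blast
qed

lemma splines_sum:
  assumes m: "m \<ge> 1" and S: "\<And>i. i \<in> I \<Longrightarrow> S i \<in> splines m n"
  shows "(\<lambda>x. \<Sum>i\<in>I. c i * S i x) \<in> splines m n"
proof (cases "finite I")
  have Z: "(\<lambda>x. 0) \<in> splines m n"
  proof -
    have "Ck01 k (\<lambda>x. 0)" for k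
    proof (induction k)
      case (Suc k)
      have "deriv01 1 (\<lambda>x. 0) x = 0" if "x \<in> {0..1}" for x
        unfolding One_nat_def by (rule deriv01_eqI[OF that]) simp
      then show ?case using Suc Ck01_cong[of "deriv01 1 (\<lambda>x. 0)" "\<lambda>x. 0" k] by (simp add: Ck01_Suc)
    qed (simp add: Ck01_0)
    moreover have "pw_polys m n (\<lambda>x. 0) (\<lambda>i. 0)" using m by (simp add: pw_polys_def)
    ultimately show ?thesis using splines_iff[OF m] by blast
  qed
  { case True
    then show ?thesis using S
    proof (induction I)
      case (insert a I)
      have "(\<lambda>x. c a * S a x + 1 * (\<Sum>i\<in>I. c i * S i x)) \<in> splines m n"
        by (rule splines_linear[OF m]) (use insert in auto)
      then show ?case using insert(1,2) by simp
    qed (use Z in simp)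
  next
    case False then show ?thesis using Z by simp }
qed

lemma pw_polys_integrable:
  assumes "pw_polys k N T q" "N \<ge> 1"
  shows "T absolutely_integrable_on {0..1}"
proof -
  have cell: "T absolutely_integrable_on {real i / real N..real (Suc i) / real N}" if "i < N" for i
  proof -
    have "poly (q i) absolutely_integrable_on {real i / real N..real (Suc i) / real N}"
      by (intro absolutely_integrable_continuous_real continuous_intros)
    then show ?thesis
    proof (rule absolutely_integrable_spike[where S = "{real i / real N, real (Suc i) / real N}"])
      fix x assume "x \<in> {real i / real N..real (Suc i) / real N} - {real i / real N, real (Suc i) / real N}"
      then have "x \<in> {real i / real N<..<real (Suc i) / real N}" by auto
      then show "T x = poly (q i) x" using assms that unfolding pw_polys_def by blast
    qed simp
  qed
  have "T absolutely_integrable_on {0..real i / real N}" if "i \<le> N" for i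
    using that
  proof (induction i)
    case 0
    show ?case using integrable_on_refl[of T 0] integrable_on_refl[of "\<lambda>x. \<bar>T x\<bar>" 0]
      by (simp add: absolutely_integrable_on_def)
  next
    case (Suc i)
    have 1: "T absolutely_integrable_on {0..real i / real N}" using Suc by simp
    have 2: "T absolutely_integrable_on {real i / real N..real (Suc i) / real N}" using cell Suc by simp
    have 3: "real i / real N \<le> real (Suc i) / real N" by (simp add: divide_right_mono)
    show ?case by (rule absolutely_integrable_on_combine[OF 1 2 _ 3]) simp
  qed
  from this[of N] show ?thesis using assms(2) by simp
qed

lemma splines_integrable:
  assumes "S \<in> splines m n" "m \<ge> 1" "n \<ge> 1" shows "S absolutely_integrable_on {0..1}"
  using assms splines_iff pw_polys_integrable by blast

lemma poly_primitive:
  fixes q :: "real poly"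
  obtains Q where "pderiv Q = q" "degree Q \<le> Suc (degree q)"
proof
  let ?Q = "\<Sum>i\<le>degree q. monom (coeff q i / real (Suc i)) (Suc i)"
  show "pderiv ?Q = q"
    by (rule poly_eqI) (auto simp: coeff_pderiv coeff_sum coeff_eq_0 if_distrib cong: if_cong intro: coeff_eq_0)
  show "degree ?Q \<le> Suc (degree q)"
    by (rule degree_sum_le) (auto intro: order_trans[OF degree_monom_le])
qed

text \<open>
  The relation between the pieces is recorded because the \<open>r\<close>-th derivative of an iterated
  primitive is needed cell by cell, while at a knot it may fail to exist.
\<close>

lemma pw_polys_primitive:
  assumes q: "pw_polys k n T q" and n: "n \<ge> 1"
  obtains Q where "pw_polys (Suc k) n (\<lambda>x. c + integral {0..x} T) Q" "\<And>i. i < n \<Longrightarrow> pderiv (Q i) = q i"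
proof -
  let ?P = "\<lambda>x. c + integral {0..x} T"
  have Ti: "T integrable_on {0..1}" using pw_polys_integrable[OF q n] by (simp add: absolutely_integrable_on_def)
  have "\<exists>Q. degree Q < Suc k \<and> (\<forall>x\<in>{real i / real n<..<real (Suc i) / real n}. ?P x = poly Q x) \<and> pderiv Q = q i" if i: "i < n" for i
  proof -
    let ?a = "real i / real n" and ?b = "real (Suc i) / real n"
    obtain Q where Q: "pderiv Q = q i" "degree Q \<le> Suc (degree (q i))" using poly_primitive by blast
    define R where "R = Q + [:c + integral {0..?a} T - poly Q ?a:]"
    have "degree Q < Suc k" using Q(2) q i unfolding pw_polys_def by fastforce
    then have "degree R < Suc k" unfolding R_def by (intro degree_add_less) auto
    moreover have "pderiv R = q i" unfolding R_def by (simp add: pderiv_add Q(1) pderiv_pCons)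
    moreover have "?P x = poly R x" if x: "x \<in> {?a<..<?b}" for x
    proof -
      have sub: "{?a..x} \<subseteq> {0..1}" "{0..x} \<subseteq> {0..1}" using cell_subset01[OF i] x by auto
      have "(poly (q i) has_integral poly Q x - poly Q ?a) {?a..x}"
        by (rule fundamental_theorem_of_calculus)
           (use x poly_DERIV[of Q] Q(1) in \<open>auto simp: has_real_derivative_iff_has_vector_derivative intro: has_vector_derivative_at_within\<close>)
      then have "(T has_integral poly Q x - poly Q ?a) {?a..x}"
        by (rule has_integral_spike[where S = "{?a}", rotated 2]) (use x q i in \<open>auto simp: pw_polys_def\<close>)
      moreover have "integral {0..x} T = integral {0..?a} T + integral {?a..x} T"
        by (rule Henstock_Kurzweil_Integration.integral_combine[symmetric])
           (use x integrable_subinterval_real[OF Ti sub(2)] in auto)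
      ultimately show ?thesis by (simp add: R_def integral_unique)
    qed
    ultimately show ?thesis by blast
  qed
  then obtain Q where Q: "\<And>i. i < n \<Longrightarrow> degree (Q i) < Suc k \<and> (\<forall>x\<in>{real i / real n<..<real (Suc i) / real n}. ?P x = poly (Q i) x) \<and> pderiv (Q i) = q i"
    by metis
  show thesis by (rule that[of Q]) (use Q in \<open>auto simp: pw_polys_def\<close>)
qed

lemma splines_primitive:
  assumes T: "T \<in> splines k n" and k: "k \<ge> 1" and n: "n \<ge> 1"
  shows "(\<lambda>x. c + integral {0..x} T) \<in> splines (Suc k) n"
proof -
  let ?P = "\<lambda>x. c + integral {0..x} T"
  obtain q where q: "pw_polys k n T q" using T splines_iff[OF k] by blast
  have Ti: "T integrable_on {0..1}" using pw_polys_integrable[OF q n] by (simp add: absolutely_integrable_on_def)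
  obtain Q where "pw_polys (Suc k) n ?P Q" using pw_polys_primitive[OF q n] by blast
  moreover have "Ck01 (Suc k - 2) ?P"
  proof (cases "k = 1")
    case True
    then show ?thesis using indefinite_integral_continuous_1[OF Ti] by (auto simp: Ck01_0 intro!: continuous_intros)
  next
    case False
    then have "2 \<le> k" using k by simp
    then have "Ck01 (k - 2) T" using T splines_iff[OF k] by blast
    from Ck01_primitive[OF this] have "Ck01 (Suc (k - 2)) ?P" .
    moreover have "Suc (k - 2) = Suc k - 2" using \<open>2 \<le> k\<close> by simp
    ultimately show ?thesis by (simp only:)
  qed
  ultimately show ?thesis using splines_iff[of "Suc k"] by (metis le_add1 plus_1_eq_Suc)
qed

text \<open>
  The truncated power \<open>(x - t)\<^sub>+\<^sup>d\<close>, which for \<open>d = 0\<close> is a step function.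
\<close>

definition trunc_pow :: "nat \<Rightarrow> real \<Rightarrow> real \<Rightarrow> real" where
  "trunc_pow d t x = (if t < x then (x - t) ^ d else 0)"

lemma has_integral_trunc_pow:
  assumes "0 \<le> t" "0 \<le> x"
  shows "(trunc_pow d t has_integral trunc_pow (Suc d) t x / real (Suc d)) {0..x}"
proof (cases "t < x")
  case True
  have "(trunc_pow d t has_integral 0) {0..t}"
    by (rule has_integral_is_0) (auto simp: trunc_pow_def)
  moreover have "(trunc_pow d t has_integral (x - t) ^ Suc d / real (Suc d)) {t..x}"
    by (rule has_integral_spike[where S = "{t}", OF _ _ has_integral_shifted_power]) (use True in \<open>auto simp: trunc_pow_def\<close>)
  ultimately have "(trunc_pow d t has_integral 0 + (x - t) ^ Suc d / real (Suc d)) {0..x}"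
    by (rule has_integral_combine[of 0 t x, rotated 2]) (use assms True in auto)
  then show ?thesis using True by (simp add: trunc_pow_def)
next
  case False
  have "(trunc_pow d t has_integral 0) {0..x}"
    by (rule has_integral_is_0) (use False in \<open>auto simp: trunc_pow_def\<close>)
  then show ?thesis using False by (simp add: trunc_pow_def)
qed

text \<open>
  Up to a factor each truncated power is the primitive of the preceding one, which starts from a step
  at a knot. A knot to the right of 1 is harmless, since the function then vanishes on \<open>[0,1]\<close>.
\<close>

lemma trunc_pow_in_splines:
  assumes n: "n \<ge> 1"
  shows "trunc_pow d (real i / real n) \<in> splines (Suc d) n"
proof (induction d)
  case 0
  have "pw_polys 1 n (trunc_pow 0 (real i / real n)) (\<lambda>j. if j < i then 0 else [:1:])"
    unfolding pw_polys_def
  proof (intro allI impI conjI ballI)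
    fix j x assume x: "x \<in> {real j / real n<..<real (Suc j) / real n}"
    show "trunc_pow 0 (real i / real n) x = poly (if j < i then 0 else [:1:]) x"
    proof (cases "j < i")
      case True
      then have "real (Suc j) / real n \<le> real i / real n" by (intro divide_right_mono) auto
      then show ?thesis using True x by (simp add: trunc_pow_def)
    next
      case False
      then have "real i / real n \<le> real j / real n" by (intro divide_right_mono) auto
      then show ?thesis using False x by (simp add: trunc_pow_def)
    qed
  qed auto
  then show ?case using splines_iff[of 1] by auto
next
  case (Suc d)
  let ?t = "real i / real n"
  have "(\<lambda>x. 0 + integral {0..x} (trunc_pow d ?t)) \<in> splines (Suc (Suc d)) n"
    by (rule splines_primitive[OF Suc _ n]) simp
  from splines_linear[OF _ this this, of "real (Suc d)" 0]
  have "(\<lambda>x. real (Suc d) * integral {0..x} (trunc_pow d ?t)) \<in> splines (Suc (Suc d)) n" by simp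
  moreover have "real (Suc d) * integral {0..x} (trunc_pow d ?t) = trunc_pow (Suc d) ?t x" for x
  proof (cases "0 \<le> x")
    case True
    then show ?thesis using has_integral_trunc_pow[of ?t x d] by (simp add: integral_unique del: of_nat_Suc)
  next
    case False
    then have "\<not> ?t < x" by (smt (verit) divide_nonneg_nonneg of_nat_0_le_iff)
    then show ?thesis using False by (simp add: trunc_pow_def)
  qed
  ultimately show ?case by simp
qed

theorem AC01_iterated_FTC:
  assumes r: "r \<ge> 1" and f: "differentiable_times01 (r - 1) f" "AC01 (deriv01 (r - 1) f)"
  shows "deriv01 r f absolutely_integrable_on {0..1}"
    "\<And>j x. j < r \<Longrightarrow> x \<in> {0..1} \<Longrightarrow> deriv01 j f x = deriv01 j f 0 + integral {0..x} (deriv01 (Suc j) f)"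
proof -
  let ?F = "deriv01 (r - 1) f"
  obtain N where N: "negligible N" "\<And>x. x \<in> {0..1} - N \<Longrightarrow> ?F differentiable (at x)"
    using AC01_differentiable_ae[OF f(2)] by blast
  have D: "(?F has_vector_derivative deriv01 (Suc (r - 1)) f x) (at x within {0..1})" if "x \<in> {0..1} - N" for x
    unfolding deriv01_Suc vector_derivative_works[symmetric]
    using N(2)[OF that] by (rule differentiable_at_withinI)
  have I: "(deriv01 (Suc (r - 1)) f has_integral ?F b - ?F a) {a..b}" if "0 \<le> a" "a \<le> b" "b \<le> 1" for a b
    by (rule AC01_FTC[OF f(2) N(1) D that])
  have r': "Suc (r - 1) = r" using r by simp
  show "deriv01 r f absolutely_integrable_on {0..1}"
    using AC01_derivative_absolutely_integrable[OF f(2) I] unfolding r' .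
  fix j x assume j: "j < r" and x: "x \<in> {0..1::real}"
  have "(deriv01 (Suc j) f has_integral deriv01 j f x - deriv01 j f 0) {0..x}"
  proof (cases "j = r - 1")
    case True then show ?thesis using I[of 0 x] x by simp
  next
    case False
    then have "deriv01 j f differentiable_on {0..1}" using f(1) j by (simp add: differentiable_times01_def)
    then have "(deriv01 j f has_vector_derivative deriv01 (Suc j) f y) (at y within {0..1})" if "y \<in> {0..1}" for y
      using that by (rule has_vector_derivative_deriv01)
    then have "(deriv01 j f has_vector_derivative deriv01 (Suc j) f y) (at y within {0..x})" if "y \<in> {0..x}" for y
      by (rule has_vector_derivative_within_subset) (use that x in auto)
    then show ?thesis
      by (intro fundamental_theorem_of_calculus) (use x in auto)
  qed
  then show "deriv01 j f x = deriv01 j f 0 + integral {0..x} (deriv01 (Suc j) f)"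
    by (simp add: integral_unique)
qed

text \<open>
  Integrate \<open>T\<close> exactly \<open>r\<close> times, each time with the initial value of the corresponding derivative of \<open>f\<close>.
\<close>

theorem spline_with_given_derivative:
  assumes r: "r \<ge> 1" and f: "differentiable_times01 (r - 1) f" "AC01 (deriv01 (r - 1) f)"
    and T: "T \<in> splines k n" "pw_polys k n T q" and k: "k \<ge> 1" and n: "n \<ge> 1"
  obtains R \<rho> where "R \<in> splines (k + r) n" "pw_polys (k + r) n R \<rho>" "\<And>i. i < n \<Longrightarrow> (pderiv ^^ r) (\<rho> i) = q i"
    "\<And>x. x \<in> {0..1} \<Longrightarrow> f x - R x = iter_int 0 r (\<lambda>x. deriv01 r f x - T x) x"
proof -
  let ?G = "\<lambda>x. deriv01 r f x - T x"
  note F = AC01_iterated_FTC[OF r f]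
  have gi: "deriv01 r f integrable_on {0..1}" using F(1) by (simp add: absolutely_integrable_on_def)
  have Ti: "T integrable_on {0..1}" using pw_polys_integrable[OF T(2) n] by (simp add: absolutely_integrable_on_def)
  have "\<exists>R \<rho>. R \<in> splines (k + s) n \<and> pw_polys (k + s) n R \<rho> \<and> (\<forall>i<n. (pderiv ^^ s) (\<rho> i) = q i) \<and>
      (\<forall>x\<in>{0..1}. deriv01 (r - s) f x - R x = iter_int 0 s ?G x)" if "s \<le> r" for s
    using that
  proof (induction s)
    case 0
    then show ?case using T by auto
  next
    case (Suc s)
    then obtain R \<rho> where R: "R \<in> splines (k + s) n" "pw_polys (k + s) n R \<rho>" "\<And>i. i < n \<Longrightarrow> (pderiv ^^ s) (\<rho> i) = q i"
      "\<And>x. x \<in> {0..1} \<Longrightarrow> deriv01 (r - s) f x - R x = iter_int 0 s ?G x" by auto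
    let ?c = "deriv01 (r - Suc s) f 0"
    let ?P = "\<lambda>x. ?c + integral {0..x} R"
    have 1: "?P \<in> splines (Suc (k + s)) n" by (rule splines_primitive[OF R(1) _ n]) (use k in simp)
    obtain Q where Q: "pw_polys (Suc (k + s)) n ?P Q" "\<And>i. i < n \<Longrightarrow> pderiv (Q i) = \<rho> i"
      using pw_polys_primitive[OF R(2) n] by blast
    have 2: "(pderiv ^^ Suc s) (Q i) = q i" if "i < n" for i
      using Q(2)[OF that] R(3)[OF that] by (simp add: funpow_swap1)
    have Ri: "R integrable_on {0..1}" using pw_polys_integrable[OF R(2) n] by (simp add: absolutely_integrable_on_def)
    have 3: "deriv01 (r - Suc s) f x - ?P x = iter_int 0 (Suc s) ?G x" if x: "x \<in> {0..1}" for x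
    proof -
      have sub: "{0..x} \<subseteq> {0..1}" using x by auto
      have Is: "Suc (r - Suc s) = r - s" using Suc.prems by simp
      have Gi: "iter_int 0 s ?G integrable_on {0..1}" by (rule iter_int_integrable) (use gi Ti in \<open>auto intro: Henstock_Kurzweil_Integration.integrable_diff\<close>)
      have "integral {0..x} (deriv01 (r - s) f) = integral {0..x} (\<lambda>x. iter_int 0 s ?G x + R x)"
      proof (rule integral_cong)
        fix y assume "y \<in> {0..x}"
        then show "deriv01 (r - s) f y = iter_int 0 s ?G y + R y" using R(4)[of y] sub by auto
      qed
      also have "\<dots> = integral {0..x} (iter_int 0 s ?G) + integral {0..x} R"
        by (intro Henstock_Kurzweil_Integration.integral_add integrable_subinterval_real[OF _ sub] Gi Ri)
      finally show ?thesis using F(2)[of "r - Suc s" x] x Suc.prems unfolding Is by simp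
    qed
    show ?case by (rule exI[of _ ?P], rule exI[of _ Q]) (use 1 2 3 Q(1) in simp)
  qed
  from this[of r] show thesis using that by auto
qed


section \<open>The p-th power of the quasinorm\<close>

lemma powr_add_le:
  fixes x y p :: real assumes "0 < p" "p \<le> 1"
  shows "\<bar>x + y\<bar> powr p \<le> \<bar>x\<bar> powr p + \<bar>y\<bar> powr p"
proof -
  have *: "(a + b) powr p \<le> a powr p + b powr p" if ab: "0 \<le> a" "0 \<le> b" for a b :: real
  proof (cases "a + b = 0")
    case False
    then have s: "a + b > 0" using ab by simp
    have le: "t \<le> t powr p" if "0 \<le> t" "t \<le> 1" for t :: real
      using powr_mono'[of p 1 t] that assms by (cases "t = 0") auto
    have "1 = a / (a + b) + b / (a + b)" using s by (simp add: add_divide_distrib[symmetric])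
    also have "\<dots> \<le> (a / (a + b)) powr p + (b / (a + b)) powr p"
      by (intro add_mono le) (use ab s in auto)
    also have "\<dots> = (a powr p + b powr p) / (a + b) powr p"
      using ab s by (simp add: powr_divide add_divide_distrib)
    finally show ?thesis using s by (simp add: field_simps)
  qed (use assms ab in auto)
  have "\<bar>x + y\<bar> powr p \<le> (\<bar>x\<bar> + \<bar>y\<bar>) powr p" using assms by (intro powr_mono2) auto
  also have "\<dots> \<le> \<bar>x\<bar> powr p + \<bar>y\<bar> powr p" by (rule *) auto
  finally show ?thesis .
qed

lemma powr_sum_le:
  fixes f :: "'a \<Rightarrow> real" assumes p: "0 < p" "p \<le> 1" and fin: "finite I"
  shows "\<bar>\<Sum>i\<in>I. f i\<bar> powr p \<le> (\<Sum>i\<in>I. \<bar>f i\<bar> powr p)"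
  using fin
proof (induction I)
  case (insert a I)
  then show ?case using powr_add_le[OF p, of "f a" "sum f I"] by simp
qed (use p in simp)

lemma powr_le_1_plus:
  fixes t p :: real assumes "0 < p" "p \<le> 1" "0 \<le> t" shows "t powr p \<le> 1 + t"
proof (cases "t \<le> 1")
  case True
  have "t powr p \<le> 1 powr p" using assms True by (intro powr_mono2) auto
  then show ?thesis using assms by simp
next
  case False
  have "t powr p \<le> t powr 1" using assms False by (intro powr_mono) auto
  then show ?thesis using assms False by simp
qed

definition energy :: "real \<Rightarrow> real \<Rightarrow> real \<Rightarrow> (real \<Rightarrow> real) \<Rightarrow> real" where
  "energy p a b h = integral {a..b} (\<lambda>x. \<bar>h x\<bar> powr p)"

lemma powr_integrable:
  assumes p: "0 < p" "p \<le> 1" and h: "h absolutely_integrable_on {a..b::real}"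
  shows "(\<lambda>x. \<bar>h x :: real\<bar> powr p) integrable_on {a..b}"
proof (rule measurable_bounded_by_integrable_imp_integrable)
  have "h \<in> borel_measurable (lebesgue_on {a..b})"
    using h absolutely_integrable_measurable[of "{a..b}" h] by simp
  then show "(\<lambda>x. \<bar>h x\<bar> powr p) \<in> borel_measurable (lebesgue_on {a..b})" by measurable
  show "(\<lambda>x. 1 + \<bar>h x\<bar>) integrable_on {a..b}"
    by (intro Henstock_Kurzweil_Integration.integrable_add) (use h in \<open>auto simp: absolutely_integrable_on_def\<close>)
  show "norm (\<bar>h x\<bar> powr p) \<le> 1 + \<bar>h x\<bar>" for x
    using powr_le_1_plus[OF p, of "\<bar>h x\<bar>"] by simp
qed simp

lemma energy_nonneg: "0 \<le> energy p a b h"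
proof (cases "(\<lambda>x. \<bar>h x\<bar> powr p) integrable_on {a..b}")
  case True
  then show ?thesis unfolding energy_def by (rule integral_nonneg) simp
qed (simp add: energy_def not_integrable_integral)

lemma energy_cong: "(\<And>x. x \<in> {a<..<b} \<Longrightarrow> h x = k x) \<Longrightarrow> energy p a b h = energy p a b k"
  unfolding energy_def by (rule integral_spike[where S = "{a,b}"]) auto

lemma energy_triangle:
  assumes p: "0 < p" "p \<le> 1" and h: "h absolutely_integrable_on {a..b}" and k: "k absolutely_integrable_on {a..b}"
  shows "energy p a b (\<lambda>x. h x + k x) \<le> energy p a b h + energy p a b k"
proof -
  have "energy p a b (\<lambda>x. h x + k x) \<le> integral {a..b} (\<lambda>x. \<bar>h x\<bar> powr p + \<bar>k x\<bar> powr p)"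
    unfolding energy_def
  proof (rule integral_le)
    show "(\<lambda>x. \<bar>h x + k x\<bar> powr p) integrable_on {a..b}"
      by (rule powr_integrable[OF p set_integral_add(1)[OF h k]])
    show "(\<lambda>x. \<bar>h x\<bar> powr p + \<bar>k x\<bar> powr p) integrable_on {a..b}"
      by (rule Henstock_Kurzweil_Integration.integrable_add[OF powr_integrable[OF p h] powr_integrable[OF p k]])
  qed (rule powr_add_le[OF p])
  also have "\<dots> = energy p a b h + energy p a b k"
    unfolding energy_def by (rule Henstock_Kurzweil_Integration.integral_add[OF powr_integrable[OF p h] powr_integrable[OF p k]])
  finally show ?thesis .
qed

lemma energy_sub:
  assumes p: "0 < p" "p \<le> 1" and h: "h absolutely_integrable_on {a..b}" and sub: "{c..d} \<subseteq> {a..b}"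
  shows "energy p c d h \<le> energy p a b h"
  unfolding energy_def
  by (rule integral_subset_le[OF sub])
     (use powr_integrable[OF p h] powr_integrable[OF p absolutely_integrable_on_subinterval[OF h sub]] in auto)

lemma energy_bounded:
  assumes p: "0 < p" "p \<le> 1" and h: "h absolutely_integrable_on {a..b}" and ab: "a \<le> b"
    and le: "\<And>x. x \<in> {a..b} \<Longrightarrow> \<bar>h x\<bar> powr p \<le> B"
  shows "energy p a b h \<le> (b - a) * B"
proof -
  have "energy p a b h \<le> integral {a..b} (\<lambda>x. B)"
    unfolding energy_def by (rule integral_le) (use powr_integrable[OF p h] le in auto)
  then show ?thesis using ab by simp
qed

lemma energy_cells:
  assumes p: "0 < p" "p \<le> 1" and h: "h absolutely_integrable_on {0..1}" and N: "N \<ge> 1"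
  shows "energy p 0 1 h = (\<Sum>i<N. energy p (real i / real N) (real (Suc i) / real N) h)"
proof -
  have "energy p 0 (real j / real N) h = (\<Sum>i<j. energy p (real i / real N) (real (Suc i) / real N) h)" if "j \<le> N" for j
    using that
  proof (induction j)
    case (Suc j)
    have "{0..real (Suc j) / real N} \<subseteq> {0..1}" using Suc.prems by (auto simp: field_simps)
    then have I: "(\<lambda>x. \<bar>h x\<bar> powr p) integrable_on {0..real (Suc j) / real N}"
      by (intro powr_integrable[OF p] absolutely_integrable_on_subinterval[OF h])
    have "energy p 0 (real (Suc j) / real N) h = energy p 0 (real j / real N) h + energy p (real j / real N) (real (Suc j) / real N) h"
      unfolding energy_def by (rule Henstock_Kurzweil_Integration.integral_combine[symmetric, OF _ _ I]) (auto intro!: divide_right_mono)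
    then show ?case using Suc by simp
  qed (simp add: energy_def)
  from this[of N] show ?thesis using N by simp
qed

lemma Lp_norm01_eq:
  assumes p: "0 < p" "p \<le> 1" and h: "h absolutely_integrable_on {0..1}"
  shows "Lp_norm01 p h = energy p 0 1 h powr (1 / p)"
proof -
  have "set_integrable lebesgue {0..1} (\<lambda>x. \<bar>h x\<bar> powr p)"
    using powr_integrable[OF p h] by (subst absolutely_integrable_on_iff_nonneg) auto
  then show ?thesis unfolding Lp_norm01_def energy_def by (simp add: set_lebesgue_integral_eq_integral)
qed

lemma Lp_norm01_powr:
  assumes p: "0 < p" "p \<le> 1" and h: "h absolutely_integrable_on {0..1}"
  shows "Lp_norm01 p h powr p = energy p 0 1 h"
  using p energy_nonneg[of p 0 1 h] by (simp add: Lp_norm01_eq[OF p h] powr_powr)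


lemma poly_absolutely_integrable: "poly q absolutely_integrable_on {a..b::real}"
  by (intro absolutely_integrable_continuous_real continuous_intros)

lemma energy_affine:
  fixes q :: "real poly"
  assumes p: "0 < p" "p \<le> 1" and h: "h > 0"
  shows "energy p 0 1 (poly (pcompose q [:a, h:])) = energy p a (a + h) (poly q) / h"
proof -
  have "((\<lambda>x. \<bar>poly q x\<bar> powr p) has_integral energy p a (a + h) (poly q)) (cbox a (a + h))"
    using powr_integrable[OF p poly_absolutely_integrable] unfolding energy_def by (simp add: integrable_integral)
  from has_integral_affinity'[OF this h, of a]
  have "((\<lambda>x. \<bar>poly q (h * x + a)\<bar> powr p) has_integral energy p a (a + h) (poly q) / h) {0..1}"
    using h by (simp add: divide_inverse_commute)
  then show ?thesis unfolding energy_def by (simp add: integral_unique poly_pcompose add.commute mult.commute)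
qed

lemma energy_dilate_half:
  fixes q :: "real poly"
  assumes p: "0 < p" "p \<le> 1"
  shows "energy p 0 1 (poly (pcompose q [:0, 1/2:])) \<le> 2 * energy p 0 1 (poly q)"
  using energy_affine[OF p, of "1/2" q 0] energy_sub[OF p poly_absolutely_integrable, of 0 "1/2" 0 1 q] by simp

lemma energy_scale: "p > 0 \<Longrightarrow> energy p a b (\<lambda>x. c * h x) = \<bar>c\<bar> powr p * energy p a b h"
  unfolding energy_def by (simp add: abs_mult powr_mult)

lemma le_powr:
  fixes t p :: real assumes "0 < p" "p \<le> 1" "0 \<le> t" "t \<le> 1" shows "t \<le> t powr p"
  using powr_mono'[of p 1 t] assms by (cases "t = 0") auto

lemma energy_power_lower:
  assumes p: "0 < p" "p \<le> 1"
  shows "1 / real (Suc d) \<le> energy p 0 1 (\<lambda>x. x ^ d)"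
proof -
  have I: "((\<lambda>x::real. x ^ d) has_integral 1 / real (Suc d)) {0..1}"
    using has_integral_shifted_power[of 0 1 d] by simp
  have "integral {0..1} (\<lambda>x::real. x ^ d) \<le> integral {0..1} (\<lambda>x::real. \<bar>x ^ d\<bar> powr p)"
  proof (rule integral_le)
    show "(\<lambda>x::real. x ^ d) integrable_on {0..1}" using I by blast
    show "(\<lambda>x::real. \<bar>x ^ d\<bar> powr p) integrable_on {0..1}"
      by (rule powr_integrable[OF p]) (intro absolutely_integrable_continuous_real continuous_intros)
    fix x :: real assume "x \<in> {0..1}"
    then have "0 \<le> x ^ d" "x ^ d \<le> 1" by (auto simp: power_le_one)
    then show "x ^ d \<le> \<bar>x ^ d\<bar> powr p" using le_powr[OF p, of "x ^ d"] by simp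
  qed
  then show ?thesis using I unfolding energy_def by (simp add: integral_unique)
qed

section \<open>Polynomials on an interval\<close>

text \<open>
  Induction on the degree. The combination \<open>q(x) - 2\<^sup>d\<^sup>+\<^sup>1 q(x/2)\<close> cancels the leading
  term, multiplies every other coefficient by a factor of modulus at least 1, and its energy is bounded by that of \<open>q\<close>. So all
  coefficients but the leading one are controlled, and the leading one follows by subtraction.
\<close>

lemma poly_coeff_bound:
  assumes p: "0 < p" "p \<le> 1"
  shows "\<exists>C>0. \<forall>q::real poly. degree q \<le> d \<longrightarrow> (\<forall>l. \<bar>coeff q l\<bar> powr p \<le> C * energy p 0 1 (poly q))"
proof (induction d)
  case 0
  have "\<bar>coeff q l\<bar> powr p \<le> 1 * energy p 0 1 (poly q)" if "degree q \<le> 0" for q :: "real poly" and l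
  proof -
    obtain c where q: "q = [:c:]" using \<open>degree q \<le> 0\<close> degree_eq_zeroE[of q] by auto
    have "energy p 0 1 (poly q) = \<bar>c\<bar> powr p" unfolding energy_def q by simp
    then show ?thesis using q by (cases l) auto
  qed
  then show ?case by (intro exI[of _ 1]) auto
next
  case (Suc d)
  then obtain C where C: "C > 0" "\<And>(q::real poly) l. degree q \<le> d \<Longrightarrow> \<bar>coeff q l\<bar> powr p \<le> C * energy p 0 1 (poly q)"
    by blast
  define K where "K = C * (1 + ((2::real) ^ Suc d) powr p * 2)"
  have K: "K > 0" using C(1) unfolding K_def by (intro mult_pos_pos add_pos_nonneg) auto
  define K' where "K' = real (Suc (Suc d)) * (1 + real (Suc d) * K) + K"
  have "\<bar>coeff q l\<bar> powr p \<le> K' * energy p 0 1 (poly q)" if deg: "degree q \<le> Suc d" for q :: "real poly" and l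
  proof -
    let ?e = "energy p 0 1 (poly q)"
    have e0: "?e \<ge> 0" by (rule energy_nonneg)
    \<comment> \<open>The multiplier \<open>1 - 2\<^sup>d\<^sup>+\<^sup>1\<^sup>-\<^sup>l\<close> of the coefficient \<open>l \<le> d\<close> is at most \<open>-1\<close>.\<close>
    define q1 where "q1 = q - smult (2 ^ Suc d) (pcompose q [:0, 1/2:])"
    have cq1: "coeff q1 l = coeff q l * (1 - 2 ^ Suc d / 2 ^ l)" for l
      unfolding q1_def by (simp add: coeff_pcompose_linear power_divide algebra_simps)
    have "degree q1 \<le> d"
    proof (rule degree_le, intro allI impI)
      fix i assume "d < i"
      then show "coeff q1 i = 0" unfolding cq1 using deg by (cases "i = Suc d") (auto simp: coeff_eq_0)
    qed
    from C(2)[OF this] have b1: "\<bar>coeff q1 l\<bar> powr p \<le> C * energy p 0 1 (poly q1)" for l .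
    have "poly q1 = (\<lambda>x. poly q x + (- (2 ^ Suc d)) * poly (pcompose q [:0, 1/2:]) x)"
      by (rule ext) (simp add: q1_def)
    moreover have "(\<lambda>x. (- (2 ^ Suc d)) * poly (pcompose q [:0, 1/2:]) x) absolutely_integrable_on {0..1}"
    proof -
      have "(\<lambda>x. (- (2 ^ Suc d)) * poly (pcompose q [:0, 1/2:]) x) = poly (smult (- (2 ^ Suc d)) (pcompose q [:0, 1/2:]))"
        by (rule ext) simp
      then show ?thesis by (simp only: poly_absolutely_integrable)
    qed
    ultimately have "energy p 0 1 (poly q1) \<le> ?e + energy p 0 1 (\<lambda>x. (- (2 ^ Suc d)) * poly (pcompose q [:0, 1/2:]) x)"
      using energy_triangle[OF p poly_absolutely_integrable[of 0 1 q]] by (simp only:)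
    also have "energy p 0 1 (\<lambda>x. (- (2 ^ Suc d)) * poly (pcompose q [:0, 1/2:]) x) \<le> ((2::real) ^ Suc d) powr p * (2 * ?e)"
      unfolding energy_scale[OF p(1)] abs_minus_cancel using energy_dilate_half[OF p, of q] by (intro mult_mono energy_nonneg) auto
    finally have pe1: "energy p 0 1 (poly q1) \<le> (1 + ((2::real) ^ Suc d) powr p * 2) * ?e" by (simp add: algebra_simps)
    have low: "\<bar>coeff q l\<bar> powr p \<le> K * ?e" if l: "l \<le> d" for l
    proof -
      have "(2::real) ^ Suc d / 2 ^ l = 2 ^ (Suc d - l)" using l by (simp add: power_diff)
      moreover have "(2::real) ^ 1 \<le> 2 ^ (Suc d - l)" by (rule power_increasing) (use l in auto)
      ultimately have "2 \<le> (2::real) ^ Suc d / 2 ^ l" by (simp only: power_one_right)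
      moreover have "1 \<le> \<bar>1 - X\<bar>" if "2 \<le> X" for X :: real using that by linarith
      ultimately have "1 \<le> \<bar>1 - (2::real) ^ Suc d / 2 ^ l\<bar>" by blast
      then have "\<bar>coeff q l\<bar> * 1 \<le> \<bar>coeff q1 l\<bar>" unfolding cq1 abs_mult by (intro mult_left_mono) auto
      then have "\<bar>coeff q l\<bar> powr p \<le> \<bar>coeff q1 l\<bar> powr p" using p by (intro powr_mono2) auto
      also have "\<dots> \<le> C * ((1 + ((2::real) ^ Suc d) powr p * 2) * ?e)"
        using b1[of l] pe1 C(1) by (meson mult_left_mono order_trans less_imp_le)
      finally show ?thesis by (simp add: K_def)
    qed
    let ?c = "coeff q (Suc d)"
    define q2 where "q2 = q - monom ?c (Suc d)"
    have cq2: "coeff q2 l = (if l = Suc d then 0 else coeff q l)" for l by (simp add: q2_def)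
    have d2: "degree q2 \<le> d"
      by (rule degree_le) (use deg in \<open>auto simp: cq2 coeff_eq_0\<close>)
    have sup2: "\<bar>poly q2 x\<bar> powr p \<le> real (Suc d) * K * ?e" if x: "x \<in> {0..1}" for x
    proof -
      have "poly q2 x = (\<Sum>i\<le>d. coeff q2 i * x ^ i)"
        unfolding poly_altdef by (rule sum.mono_neutral_left) (use d2 in \<open>auto simp: coeff_eq_0\<close>)
      then have "\<bar>poly q2 x\<bar> powr p \<le> (\<Sum>i\<le>d. \<bar>coeff q2 i * x ^ i\<bar> powr p)"
        using powr_sum_le[OF p, of "{..d}"] by simp
      also have "\<dots> \<le> (\<Sum>i\<le>d. K * ?e)"
      proof (rule sum_mono)
        fix i assume i: "i \<in> {..d}"
        have "\<bar>coeff q2 i * x ^ i\<bar> \<le> \<bar>coeff q i\<bar> * 1"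
          unfolding abs_mult using x by (intro mult_mono) (auto simp: cq2 power_le_one)
        then have "\<bar>coeff q2 i * x ^ i\<bar> powr p \<le> \<bar>coeff q i\<bar> powr p" using p by (intro powr_mono2) auto
        then show "\<bar>coeff q2 i * x ^ i\<bar> powr p \<le> K * ?e" using low[of i] i by auto
      qed
      finally show ?thesis by simp
    qed
    have "(\<lambda>x. - poly q2 x) = poly (- q2)" by (rule ext) simp
    then have ai2: "(\<lambda>x. - poly q2 x) absolutely_integrable_on {0..1}" by (simp only: poly_absolutely_integrable)
    have "energy p 0 1 (\<lambda>x. ?c * x ^ Suc d) \<le> ?e + energy p 0 1 (\<lambda>x. - poly q2 x)"
    proof -
      have "(\<lambda>x. ?c * x ^ Suc d) = (\<lambda>x. poly q x + - poly q2 x)"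
        by (rule ext) (simp add: q2_def poly_monom)
      with ai2 show ?thesis using energy_triangle[OF p poly_absolutely_integrable, of 0 1 "\<lambda>x. - poly q2 x" q] by simp
    qed
    also have "energy p 0 1 (\<lambda>x. - poly q2 x) \<le> (1 - 0) * (real (Suc d) * K * ?e)"
      by (rule energy_bounded[OF p]) (use sup2 ai2 in auto)
    finally have up: "energy p 0 1 (\<lambda>x. ?c * x ^ Suc d) \<le> (1 + real (Suc d) * K) * ?e" by (simp add: algebra_simps)
    have "\<bar>?c\<bar> powr p * (1 / real (Suc (Suc d))) \<le> energy p 0 1 (\<lambda>x. ?c * x ^ Suc d)"
      unfolding energy_scale[OF p(1)] by (intro mult_left_mono energy_power_lower p) auto
    then have top: "\<bar>?c\<bar> powr p \<le> real (Suc (Suc d)) * (1 + real (Suc d) * K) * ?e"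
    proof -
      let ?X = "energy p 0 1 (\<lambda>x. ?c * x ^ Suc d)"
      assume "\<bar>?c\<bar> powr p * (1 / real (Suc (Suc d))) \<le> ?X"
      then have "\<bar>?c\<bar> powr p \<le> real (Suc (Suc d)) * ?X" by (simp add: field_simps del: of_nat_Suc power_Suc)
      also have "\<dots> \<le> real (Suc (Suc d)) * ((1 + real (Suc d) * K) * ?e)" by (rule mult_left_mono[OF up]) simp
      finally show ?thesis by (simp only: mult.assoc)
    qed
    have P1: "0 \<le> real (Suc (Suc d)) * (1 + real (Suc d) * K) * ?e" "0 \<le> K * ?e"
      using K e0 by auto
    have KK: "K' * ?e = real (Suc (Suc d)) * (1 + real (Suc d) * K) * ?e + K * ?e" by (simp only: K'_def distrib_right)
    consider "l \<le> d" | "l = Suc d" | "l > Suc d" by linarith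
    then show ?thesis
    proof cases
      case 1 then show ?thesis using low[OF 1] P1 unfolding KK by linarith
    next
      case 2 then show ?thesis using top P1 unfolding KK 2 by linarith
    next
      case 3 then have "coeff q l = 0" using deg by (auto simp: coeff_eq_0)
      then show ?thesis using P1 p unfolding KK by simp
    qed
  qed
  moreover have "K' > 0" using K unfolding K'_def by (intro add_nonneg_pos mult_nonneg_nonneg) auto
  ultimately show ?case by blast
qed

text \<open>
  After an affine substitution both bounds follow from the bounds for the coefficients.
\<close>

lemma poly_sup_bound:
  assumes p: "0 < p" "p \<le> 1"
  obtains C where "C > 0" "\<And>(q::real poly) a h x. degree q \<le> d \<Longrightarrow> h > 0 \<Longrightarrow> x \<in> {a..a+h} \<Longrightarrow>
     \<bar>poly q x\<bar> powr p \<le> C / h * energy p a (a + h) (poly q)"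
    "\<And>(q::real poly) a h x. degree q \<le> d \<Longrightarrow> h > 0 \<Longrightarrow> x \<in> {a..a+h} \<Longrightarrow>
     \<bar>poly (pderiv q) x\<bar> powr p \<le> C / h / h powr p * energy p a (a + h) (poly q)"
proof -
  obtain C where C: "C > 0" "\<And>(q::real poly) l. degree q \<le> d \<Longrightarrow> \<bar>coeff q l\<bar> powr p \<le> C * energy p 0 1 (poly q)"
    using poly_coeff_bound[OF p, of d] by blast
  define K where "K = real (Suc d) * C * real (Suc d)"
  have gen: "\<bar>poly s y\<bar> powr p \<le> K * energy p 0 1 (poly Q)"
    if Q: "degree Q \<le> d" and s: "degree s \<le> d" "\<And>l. \<bar>coeff s l\<bar> powr p \<le> real (Suc d) * C * energy p 0 1 (poly Q)"
      and y: "y \<in> {0..1}" for Q s :: "real poly" and y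
  proof -
    have "poly s y = (\<Sum>i\<le>d. coeff s i * y ^ i)"
      unfolding poly_altdef by (rule sum.mono_neutral_left) (use s(1) in \<open>auto simp: coeff_eq_0\<close>)
    then have "\<bar>poly s y\<bar> powr p \<le> (\<Sum>i\<le>d. \<bar>coeff s i * y ^ i\<bar> powr p)"
      using powr_sum_le[OF p, of "{..d}"] by simp
    also have "\<dots> \<le> (\<Sum>i\<le>d. real (Suc d) * C * energy p 0 1 (poly Q))"
    proof (rule sum_mono)
      fix i
      have "\<bar>coeff s i * y ^ i\<bar> \<le> \<bar>coeff s i\<bar> * 1"
        unfolding abs_mult using y by (intro mult_mono) (auto simp: power_le_one)
      then have "\<bar>coeff s i * y ^ i\<bar> powr p \<le> \<bar>coeff s i\<bar> powr p" using p by (intro powr_mono2) auto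
      then show "\<bar>coeff s i * y ^ i\<bar> powr p \<le> real (Suc d) * C * energy p 0 1 (poly Q)" using s(2)[of i] by linarith
    qed
    finally show ?thesis by (simp add: K_def algebra_simps)
  qed
  have K: "K > 0" using C(1) by (simp add: K_def)
  have le: "C * energy p 0 1 (poly Q) \<le> real (Suc d) * C * energy p 0 1 (poly Q)" for Q
  proof -
    have "1 * (C * energy p 0 1 (poly Q)) \<le> real (Suc d) * (C * energy p 0 1 (poly Q))"
      by (rule mult_right_mono) (use C(1) energy_nonneg in auto)
    then show ?thesis by (simp add: mult.assoc)
  qed
  show thesis
  proof (rule that[OF K])
    fix q :: "real poly" and a h x assume q: "degree q \<le> d" and h: "h > (0::real)" and x: "x \<in> {a..a+h}"
    define Q where "Q = pcompose q [:a, h:]"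
    define y where "y = (x - a) / h"
    have y: "y \<in> {0..1}" "x = a + h * y" using x h by (auto simp: y_def field_simps)
    have dQ: "degree Q \<le> d" unfolding Q_def using degree_pcompose_le[of q "[:a,h:]"] q h by simp
    have ce: "energy p 0 1 (poly Q) = energy p a (a + h) (poly q) / h" unfolding Q_def by (rule energy_affine[OF p h])
    have "\<bar>poly Q y\<bar> powr p \<le> K * energy p 0 1 (poly Q)"
      by (rule gen[OF dQ dQ _ y(1)]) (use C(2)[OF dQ] le order_trans in blast)
    then show "\<bar>poly q x\<bar> powr p \<le> K / h * energy p a (a + h) (poly q)"
      unfolding ce by (simp add: Q_def poly_pcompose y(2) mult.commute)
    have "\<bar>poly (pderiv Q) y\<bar> powr p \<le> K * energy p 0 1 (poly Q)"
    proof (rule gen[OF dQ _ _ y(1)])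
      show "degree (pderiv Q) \<le> d" using degree_pderiv[of Q] dQ by simp
      fix l
      show "\<bar>coeff (pderiv Q) l\<bar> powr p \<le> real (Suc d) * C * energy p 0 1 (poly Q)"
      proof (cases "l < d")
        case True
        have "real (Suc l) powr p \<le> real (Suc d) powr 1"
        proof -
          have "real (Suc l) powr p \<le> real (Suc l) powr 1" using p by (intro powr_mono) auto
          then show ?thesis using True by simp
        qed
        then have "real (Suc l) powr p * \<bar>coeff Q (Suc l)\<bar> powr p \<le> real (Suc d) * (C * energy p 0 1 (poly Q))"
          using C(2)[OF dQ, of "Suc l"] by (intro mult_mono) auto
        then show ?thesis by (simp add: coeff_pderiv abs_mult powr_mult mult.assoc del: of_nat_Suc)
      next
        case False
        then have "coeff (pderiv Q) l = 0" using dQ by (simp add: coeff_pderiv coeff_eq_0)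
        then show ?thesis using C(1) p energy_nonneg[of p 0 1 "poly Q"] by simp
      qed
    qed
    moreover have "poly (pderiv Q) y = h * poly (pderiv q) x"
      unfolding Q_def pderiv_pcompose by (simp add: poly_pcompose y(2) pderiv_pCons mult.commute)
    ultimately have "h powr p * \<bar>poly (pderiv q) x\<bar> powr p \<le> K * (energy p a (a + h) (poly q) / h)"
      unfolding ce using h by (simp add: abs_mult powr_mult)
    then show "\<bar>poly (pderiv q) x\<bar> powr p \<le> K / h / h powr p * energy p a (a + h) (poly q)"
      using h by (simp add: field_simps)
  qed
qed

text \<open>
  The inequality of Nikolskii between the \<open>L\<^sub>1\<close> norm and the \<open>L\<^sub>p\<close> quasinorm.
\<close>

lemma poly_nikolskii:
  assumes p: "0 < p" "p \<le> 1"
  obtains C where "C > 0" "\<And>(q::real poly) a h. degree q \<le> d \<Longrightarrow> h > 0 \<Longrightarrow>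
     (integral {a..a+h} (\<lambda>x. \<bar>poly q x\<bar>)) powr p \<le> C * h powr (p - 1) * energy p a (a + h) (poly q)"
proof -
  obtain C where C: "C > 0" "\<And>(q::real poly) a h x. degree q \<le> d \<Longrightarrow> h > 0 \<Longrightarrow> x \<in> {a..a+h} \<Longrightarrow>
     \<bar>poly q x\<bar> powr p \<le> C / h * energy p a (a + h) (poly q)"
    using poly_sup_bound[OF p, of d] by metis
  show thesis
  proof (rule that[OF C(1)])
    fix q :: "real poly" and a h assume q: "degree q \<le> d" and h: "h > (0::real)"
    define B where "B = (C / h * energy p a (a + h) (poly q)) powr (1 / p)"
    have nn: "0 \<le> C / h * energy p a (a + h) (poly q)" "0 \<le> C * energy p a (a + h) (poly q)" using C(1) h energy_nonneg by simp_all
    have "integral {a..a+h} (\<lambda>x. \<bar>poly q x\<bar>) \<le> integral {a..a+h} (\<lambda>x. B)"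
    proof (rule integral_le)
      show "(\<lambda>x. \<bar>poly q x\<bar>) integrable_on {a..a+h}"
        using poly_absolutely_integrable[of _ _ q] by (simp add: absolutely_integrable_on_def)
      fix x assume "x \<in> {a..a+h}"
      from C(2)[OF q h this] have "(\<bar>poly q x\<bar> powr p) powr (1/p) \<le> B"
        unfolding B_def using p by (intro powr_mono2) auto
      then show "\<bar>poly q x\<bar> \<le> B" using p by (simp add: powr_powr)
    qed auto
    then have le: "integral {a..a+h} (\<lambda>x. \<bar>poly q x\<bar>) \<le> h * B" using h by simp
    have "0 \<le> integral {a..a+h} (\<lambda>x. \<bar>poly q x\<bar>)"
      using poly_absolutely_integrable[of _ _ q] by (intro integral_nonneg) (auto simp: absolutely_integrable_on_def)
    then have "(integral {a..a+h} (\<lambda>x. \<bar>poly q x\<bar>)) powr p \<le> (h * B) powr p" using le p by (intro powr_mono2) auto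
    also have "\<dots> = h powr p * (C / h * energy p a (a + h) (poly q))"
      using h nn p by (simp add: powr_mult B_def powr_powr)
    also have "\<dots> = C * h powr (p - 1) * energy p a (a + h) (poly q)"
      using h by (simp add: powr_diff)
    finally show "(integral {a..a+h} (\<lambda>x. \<bar>poly q x\<bar>)) powr p \<le> C * h powr (p - 1) * energy p a (a + h) (poly q)" .
  qed
qed

text \<open>
  The inequality of Markov for the \<open>r\<close>-th derivative, by iteration from the first derivative.
\<close>

lemma poly_markov:
  assumes p: "0 < p" "p \<le> 1"
  obtains C where "C > 0" "\<And>(q::real poly) a h. degree q \<le> d \<Longrightarrow> h > 0 \<Longrightarrow>
     energy p a (a + h) (poly ((pderiv ^^ r) q)) \<le> C * h powr (- (real r * p)) * energy p a (a + h) (poly q)"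
proof -
  obtain C where C: "C > 0" "\<And>(q::real poly) a h x. degree q \<le> d \<Longrightarrow> h > 0 \<Longrightarrow> x \<in> {a..a+h} \<Longrightarrow>
     \<bar>poly (pderiv q) x\<bar> powr p \<le> C / h / h powr p * energy p a (a + h) (poly q)"
    using poly_sup_bound[OF p, of d] by metis
  have one: "energy p a (a + h) (poly (pderiv q)) \<le> C * h powr (- p) * energy p a (a + h) (poly q)"
    if "degree q \<le> d" "h > 0" for q :: "real poly" and a h
  proof -
    have "energy p a (a + h) (poly (pderiv q)) \<le> (a + h - a) * (C / h / h powr p * energy p a (a + h) (poly q))"
      by (rule energy_bounded[OF p poly_absolutely_integrable]) (use C(2) that in auto)
    then show ?thesis using that by (simp add: powr_minus field_simps)
  qed
  have "degree ((pderiv ^^ r) q) \<le> d \<and> energy p a (a + h) (poly ((pderiv ^^ r) q)) \<le> C ^ r * h powr (- (real r * p)) * energy p a (a + h) (poly q)"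
    if "degree q \<le> d" "h > 0" for q :: "real poly" and a h
  proof (induction r)
    case 0
    then show ?case using that by simp
  next
    case (Suc r)
    have "energy p a (a + h) (poly (pderiv ((pderiv ^^ r) q))) \<le> C * h powr (- p) * energy p a (a + h) (poly ((pderiv ^^ r) q))"
      by (rule one) (use Suc that in auto)
    also have "\<dots> \<le> C * h powr (- p) * (C ^ r * h powr (- (real r * p)) * energy p a (a + h) (poly q))"
      using Suc C(1) by (intro mult_left_mono) auto
    also have "\<dots> = C ^ Suc r * (h powr (- p) * h powr (- (real r * p))) * energy p a (a + h) (poly q)" by simp
    also have "h powr (- p) * h powr (- (real r * p)) = h powr (- (real (Suc r) * p))"
      by (simp add: powr_add[symmetric] algebra_simps)
    finally have "energy p a (a + h) (poly ((pderiv ^^ Suc r) q)) \<le> C ^ Suc r * h powr (- (real (Suc r) * p)) * energy p a (a + h) (poly q)" by simp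
    moreover have "degree ((pderiv ^^ Suc r) q) \<le> d"
      using Suc degree_pderiv[of "(pderiv ^^ r) q"] by (simp add: le_diff_conv)
    ultimately show ?case by blast
  qed
  then show thesis using that[of "C ^ r"] C(1) by simp
qed


section \<open>Mixing meshes that are not nested\<close>

text \<open>
  No knot \<open>q/\<nu>\<close> lies in the open cell from \<open>i/M\<close> to \<open>(i+1)/M\<close>; the fractions are cleared.
\<close>

definition knot_free :: "nat \<Rightarrow> nat \<Rightarrow> nat \<Rightarrow> bool" where
  "knot_free M i \<nu> \<longleftrightarrow> (\<forall>q. q * M \<le> i * \<nu> \<or> (i + 1) * \<nu> \<le> q * M)"

lemma not_knot_free:
  assumes "\<not> knot_free M i \<nu>" "M > 0"
  obtains q :: nat where "0 < real q - real \<nu> * (real i / real M)" "real q - real \<nu> * (real i / real M) < real \<nu> / real M"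
proof -
  obtain q where q: "i * \<nu> < q * M" "q * M < (i + 1) * \<nu>" using assms by (auto simp: knot_free_def not_le)
  have "real (i * \<nu>) < real (q * M)" "real (q * M) < real ((i + 1) * \<nu>)" using q by (simp_all only: of_nat_less_iff)
  then have "real \<nu> * (real i / real M) < real q" "real q < real \<nu> / real M + real \<nu> * (real i / real M)"
    using assms(2) by (simp_all add: field_simps)
  then show thesis by (intro that[of q]) linarith+
qed

lemma multiple_away_from_integers:
  fixes \<theta> :: real assumes "0 < \<theta>" "\<theta> \<le> 1 / 2"
  obtains s :: nat where "1 / 4 \<le> real s * \<theta>" "real s * \<theta> \<le> 3 / 4" "real s < 1 / (4 * \<theta>) + 1"
proof
  let ?s = "nat \<lceil>1 / (4 * \<theta>)\<rceil>"
  have "1 / (4 * \<theta>) > 0" using assms by simp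
  then have s: "1 / (4 * \<theta>) \<le> real ?s" "real ?s < 1 / (4 * \<theta>) + 1" by linarith+
  show "real ?s < 1 / (4 * \<theta>) + 1" by (rule s(2))
  show "1 / 4 \<le> real ?s * \<theta>" using mult_right_mono[OF s(1), of \<theta>] assms by simp
  have "real ?s * \<theta> \<le> (1 / (4 * \<theta>) + 1) * \<theta>" using s(2) assms by (intro mult_right_mono) auto
  also have "\<dots> = 1 / 4 + \<theta>" using assms by (simp add: field_simps)
  finally show "real ?s * \<theta> \<le> 3 / 4" using assms by simp
qed

text \<open>
  If \<open>\<theta> = i/M\<close> and a knot \<open>q/\<nu>\<close> lies in the cell, then \<open>\<nu> \<theta>\<close> falls short of the integer \<open>q\<close> by
  less than \<open>\<nu>/M \<le> 1/4\<close>. If this happens for \<open>\<nu>\<close> and \<open>\<nu> + s\<close>, then \<open>s \<theta>\<close> has distance less than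
  \<open>1/4\<close> from an integer. So any \<open>s\<close> for which \<open>s \<theta>\<close> stays away from the integers works, and one can be
  found with \<open>s \<le> 2a\<close> unless \<open>\<theta>\<close> is so close to 0 or 1 that the cell is knot-free for all \<open>\<nu> \<le> 2a\<close>.
\<close>

lemma knot_free_or_shift:
  assumes a: "a \<ge> 1" and i: "i < 16 * a"
  obtains s where "s \<le> 2 * a" "\<And>\<nu>. \<nu> \<in> {a<..2*a} \<Longrightarrow> knot_free (16 * a) i \<nu> \<or> knot_free (16 * a) i (\<nu> + s)"
proof -
  note result = that
  let ?M = "16 * a"
  define \<theta> where "\<theta> = real i / real ?M"
  have M0: "?M > 0" using a by simp
  have \<theta>: "0 \<le> \<theta>" "\<theta> \<le> 1 - 1 / real ?M"
  proof -
    have "real i \<le> real ?M - 1" using i by linarith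
    then show "\<theta> \<le> 1 - 1 / real ?M" using M0 by (simp add: \<theta>_def field_simps)
  qed (simp add: \<theta>_def)
  have small: "real \<nu> / real ?M \<le> 1 / 4" if "\<nu> \<le> 4 * a" for \<nu> using that a by (simp add: field_simps)
  have small2: "real \<nu> / real ?M \<le> 1 / 8" if "\<nu> \<le> 2 * a" for \<nu> using that a by (simp add: field_simps)
  have shift: thesis if s: "s \<le> 2 * a" and away: "\<And>z::int. \<bar>real s * \<theta> - real_of_int z\<bar> \<ge> 1 / 4" for s
  proof (rule result[OF s], rule ccontr)
    fix \<nu> assume \<nu>: "\<nu> \<in> {a<..2*a}" and "\<not> (knot_free ?M i \<nu> \<or> knot_free ?M i (\<nu> + s))"
    then have b: "\<not> knot_free ?M i \<nu>" "\<not> knot_free ?M i (\<nu> + s)" by auto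
    obtain q where q: "0 < real q - real \<nu> * \<theta>" "real q - real \<nu> * \<theta> < real \<nu> / real ?M"
      using not_knot_free[OF b(1) M0] unfolding \<theta>_def by metis
    obtain q' where q': "0 < real q' - real (\<nu> + s) * \<theta>" "real q' - real (\<nu> + s) * \<theta> < real (\<nu> + s) / real ?M"
      using not_knot_free[OF b(2) M0] unfolding \<theta>_def by metis
    have "\<bar>real s * \<theta> - real_of_int (int q' - int q)\<bar> < 1 / 4"
    proof -
      have "\<nu> \<le> 4 * a" "\<nu> + s \<le> 4 * a" using \<nu> s by auto
      note sm = small[OF this(1)] small[OF this(2)]
      have "real q - real \<nu> * \<theta> < 1 / 4" using q(2) sm(1) by linarith
      moreover have "real q' - real (\<nu> + s) * \<theta> < 1 / 4" using q'(2) sm(2) by linarith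
      moreover have "real (\<nu> + s) * \<theta> = real \<nu> * \<theta> + real s * \<theta>" by (simp add: distrib_right)
      moreover have "real_of_int (int q' - int q) = real q' - real q" by simp
      ultimately show ?thesis using q(1) q'(1) by linarith
    qed
    then show False using away[of "int q' - int q"] by simp
  qed
  have noshift: thesis if "\<And>\<nu>. \<nu> \<in> {a<..2*a} \<Longrightarrow> knot_free ?M i \<nu>"
    by (rule result[of 0]) (use that in auto)
  have bound: "s \<le> 2 * a" if "real s < 1 / (4 * x) + 1" "x > 3 / (8 * real a)" for s :: nat and x :: real
  proof -
    have "3 / (8 * real a) > 0" using a by simp
    then have "x > 0" using that(2) by linarith
    have "1 / (4 * x) < 2 * real a / 3" using that(2) \<open>x > 0\<close> a by (simp add: field_simps)
    then have "real s < 2 * real a / 3 + 1" using that(1) by linarith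
    then show ?thesis using a by linarith
  qed
  have away: "\<bar>t - real_of_int z\<bar> \<ge> 1 / 4" if "1 / 4 \<le> t" "t \<le> 3 / 4" for t and z :: int
  proof (cases "z \<le> 0")
    case True then have "real_of_int z \<le> 0" by simp
    then show ?thesis using that by linarith
  next
    case False then have "real_of_int z \<ge> 1" by linarith
    then show ?thesis using that by linarith
  qed
  show thesis
  proof (cases "\<theta> \<le> 1 / 2")
    case True
    show thesis
    proof (cases "\<theta> \<le> 3 / (8 * real a)")
      case le: True
      show thesis
      proof (rule noshift, rule ccontr)
        fix \<nu> assume \<nu>: "\<nu> \<in> {a<..2*a}" and b: "\<not> knot_free ?M i \<nu>"
        obtain q where q: "0 < real q - real \<nu> * \<theta>" "real q - real \<nu> * \<theta> < real \<nu> / real ?M"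
          using not_knot_free[OF b M0] unfolding \<theta>_def by metis
        have "real \<nu> * \<theta> \<le> (2 * real a) * (3 / (8 * real a))" using \<nu> le \<theta> by (intro mult_mono) auto
        also have "\<dots> = 3 / 4" using a by simp
        finally have "real \<nu> * \<theta> \<le> 3 / 4" .
        moreover have "0 \<le> real \<nu> * \<theta>" using \<theta> by simp
        moreover have "real \<nu> / real ?M \<le> 1 / 8" by (rule small2) (use \<nu> in auto)
        ultimately have "0 < real q" "real q < 1" using q by linarith+
        then show False by simp
      qed
    next
      case False
      then have pos: "\<theta> > 0" using \<theta>(1) by (cases "\<theta> = 0") auto
      obtain s where s: "1 / 4 \<le> real s * \<theta>" "real s * \<theta> \<le> 3 / 4" "real s < 1 / (4 * \<theta>) + 1"
        using multiple_away_from_integers[OF pos True] by blast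
      show thesis by (rule shift[OF bound[OF s(3)] away[OF s(1,2)]]) (use False in simp)
    qed
  next
    case big: False
    define \<phi> where "\<phi> = 1 - \<theta>"
    have \<phi>: "1 / real ?M \<le> \<phi>" "\<phi> \<le> 1 / 2" using \<theta> big by (auto simp: \<phi>_def)
    have M1: "1 / real ?M > 0" using M0 by simp
    have pos: "\<phi> > 0" using \<phi>(1) M1 by linarith
    show thesis
    proof (cases "\<phi> \<le> 3 / (8 * real a)")
      case le: True
      show thesis
      proof (rule noshift, rule ccontr)
        fix \<nu> assume \<nu>: "\<nu> \<in> {a<..2*a}" and b: "\<not> knot_free ?M i \<nu>"
        obtain q where q: "0 < real q - real \<nu> * \<theta>" "real q - real \<nu> * \<theta> < real \<nu> / real ?M"
          using not_knot_free[OF b M0] unfolding \<theta>_def by metis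
        have "real \<nu> * \<phi> \<le> (2 * real a) * (3 / (8 * real a))" using \<nu> le pos by (intro mult_mono) auto
        also have "\<dots> = 3 / 4" using a by simp
        finally have up: "real \<nu> * \<phi> \<le> 3 / 4" .
        have "real \<nu> * (1 / real ?M) \<le> real \<nu> * \<phi>" using \<phi> by (intro mult_left_mono) auto
        then have lo: "real \<nu> / real ?M \<le> real \<nu> * \<phi>" by simp
        \<comment> \<open>For \<open>\<theta>\<close> close to 1 the knot would satisfy \<open>-1 < q - \<nu> < 0\<close>.\<close>
        define w where "w = int q - int \<nu>"
        have e: "real q - real \<nu> * \<theta> = real_of_int w + real \<nu> * \<phi>" by (simp add: w_def \<phi>_def algebra_simps)
        have "real_of_int w < 0" "real_of_int w > -1" using q up lo unfolding e by linarith+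
        then have "w < 0" "- 1 < w" using of_int_less_iff[of "- 1" w, where 'a = real] by simp_all
        then show False by linarith
      qed
    next
      case False
      obtain s where s: "1 / 4 \<le> real s * \<phi>" "real s * \<phi> \<le> 3 / 4" "real s < 1 / (4 * \<phi>) + 1"
        using multiple_away_from_integers[OF pos \<phi>(2)] by blast
      show thesis
      proof (rule shift[of s])
        show "s \<le> 2 * a" by (rule bound[OF s(3)]) (use False in simp)
        fix z :: int
        have "real s * \<theta> - real_of_int z = - (real s * \<phi> - real_of_int (int s - z))" by (simp add: \<phi>_def algebra_simps)
        then show "1 / 4 \<le> \<bar>real s * \<theta> - real_of_int z\<bar>" using away[OF s(1,2), of "int s - z"] by linarith
      qed
    qed
  qed
qed

text \<open>
  Were the bound violated by every knot-free \<open>\<nu>\<close>, then \<open>e(\<nu>) + e(\<nu> + s)\<close> would be too large for each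
  of the \<open>a\<close> values \<open>a < \<nu> \<le> 2a\<close>, and adding these up would exceed twice the total.
\<close>

lemma exists_good_knot_free:
  fixes e :: "nat \<Rightarrow> real"
  assumes a: "a \<ge> 1" and i: "i < 16 * a" and e: "\<And>\<nu>. e \<nu> \<ge> 0"
  obtains \<nu> where "\<nu> \<in> {a<..4*a}" "knot_free (16 * a) i \<nu>" "real a * e \<nu> \<le> 2 * (\<Sum>\<kappa>\<in>{a<..4*a}. e \<kappa>)"
proof (rule ccontr)
  note result = that
  assume neg: "\<not> thesis"
  let ?S = "\<Sum>\<kappa>\<in>{a<..4*a}. e \<kappa>"
  have bad: "2 * ?S < real a * e \<nu>" if "\<nu> \<in> {a<..4*a}" "knot_free (16 * a) i \<nu>" for \<nu>
  proof (rule ccontr)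
    assume "\<not> 2 * ?S < real a * e \<nu>"
    then have "real a * e \<nu> \<le> 2 * ?S" by simp
    with result[OF that] neg show False by blast
  qed
  obtain s where s: "s \<le> 2 * a" "\<And>\<nu>. \<nu> \<in> {a<..2*a} \<Longrightarrow> knot_free (16 * a) i \<nu> \<or> knot_free (16 * a) i (\<nu> + s)"
    using knot_free_or_shift[OF a i] by blast
  have "(\<Sum>\<nu>\<in>{a<..2*a}. 2 * ?S) < (\<Sum>\<nu>\<in>{a<..2*a}. real a * e \<nu> + real a * e (\<nu> + s))"
  proof (rule sum_strict_mono)
    show "{a<..2*a} \<noteq> {}" using a by simp
    fix \<nu> assume \<nu>: "\<nu> \<in> {a<..2*a}"
    have nn: "0 \<le> real a * e \<nu>" "0 \<le> real a * e (\<nu> + s)" using e by auto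
    from s(2)[OF \<nu>] show "2 * ?S < real a * e \<nu> + real a * e (\<nu> + s)"
    proof
      assume "knot_free (16 * a) i \<nu>"
      from bad[OF _ this] show ?thesis using \<nu> nn by fastforce
    next
      assume "knot_free (16 * a) i (\<nu> + s)"
      from bad[OF _ this] show ?thesis using \<nu> s(1) nn by fastforce
    qed
  qed simp
  also have "\<dots> = real a * ((\<Sum>\<nu>\<in>{a<..2*a}. e \<nu>) + (\<Sum>\<nu>\<in>{a<..2*a}. e (\<nu> + s)))"
    by (simp add: sum.distrib sum_distrib_left distrib_left)
  also have "\<dots> \<le> real a * (?S + ?S)"
  proof (intro mult_left_mono add_mono)
    show "(\<Sum>\<nu>\<in>{a<..2*a}. e \<nu>) \<le> ?S" by (rule sum_mono2) (use e in auto)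
    have "(\<Sum>\<nu>\<in>{a<..2*a}. e (\<nu> + s)) = sum e ((\<lambda>\<nu>. \<nu> + s) ` {a<..2*a})"
      by (subst sum.reindex) (auto simp: inj_on_def)
    also have "\<dots> \<le> ?S" by (rule sum_mono2) (use e s(1) in auto)
    finally show "(\<Sum>\<nu>\<in>{a<..2*a}. e (\<nu> + s)) \<le> ?S" .
  qed simp
  finally show False by simp
qed

lemma knot_free_cell:
  assumes "knot_free M i \<nu>" "i < M" "\<nu> \<ge> 1"
  obtains j where "j < \<nu>" "{real i / real M<..<real (Suc i) / real M} \<subseteq> {real j / real \<nu><..<real (Suc j) / real \<nu>}"
proof -
  define j where "j = i * \<nu> div M"
  have M: "M > 0" using assms by simp
  have 1: "j * M \<le> i * \<nu>" by (simp add: j_def)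
  have 2: "i * \<nu> < (j + 1) * M" using M by (simp add: j_def dividend_less_div_times)
  have 3: "(i + 1) * \<nu> \<le> (j + 1) * M" using assms(1) 2 unfolding knot_free_def by (meson not_le)
  have "i * \<nu> < M * \<nu>" using assms by simp
  from le_less_trans[OF 1 this] have j: "j < \<nu>" by (simp add: mult.commute)
  have "real (j * M) \<le> real (i * \<nu>)" "real ((i + 1) * \<nu>) \<le> real ((j + 1) * M)" using 1 3 by (simp_all only: of_nat_le_iff)
  then have "real j / real \<nu> \<le> real i / real M" "real (Suc i) / real M \<le> real (Suc j) / real \<nu>"
    using M assms(3) by (simp_all add: field_simps)
  note le = this
  show thesis
  proof (rule that[OF j], rule subsetI)
    fix x assume "x \<in> {real i / real M<..<real (Suc i) / real M}"
    then show "x \<in> {real j / real \<nu><..<real (Suc j) / real \<nu>}"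
      using le unfolding greaterThanLessThan_iff by linarith
  qed
qed

definition pwpoly :: "nat \<Rightarrow> (nat \<Rightarrow> real poly) \<Rightarrow> real \<Rightarrow> real" where
  "pwpoly M Q x = poly (Q (nat \<lfloor>real M * x\<rfloor>)) x"

lemma pw_polys_pwpoly:
  assumes "\<And>i. i < M \<Longrightarrow> degree (Q i) < k" shows "pw_polys k M (pwpoly M Q) Q"
  unfolding pw_polys_def
proof (intro allI impI conjI ballI)
  fix i x assume i: "i < M" and x: "x \<in> {real i / real M<..<real (Suc i) / real M}"
  then have "real i < real M * x" "real M * x < real i + 1" by (auto simp: field_simps)
  then have "\<lfloor>real M * x\<rfloor> = int i" by linarith
  then show "pwpoly M Q x = poly (Q i) x" by (simp add: pwpoly_def)
qed (use assms in auto)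

text \<open>
  In each cell take the polynomial piece of a spline with between \<open>a\<close> and \<open>4a\<close> cells that has no knot there and is up to a constant
  no worse than the average, then glue without regard to continuity.
\<close>

theorem spline_mixing:
  assumes p: "0 < p" "p \<le> 1" and a: "a \<ge> 1" and g: "g absolutely_integrable_on {0..1}"
    and T: "\<And>\<nu>. \<nu> \<in> {a<..4*a} \<Longrightarrow> pw_polys k \<nu> (T \<nu>) (q \<nu>)"
  obtains P Q where "pw_polys k (16 * a) P Q"
    "real a * energy p 0 1 (\<lambda>x. g x - P x) \<le> 2 * (\<Sum>\<nu>\<in>{a<..4*a}. energy p 0 1 (\<lambda>x. g x - T \<nu> x))"
proof -
  let ?M = "16 * a"
  let ?l = "\<lambda>i. real i / real ?M" and ?u = "\<lambda>i. real (Suc i) / real ?M"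
  have M: "?M \<ge> 1" using a by simp
  have "\<exists>Q. degree Q < k \<and> real a * energy p (?l i) (?u i) (\<lambda>x. g x - poly Q x)
      \<le> 2 * (\<Sum>\<nu>\<in>{a<..4*a}. energy p (?l i) (?u i) (\<lambda>x. g x - T \<nu> x))" if i: "i < ?M" for i
  proof -
    obtain \<nu> where \<nu>: "\<nu> \<in> {a<..4*a}" "knot_free ?M i \<nu>"
      "real a * energy p (?l i) (?u i) (\<lambda>x. g x - T \<nu> x) \<le> 2 * (\<Sum>\<nu>\<in>{a<..4*a}. energy p (?l i) (?u i) (\<lambda>x. g x - T \<nu> x))"
      by (rule exists_good_knot_free[OF a i, of "\<lambda>\<nu>. energy p (?l i) (?u i) (\<lambda>x. g x - T \<nu> x)"]) (use energy_nonneg in auto)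
    obtain j where j: "j < \<nu>" "{?l i<..<?u i} \<subseteq> {real j / real \<nu><..<real (Suc j) / real \<nu>}"
      by (rule knot_free_cell[OF \<nu>(2) i]) (use \<nu>(1) in auto)
    have "T \<nu> x = poly (q \<nu> j) x" if "x \<in> {?l i<..<?u i}" for x
      using T[OF \<nu>(1)] j that unfolding pw_polys_def by blast
    then have "energy p (?l i) (?u i) (\<lambda>x. g x - T \<nu> x) = energy p (?l i) (?u i) (\<lambda>x. g x - poly (q \<nu> j) x)"
      by (intro energy_cong) auto
    moreover have "degree (q \<nu> j) < k" using T[OF \<nu>(1)] j(1) unfolding pw_polys_def by blast
    ultimately show ?thesis using \<nu>(3) by auto
  qed
  note ex = this
  define Q where "Q i = (SOME Q. degree Q < k \<and> real a * energy p (?l i) (?u i) (\<lambda>x. g x - poly Q x)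
      \<le> 2 * (\<Sum>\<nu>\<in>{a<..4*a}. energy p (?l i) (?u i) (\<lambda>x. g x - T \<nu> x)))" for i
  have Q: "degree (Q i) < k \<and> real a * energy p (?l i) (?u i) (\<lambda>x. g x - poly (Q i) x)
      \<le> 2 * (\<Sum>\<nu>\<in>{a<..4*a}. energy p (?l i) (?u i) (\<lambda>x. g x - T \<nu> x))" if "i < ?M" for i
    unfolding Q_def by (rule someI_ex[OF ex[OF that]])
  let ?P = "pwpoly ?M Q"
  have P: "pw_polys k ?M ?P Q" by (rule pw_polys_pwpoly) (use Q in blast)
  have ai: "(\<lambda>x. g x - P x) absolutely_integrable_on {0..1}" if "pw_polys k N P Q'" "N \<ge> 1" for P Q' N
    using pw_polys_integrable[OF that] g by (intro set_integral_diff(1))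
  have "real a * energy p 0 1 (\<lambda>x. g x - ?P x) = (\<Sum>i<?M. real a * energy p (?l i) (?u i) (\<lambda>x. g x - ?P x))"
    using energy_cells[OF p ai[OF P M] M] by (simp only: sum_distrib_left)
  also have "\<dots> \<le> (\<Sum>i<?M. 2 * (\<Sum>\<nu>\<in>{a<..4*a}. energy p (?l i) (?u i) (\<lambda>x. g x - T \<nu> x)))"
  proof (rule sum_mono)
    fix i assume i: "i \<in> {..<?M}"
    have "energy p (?l i) (?u i) (\<lambda>x. g x - ?P x) = energy p (?l i) (?u i) (\<lambda>x. g x - poly (Q i) x)"
      by (rule energy_cong) (use P i in \<open>auto simp: pw_polys_def\<close>)
    then show "real a * energy p (?l i) (?u i) (\<lambda>x. g x - ?P x) \<le> 2 * (\<Sum>\<nu>\<in>{a<..4*a}. energy p (?l i) (?u i) (\<lambda>x. g x - T \<nu> x))"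
      using Q[of i] i by simp
  qed
  also have "\<dots> = 2 * (\<Sum>\<nu>\<in>{a<..4*a}. \<Sum>i<?M. energy p (?l i) (?u i) (\<lambda>x. g x - T \<nu> x))"
    unfolding sum_distrib_left[symmetric] by (subst sum.swap) simp
  also have "\<dots> = 2 * (\<Sum>\<nu>\<in>{a<..4*a}. energy p 0 1 (\<lambda>x. g x - T \<nu> x))"
    by (intro arg_cong[where f = "(*) 2"] sum.cong refl energy_cells[OF p _ M, symmetric] ai[OF T]) auto
  finally show thesis using that[OF P] by blast
qed


section \<open>The L1 norm of the spline error on cells\<close>

text \<open>
  The sum of the \<open>p\<close>-th powers of the \<open>L\<^sub>1\<close> norms over the cells; it does not decrease when the
  mesh is refined.
\<close>

definition cell_L1 :: "real \<Rightarrow> nat \<Rightarrow> (real \<Rightarrow> real) \<Rightarrow> real" where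
  "cell_L1 p N h = (\<Sum>i<N. (integral {real i / real N..real (Suc i) / real N} (\<lambda>x. \<bar>h x\<bar>)) powr p)"

lemma abs_integrable_cell:
  fixes h :: "real \<Rightarrow> real"
  assumes "h absolutely_integrable_on {0..1}" "{a..b} \<subseteq> {0..1}"
  shows "(\<lambda>x. \<bar>h x\<bar>) integrable_on {a..b}"
  using absolutely_integrable_on_subinterval[OF assms] by (simp add: absolutely_integrable_on_def)

lemma integral_abs_nonneg: "0 \<le> integral A (\<lambda>x. \<bar>h x\<bar> :: real)"
  by (cases "(\<lambda>x. \<bar>h x\<bar>) integrable_on A") (simp_all add: integral_nonneg not_integrable_integral)

lemma cell_L1_triangle:
  assumes p: "0 < p" "p \<le> 1" and h: "h absolutely_integrable_on {0..1}" and k: "k absolutely_integrable_on {0..1}"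
  shows "cell_L1 p N (\<lambda>x. h x + k x) \<le> cell_L1 p N h + cell_L1 p N k"
  unfolding cell_L1_def sum.distrib[symmetric]
proof (rule sum_mono)
  fix i assume "i \<in> {..<N}"
  then have sub: "{real i / real N..real (Suc i) / real N} \<subseteq> {0..1}" (is "?I \<subseteq> _") using cell_subset01 by blast
  note I = abs_integrable_cell[OF h sub] abs_integrable_cell[OF k sub]
  have "integral ?I (\<lambda>x. \<bar>h x + k x\<bar>) \<le> integral ?I (\<lambda>x. \<bar>h x\<bar> + \<bar>k x\<bar>)"
  proof (rule integral_le)
    show "(\<lambda>x. \<bar>h x + k x\<bar>) integrable_on ?I" by (rule abs_integrable_cell[OF set_integral_add(1)[OF h k] sub])
    show "(\<lambda>x. \<bar>h x\<bar> + \<bar>k x\<bar>) integrable_on ?I" by (rule Henstock_Kurzweil_Integration.integrable_add[OF I])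
  qed simp
  also have "\<dots> = integral ?I (\<lambda>x. \<bar>h x\<bar>) + integral ?I (\<lambda>x. \<bar>k x\<bar>)"
    by (rule Henstock_Kurzweil_Integration.integral_add[OF I])
  finally have "(integral ?I (\<lambda>x. \<bar>h x + k x\<bar>)) powr p \<le> (integral ?I (\<lambda>x. \<bar>h x\<bar>) + integral ?I (\<lambda>x. \<bar>k x\<bar>)) powr p"
    using p integral_abs_nonneg by (intro powr_mono2) auto
  also have "\<dots> \<le> (integral ?I (\<lambda>x. \<bar>h x\<bar>)) powr p + (integral ?I (\<lambda>x. \<bar>k x\<bar>)) powr p"
    using powr_add_le[OF p, of "integral ?I (\<lambda>x. \<bar>h x\<bar>)" "integral ?I (\<lambda>x. \<bar>k x\<bar>)"]
      integral_abs_nonneg[of ?I h] integral_abs_nonneg[of ?I k]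
    by (simp only: abs_of_nonneg add_nonneg_nonneg)
  finally show "(integral ?I (\<lambda>x. \<bar>h x + k x\<bar>)) powr p \<le> (integral ?I (\<lambda>x. \<bar>h x\<bar>)) powr p + (integral ?I (\<lambda>x. \<bar>k x\<bar>)) powr p" .
qed

lemma cell_L1_refine:
  assumes p: "0 < p" "p \<le> 1" and h: "h absolutely_integrable_on {0..1}" and N: "N \<ge> 1" and L: "L \<ge> 1"
  shows "cell_L1 p N h \<le> cell_L1 p (N * L) h"
proof -
  let ?M = "N * L"
  define f where "f \<kappa> = integral {real \<kappa> / real ?M..real (Suc \<kappa>) / real ?M} (\<lambda>x. \<bar>h x\<bar>)" for \<kappa>
  have f0: "f \<kappa> \<ge> 0" for \<kappa> unfolding f_def by (rule integral_abs_nonneg)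
  have scale: "real (i * L) / real ?M = real i / real N" for i using L by simp
  have "integral {real i / real N..real (Suc i) / real N} (\<lambda>x. \<bar>h x\<bar>) = (\<Sum>\<kappa>\<in>{i*L..<i*L+L}. f \<kappa>)" if i: "i < N" for i
  proof -
    have "integral {real i / real N..real (i * L + j) / real ?M} (\<lambda>x. \<bar>h x\<bar>) = (\<Sum>\<kappa>\<in>{i*L..<i*L+j}. f \<kappa>)" if "j \<le> L" for j
      using that
    proof (induction j)
      case 0
      then show ?case using scale[of i] by simp
    next
      case (Suc j)
      have le: "i * L + Suc j \<le> ?M"
      proof -
        have "i * L + Suc j \<le> Suc i * L" using Suc.prems by simp
        also have "\<dots> \<le> N * L" using i by (intro mult_le_mono1) simp
        finally show ?thesis .
      qed
      have "{real i / real N..real (i * L + Suc j) / real ?M} \<subseteq> {0..1}"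
      proof -
        have "real (i * L + Suc j) / real ?M \<le> real ?M / real ?M" using le by (intro divide_right_mono) (auto simp only: of_nat_le_iff of_nat_0_le_iff)
        also have "\<dots> = 1" using N L by simp
        finally show ?thesis by auto
      qed
      note I = abs_integrable_cell[OF h this]
      have o: "real i / real N \<le> real (i * L + j) / real ?M" "real (i * L + j) / real ?M \<le> real (i * L + Suc j) / real ?M"
        unfolding scale[of i, symmetric] by (intro divide_right_mono; simp)+
      have "integral {real i / real N..real (i * L + Suc j) / real ?M} (\<lambda>x. \<bar>h x\<bar>)
         = integral {real i / real N..real (i * L + j) / real ?M} (\<lambda>x. \<bar>h x\<bar>) + f (i * L + j)"
        unfolding f_def using Henstock_Kurzweil_Integration.integral_combine[OF o I] by simp
      then show ?case using Suc by simp
    qed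
    from this[of L] scale[of "Suc i"] show ?thesis by (simp add: add.commute)
  qed
  then have "cell_L1 p N h = (\<Sum>i<N. (\<Sum>\<kappa>\<in>{i*L..<i*L+L}. f \<kappa>) powr p)"
    unfolding cell_L1_def by (intro sum.cong) auto
  also have "\<dots> \<le> (\<Sum>i<N. \<Sum>\<kappa>\<in>{i*L..<i*L+L}. f \<kappa> powr p)"
  proof (rule sum_mono)
    fix i
    show "(\<Sum>\<kappa>\<in>{i*L..<i*L+L}. f \<kappa>) powr p \<le> (\<Sum>\<kappa>\<in>{i*L..<i*L+L}. f \<kappa> powr p)"
      using powr_sum_le[OF p, of "{i*L..<i*L+L}" f] f0 by (simp add: abs_of_nonneg sum_nonneg)
  qed
  also have "\<dots> = (\<Sum>\<kappa><N*L. f \<kappa> powr p)" by (rule sum.nat_group)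
  finally show ?thesis by (simp add: cell_L1_def f_def)
qed

lemma cell_L1_piecewise_poly:
  assumes p: "0 < p" "p \<le> 1"
  obtains C where "C > 0" "\<And>M D Q. M \<ge> 1 \<Longrightarrow> pw_polys k M D Q \<Longrightarrow>
    cell_L1 p M D \<le> C * real M powr (1 - p) * energy p 0 1 D"
proof -
  obtain C where C: "C > 0" "\<And>(q::real poly) a h. degree q \<le> k \<Longrightarrow> h > 0 \<Longrightarrow>
     (integral {a..a+h} (\<lambda>x. \<bar>poly q x\<bar>)) powr p \<le> C * h powr (p - 1) * energy p a (a + h) (poly q)"
    using poly_nikolskii[OF p, of k] by blast
  show thesis
  proof (rule that[OF C(1)])
    fix M :: nat and D Q assume M: "M \<ge> 1" and D: "pw_polys k M D Q"
    have "cell_L1 p M D \<le> (\<Sum>i<M. C * real M powr (1 - p) * energy p (real i / real M) (real (Suc i) / real M) D)"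
      unfolding cell_L1_def
    proof (rule sum_mono)
      fix i assume i: "i \<in> {..<M}"
      let ?a = "real i / real M" and ?b = "real (Suc i) / real M"
      have b: "?b = ?a + 1 / real M" by (simp add: add_divide_distrib)
      have eq: "D x = poly (Q i) x" if "x \<in> {?a<..<?b}" for x using D i that by (auto simp: pw_polys_def)
      have "degree (Q i) \<le> k" using D i by (auto simp: pw_polys_def)
      from C(2)[OF this, of "1 / real M" ?a]
      have "(integral {?a..?b} (\<lambda>x. \<bar>poly (Q i) x\<bar>)) powr p \<le> C * (1 / real M) powr (p - 1) * energy p ?a ?b (poly (Q i))"
        using M unfolding b by simp
      also have "integral {?a..?b} (\<lambda>x. \<bar>poly (Q i) x\<bar>) = integral {?a..?b} (\<lambda>x. \<bar>D x\<bar>)"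
        by (rule integral_spike[where S = "{?a, ?b}"]) (use eq in auto)
      also have "energy p ?a ?b (poly (Q i)) = energy p ?a ?b D" by (rule energy_cong) (use eq in auto)
      also have "(1 / real M) powr (p - 1) = real M powr (1 - p)"
      proof -
        have "real M powr (1 - p) = real M powr (- (p - 1))" by simp
        also have "\<dots> = inverse (real M powr (p - 1))" by (rule powr_minus)
        finally show ?thesis using M by (simp add: powr_divide divide_inverse inverse_powr)
      qed
      finally show "(integral {?a..?b} (\<lambda>x. \<bar>D x\<bar>)) powr p \<le> C * real M powr (1 - p) * energy p ?a ?b D" .
    qed
    also have "\<dots> = C * real M powr (1 - p) * energy p 0 1 D"
      using energy_cells[OF p pw_polys_integrable[OF D M] M] by (simp only: sum_distrib_left)
    finally show "cell_L1 p M D \<le> C * real M powr (1 - p) * energy p 0 1 D" .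
  qed
qed

lemma pw_polys_refine:
  assumes T: "pw_polys k N T q" and N: "N \<ge> 1" and L: "L \<ge> 1"
  shows "pw_polys k (N * L) T (\<lambda>i. q (i div L))"
  unfolding pw_polys_def
proof (intro allI impI conjI ballI)
  fix i x assume i: "i < N * L"
  define j where "j = i div L"
  have j: "j < N" using i L by (simp add: j_def less_mult_imp_div_less)
  then show "degree (q (i div L)) < k" using T by (simp add: pw_polys_def j_def)
  assume x: "x \<in> {real i / real (N * L)<..<real (Suc i) / real (N * L)}"
  have "j * L \<le> i" "Suc i \<le> Suc j * L" using L by (simp_all add: j_def dividend_less_times_div mult.commute Suc_leI)
  then have "real (j * L) \<le> real i" "real (Suc i) \<le> real (Suc j * L)" by (simp_all only: of_nat_le_iff)
  then have "real (j * L) / real (N * L) \<le> real i / real (N * L)" "real (Suc i) / real (N * L) \<le> real (Suc j * L) / real (N * L)"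
    by (intro divide_right_mono; simp)+
  moreover have "real (j * L) / real (N * L) = real j / real N" "real (Suc j * L) / real (N * L) = real (Suc j) / real N"
    using L unfolding of_nat_mult by (simp_all del: of_nat_Suc)
  ultimately have "x \<in> {real j / real N<..<real (Suc j) / real N}" using x unfolding greaterThanLessThan_iff by linarith
  then show "T x = poly (q (i div L)) x" using T j by (simp add: pw_polys_def j_def)
qed

lemma pw_polys_diff:
  assumes "pw_polys k N T q" "pw_polys k N T' q'"
  shows "pw_polys k N (\<lambda>x. T x - T' x) (\<lambda>i. q i - q' i)"
  using assms unfolding pw_polys_def by (auto intro: degree_diff_less)

text \<open>
  The approximations converge in \<open>L\<^sub>p\<close> only, which does not give convergence of the \<open>L\<^sub>1\<close> norms. For the truncation
  at height \<open>K\<close> it does, because \<open>min t K \<le> K\<^sup>1\<^sup>-\<^sup>p t\<^sup>p\<close>; finally \<open>K\<close> tends to infinity.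
\<close>

lemma cell_L1_limit:
  assumes p: "0 < p" "p < 1" and G: "G absolutely_integrable_on {0..1}" and N: "N \<ge> 1"
    and D: "\<And>J. D J absolutely_integrable_on {0..1}" and B: "\<And>J. cell_L1 p N (D J) \<le> B"
    and lim: "(\<lambda>J. energy p 0 1 (\<lambda>x. G x - D J x)) \<longlonglongrightarrow> 0"
  shows "cell_L1 p N G \<le> B"
proof -
  have p': "p \<le> 1" using p by simp
  let ?I = "\<lambda>i. {real i / real N..real (Suc i) / real N}"
  have trunc: "(\<Sum>i<N. (integral (?I i) (\<lambda>x. min \<bar>G x\<bar> K)) powr p) \<le> B" if K: "K > 0" for K
  proof -
    define E where "E J = energy p 0 1 (\<lambda>x. G x - D J x)" for J
    have GD: "(\<lambda>x. G x - D J x) absolutely_integrable_on {0..1}" for J by (rule set_integral_diff(1)[OF G D])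
    have bound: "(\<Sum>i<N. (integral (?I i) (\<lambda>x. min \<bar>G x\<bar> K)) powr p) \<le> B + real N * (K powr (1 - p) * E J) powr p" for J
    proof -
      have "(integral (?I i) (\<lambda>x. min \<bar>G x\<bar> K)) powr p \<le> (integral (?I i) (\<lambda>x. \<bar>D J x\<bar>)) powr p + (K powr (1 - p) * E J) powr p"
        if i: "i < N" for i
      proof -
        have sub: "?I i \<subseteq> {0..1}" by (rule cell_subset01[OF i])
        have mi: "(\<lambda>x. min \<bar>G x\<bar> K) integrable_on ?I i"
        proof (rule measurable_bounded_by_integrable_imp_integrable)
          have "G \<in> borel_measurable (lebesgue_on (?I i))"
            using absolutely_integrable_on_subinterval[OF G sub] absolutely_integrable_measurable[of "?I i" G] by simp
          then show "(\<lambda>x. min \<bar>G x\<bar> K) \<in> borel_measurable (lebesgue_on (?I i))" by measurable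
          show "(\<lambda>x. \<bar>G x\<bar>) integrable_on ?I i" by (rule abs_integrable_cell[OF G sub])
        qed (use K in auto)
        note Di = abs_integrable_cell[OF D sub, of J]
        have Pi: "(\<lambda>x. \<bar>G x - D J x\<bar> powr p) integrable_on ?I i"
          by (rule powr_integrable[OF p(1) p' absolutely_integrable_on_subinterval[OF GD sub]])
        have KPi: "(\<lambda>x. K powr (1 - p) * \<bar>G x - D J x\<bar> powr p) integrable_on ?I i"
          using integrable_cmul[OF Pi, of "K powr (1 - p)"] by simp
        have "integral (?I i) (\<lambda>x. min \<bar>G x\<bar> K) \<le> integral (?I i) (\<lambda>x. \<bar>D J x\<bar> + K powr (1 - p) * \<bar>G x - D J x\<bar> powr p)"
        proof (rule integral_le[OF mi Henstock_Kurzweil_Integration.integrable_add[OF Di KPi]])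
          fix x
          have "min \<bar>G x - D J x\<bar> K \<le> K powr (1 - p) * \<bar>G x - D J x\<bar> powr p"
          proof (cases "\<bar>G x - D J x\<bar> \<le> K")
            case True
            have "\<bar>G x - D J x\<bar> = \<bar>G x - D J x\<bar> powr (1 - p) * \<bar>G x - D J x\<bar> powr p"
              by (simp add: powr_add[symmetric])
            also have "\<dots> \<le> K powr (1 - p) * \<bar>G x - D J x\<bar> powr p"
              using True p by (intro mult_right_mono powr_mono2) auto
            finally show ?thesis by simp
          next
            case False
            have "K = K powr (1 - p) * K powr p" using K by (simp add: powr_add[symmetric])
            also have "\<dots> \<le> K powr (1 - p) * \<bar>G x - D J x\<bar> powr p"
              using False p K by (intro mult_left_mono powr_mono2) auto
            finally show ?thesis by simp
          qed
          then show "min \<bar>G x\<bar> K \<le> \<bar>D J x\<bar> + K powr (1 - p) * \<bar>G x - D J x\<bar> powr p" using K by linarith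
        qed
        also have "\<dots> = integral (?I i) (\<lambda>x. \<bar>D J x\<bar>) + K powr (1 - p) * energy p (real i / real N) (real (Suc i) / real N) (\<lambda>x. G x - D J x)"
          unfolding energy_def using Henstock_Kurzweil_Integration.integral_add[OF Di KPi] by simp
        also have "\<dots> \<le> integral (?I i) (\<lambda>x. \<bar>D J x\<bar>) + K powr (1 - p) * E J"
          unfolding E_def by (intro add_left_mono mult_left_mono energy_sub[OF p(1) p' GD sub]) auto
        finally have le: "integral (?I i) (\<lambda>x. min \<bar>G x\<bar> K) \<le> integral (?I i) (\<lambda>x. \<bar>D J x\<bar>) + K powr (1 - p) * E J" .
        have nn: "0 \<le> integral (?I i) (\<lambda>x. min \<bar>G x\<bar> K)" "0 \<le> integral (?I i) (\<lambda>x. \<bar>D J x\<bar>)" "0 \<le> K powr (1 - p) * E J"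
          using integral_nonneg[OF mi] K integral_abs_nonneg by (auto simp: E_def energy_nonneg)
        have "(integral (?I i) (\<lambda>x. min \<bar>G x\<bar> K)) powr p \<le> (integral (?I i) (\<lambda>x. \<bar>D J x\<bar>) + K powr (1 - p) * E J) powr p"
          using le nn p by (intro powr_mono2) auto
        also have "\<dots> \<le> (integral (?I i) (\<lambda>x. \<bar>D J x\<bar>)) powr p + (K powr (1 - p) * E J) powr p"
          using powr_add_le[OF p(1) p', of "integral (?I i) (\<lambda>x. \<bar>D J x\<bar>)" "K powr (1 - p) * E J"] nn by simp
        finally show ?thesis .
      qed
      then have "(\<Sum>i<N. (integral (?I i) (\<lambda>x. min \<bar>G x\<bar> K)) powr p) \<le> (\<Sum>i<N. (integral (?I i) (\<lambda>x. \<bar>D J x\<bar>)) powr p + (K powr (1 - p) * E J) powr p)"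
        by (intro sum_mono) auto
      also have "\<dots> = cell_L1 p N (D J) + real N * (K powr (1 - p) * E J) powr p"
        by (simp add: sum.distrib cell_L1_def)
      finally show ?thesis using B[of J] by simp
    qed
    have "(\<lambda>J. B + real N * (K powr (1 - p) * E J) powr p) \<longlonglongrightarrow> B + real N * (K powr (1 - p) * 0) powr p"
      using p by (intro tendsto_intros tendsto_powr' lim[folded E_def]) (auto simp: E_def energy_nonneg)
    then have "(\<lambda>J. B + real N * (K powr (1 - p) * E J) powr p) \<longlonglongrightarrow> B" using p by simp
    then show ?thesis by (rule LIMSEQ_le_const) (use bound in auto)
  qed
  have "(\<lambda>K. \<Sum>i<N. (integral (?I i) (\<lambda>x. min \<bar>G x\<bar> (real (Suc K)))) powr p) \<longlonglongrightarrow> (\<Sum>i<N. (integral (?I i) (\<lambda>x. \<bar>G x\<bar>)) powr p)"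
  proof (rule tendsto_sum)
    fix i assume "i \<in> {..<N}"
    then have sub: "?I i \<subseteq> {0..1}" using cell_subset01 by blast
    have Gm: "G \<in> borel_measurable (lebesgue_on (?I i))"
      using absolutely_integrable_on_subinterval[OF G sub] absolutely_integrable_measurable[of "?I i" G] by simp
    note Gi = abs_integrable_cell[OF G sub]
    have mi: "(\<lambda>x. min \<bar>G x\<bar> (real (Suc K))) integrable_on ?I i" for K
    proof (rule measurable_bounded_by_integrable_imp_integrable[OF _ Gi])
      show "(\<lambda>x. min \<bar>G x\<bar> (real (Suc K))) \<in> borel_measurable (lebesgue_on (?I i))" using Gm by measurable
    qed auto
    have "(\<lambda>K. integral (?I i) (\<lambda>x. min \<bar>G x\<bar> (real (Suc K)))) \<longlonglongrightarrow> integral (?I i) (\<lambda>x. \<bar>G x\<bar>)"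
    proof (rule dominated_convergence(2)[OF mi Gi])
      fix x
      obtain K0 where K0: "\<bar>G x\<bar> < real K0" using reals_Archimedean2 by blast
      have "eventually (\<lambda>K. min \<bar>G x\<bar> (real (Suc K)) = \<bar>G x\<bar>) sequentially"
        using eventually_ge_at_top[of K0] by eventually_elim (use K0 in auto)
      then show "(\<lambda>K. min \<bar>G x\<bar> (real (Suc K))) \<longlonglongrightarrow> \<bar>G x\<bar>" by (rule tendsto_eventually)
    qed auto
    then show "(\<lambda>K. (integral (?I i) (\<lambda>x. min \<bar>G x\<bar> (real (Suc K)))) powr p) \<longlonglongrightarrow> (integral (?I i) (\<lambda>x. \<bar>G x\<bar>)) powr p"
    proof (rule tendsto_powr')
      show "(\<lambda>K::nat. p) \<longlonglongrightarrow> p" by simp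
      show "integral (?I i) (\<lambda>x. \<bar>G x\<bar>) \<noteq> 0 \<or> 0 < p \<and> (\<forall>\<^sub>F K in sequentially. 0 \<le> integral (?I i) (\<lambda>x. min \<bar>G x\<bar> (real (Suc K))))"
        using p integral_nonneg[OF mi] by simp
    qed
  qed
  then have "(\<lambda>K. \<Sum>i<N. (integral (?I i) (\<lambda>x. min \<bar>G x\<bar> (real (Suc K)))) powr p) \<longlonglongrightarrow> cell_L1 p N G"
    by (simp add: cell_L1_def)
  then show ?thesis by (rule LIMSEQ_le_const2) (use trunc in auto)
qed


lemma sum_dyadic_windows:
  fixes f :: "nat \<Rightarrow> real"
  shows "(\<Sum>j<J. \<Sum>\<nu>\<in>{n * 4 ^ j<..4 * (n * 4 ^ j)}. f \<nu>) = (\<Sum>\<nu>\<in>{n<..n * 4 ^ J}. f \<nu>)"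
proof (induction J)
  case (Suc J)
  have "{n<..n * 4 ^ Suc J} = {n<..n * 4 ^ J} \<union> {n * 4 ^ J<..4 * (n * 4 ^ J)}"
  proof -
    have "{n<..4 * A} = {n<..A} \<union> {A<..4 * A}" if "n \<le> A" for A using that by auto
    from this[of "n * 4 ^ J"] show ?thesis by (simp add: mult_ac)
  qed
  then show ?case using Suc by (simp add: sum.union_disjoint ivl_disj_int)
qed simp

text \<open>
  With \<open>a\<^sub>j = n 4\<^sup>j\<close> let \<open>P\<^sub>j\<close> be the piecewise polynomial on the mesh \<open>1/(16 a\<^sub>j)\<close> obtained by mixing, and
  \<open>E\<^sub>j\<close> its energy error. The telescoping sum of \<open>P\<^sub>0 - T\<close> and \<open>P\<^sub>j\<^sub>+\<^sub>1 - P\<^sub>j\<close> is estimated term by term by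
  the inequality of Nikolskii. The weights \<open>w\<^sub>j = a\<^sub>j\<^sup>1\<^sup>-\<^sup>p E\<^sub>j\<close> that arise are at most the parts of the series
  over the disjoint windows.
\<close>

theorem cell_L1_spline_error:
  assumes p: "0 < p" "p < 1"
  obtains C where "C > 0"
    "\<And>g n T q Z. n \<ge> 1 \<Longrightarrow> g absolutely_integrable_on {0..1} \<Longrightarrow>
      (\<And>\<nu>. \<nu> \<ge> n \<Longrightarrow> pw_polys k \<nu> (T \<nu>) (q \<nu>)) \<Longrightarrow>
      (\<And>N. (\<Sum>\<nu>\<in>{n<..N}. real \<nu> powr (- p) * energy p 0 1 (\<lambda>x. g x - T \<nu> x)) \<le> Z) \<Longrightarrow>
      cell_L1 p n (\<lambda>x. g x - T n x) \<le> C * (real n powr (1 - p) * energy p 0 1 (\<lambda>x. g x - T n x) + Z)"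
proof -
  have p': "p \<le> 1" using p by simp
  obtain C where C: "C > 0" "\<And>M D Q. M \<ge> 1 \<Longrightarrow> pw_polys k M D Q \<Longrightarrow>
    cell_L1 p M D \<le> C * real M powr (1 - p) * energy p 0 1 D"
    using cell_L1_piecewise_poly[OF p(1) p'] by blast
  \<comment> \<open>The value 2000 absorbs the numerical factors collected in \<open>B\<close> below.\<close>
  show thesis
  proof (rule that[of "C * 2000"])
    show "C * 2000 > 0" using C(1) by simp
    fix g n T q Z
    assume n: "n \<ge> (1::nat)" and g: "g absolutely_integrable_on {0..1}"
      and T: "\<And>\<nu>. \<nu> \<ge> n \<Longrightarrow> pw_polys k \<nu> (T \<nu>) (q \<nu>)"
      and Z: "\<And>N. (\<Sum>\<nu>\<in>{n<..N}. real \<nu> powr (- p) * energy p 0 1 (\<lambda>x. g x - T \<nu> x)) \<le> Z"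
    define e where "e \<nu> = energy p 0 1 (\<lambda>x. g x - T \<nu> x)" for \<nu>
    have e0: "e \<nu> \<ge> 0" for \<nu> unfolding e_def by (rule energy_nonneg)
    define a where "a j = n * 4 ^ j" for j :: nat
    have a1: "a j \<ge> 1" for j using n by (simp add: a_def)
    have an: "a j \<ge> n" for j by (simp add: a_def)
    have "\<exists>P Q. pw_polys k (16 * a j) P Q \<and> real (a j) * energy p 0 1 (\<lambda>x. g x - P x) \<le> 2 * (\<Sum>\<nu>\<in>{a j<..4 * a j}. e \<nu>)" for j
    proof -
      obtain P Q where "pw_polys k (16 * a j) P Q"
        "real (a j) * energy p 0 1 (\<lambda>x. g x - P x) \<le> 2 * (\<Sum>\<nu>\<in>{a j<..4 * a j}. energy p 0 1 (\<lambda>x. g x - T \<nu> x))"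
      proof (rule spline_mixing[OF p(1) p' a1 g])
        show "pw_polys k \<nu> (T \<nu>) (q \<nu>)" if "\<nu> \<in> {a j<..4 * a j}" for \<nu> using that an[of j] by (intro T) auto
      qed
      then show ?thesis unfolding e_def by blast
    qed
    then obtain P Q where PQ: "\<And>j. pw_polys k (16 * a j) (P j) (Q j)"
      "\<And>j. real (a j) * energy p 0 1 (\<lambda>x. g x - P j x) \<le> 2 * (\<Sum>\<nu>\<in>{a j<..4 * a j}. e \<nu>)" by metis
    define E where "E j = energy p 0 1 (\<lambda>x. g x - P j x)" for j
    have E0: "E j \<ge> 0" for j unfolding E_def by (rule energy_nonneg)
    define w where "w j = real (a j) powr (1 - p) * E j" for j
    have w0: "w j \<ge> 0" for j unfolding w_def using E0 by simp
    have wle: "w j \<le> 8 * (\<Sum>\<nu>\<in>{a j<..4 * a j}. real \<nu> powr (- p) * e \<nu>)" for j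
    proof -
      have apos: "real (a j) > 0" using a1[of j] by simp
      have "w j = real (a j) powr (- p) * (real (a j) * E j)"
        using apos by (simp add: w_def powr_diff powr_minus divide_inverse)
      also have "\<dots> \<le> real (a j) powr (- p) * (2 * (\<Sum>\<nu>\<in>{a j<..4 * a j}. e \<nu>))"
        using PQ(2)[of j] unfolding E_def by (intro mult_left_mono) auto
      also have "\<dots> = (\<Sum>\<nu>\<in>{a j<..4 * a j}. 2 * real (a j) powr (- p) * e \<nu>)" by (simp add: sum_distrib_left mult_ac)
      also have "\<dots> \<le> (\<Sum>\<nu>\<in>{a j<..4 * a j}. 8 * (real \<nu> powr (- p) * e \<nu>))"
      proof (rule sum_mono)
        fix \<nu> assume \<nu>: "\<nu> \<in> {a j<..4 * a j}"
        have "(4 * real (a j)) powr (- p) \<le> real \<nu> powr (- p)"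
          using \<nu> p apos by (intro powr_mono2') auto
        then have "4 powr (- p) * real (a j) powr (- p) \<le> real \<nu> powr (- p)" using apos by (simp add: powr_mult)
        moreover have "(1 / 4) * real (a j) powr (- p) \<le> 4 powr (- p) * real (a j) powr (- p)"
        proof (rule mult_right_mono)
          have "4 powr (- 1) \<le> (4::real) powr (- p)" using p by (intro powr_mono) auto
          then show "1 / 4 \<le> (4::real) powr (- p)" by (simp add: powr_minus)
        qed simp
        ultimately have "2 * real (a j) powr (- p) \<le> 8 * real \<nu> powr (- p)" by linarith
        then have "2 * real (a j) powr (- p) * e \<nu> \<le> 8 * real \<nu> powr (- p) * e \<nu>" by (rule mult_right_mono[OF _ e0])
        then show "2 * real (a j) powr (- p) * e \<nu> \<le> 8 * (real \<nu> powr (- p) * e \<nu>)" by (simp only: mult.assoc)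
      qed
      also have "\<dots> = 8 * (\<Sum>\<nu>\<in>{a j<..4 * a j}. real \<nu> powr (- p) * e \<nu>)" by (simp only: sum_distrib_left)
      finally show ?thesis .
    qed
    have wsum: "(\<Sum>j<J. w j) \<le> 8 * Z" for J
    proof -
      have "(\<Sum>j<J. w j) \<le> (\<Sum>j<J. 8 * (\<Sum>\<nu>\<in>{a j<..4 * a j}. real \<nu> powr (- p) * e \<nu>))"
        by (intro sum_mono wle)
      also have "\<dots> = 8 * (\<Sum>\<nu>\<in>{n<..n * 4 ^ J}. real \<nu> powr (- p) * e \<nu>)"
        unfolding sum_distrib_left[symmetric] a_def by (simp only: sum_dyadic_windows)
      also have "\<dots> \<le> 8 * Z" using Z[of "n * 4 ^ J"] unfolding e_def by simp
      finally show ?thesis .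
    qed
    have Z0: "Z \<ge> 0" using wsum[of 0] by simp
    have M1: "16 * a j \<ge> 1" for j using a1[of j] by simp
    have Pi: "P j absolutely_integrable_on {0..1}" for j by (rule pw_polys_integrable[OF PQ(1) M1])
    have Ti: "T n absolutely_integrable_on {0..1}" by (rule pw_polys_integrable[OF T n]) simp
    have gP: "(\<lambda>x. g x - P j x) absolutely_integrable_on {0..1}" for j by (rule set_integral_diff(1)[OF g Pi])
    have gT: "(\<lambda>x. g x - T n x) absolutely_integrable_on {0..1}" by (rule set_integral_diff(1)[OF g Ti])
    have neg: "energy p 0 1 (\<lambda>x. - h x) = energy p 0 1 h" for h by (simp add: energy_def)
    have step: "cell_L1 p n (\<lambda>x. P (Suc j) x - P j x) \<le> C * (64 * (w j + w (Suc j)))" for j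
    proof -
      have aS: "16 * a (Suc j) = (16 * a j) * 4" by (simp add: a_def)
      have cp: "pw_polys k (16 * a (Suc j)) (\<lambda>x. P (Suc j) x - P j x) (\<lambda>i. Q (Suc j) i - Q j (i div 4))"
        by (rule pw_polys_diff[OF PQ(1)]) (unfold aS, rule pw_polys_refine[OF PQ(1) M1], simp)
      have di: "(\<lambda>x. P (Suc j) x - P j x) absolutely_integrable_on {0..1}" by (rule set_integral_diff(1)[OF Pi Pi])
      have an: "16 * a (Suc j) = n * (16 * 4 ^ Suc j)" by (simp add: a_def)
      have "cell_L1 p n (\<lambda>x. P (Suc j) x - P j x) \<le> cell_L1 p (n * (16 * 4 ^ Suc j)) (\<lambda>x. P (Suc j) x - P j x)"
        by (rule cell_L1_refine[OF p(1) p' di n]) simp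
      also have "\<dots> \<le> C * real (16 * a (Suc j)) powr (1 - p) * energy p 0 1 (\<lambda>x. P (Suc j) x - P j x)"
        unfolding an[symmetric] by (rule C(2)[OF M1 cp])
      also have "energy p 0 1 (\<lambda>x. P (Suc j) x - P j x) \<le> E j + E (Suc j)"
      proof -
        have "energy p 0 1 (\<lambda>x. (g x - P j x) + - (g x - P (Suc j) x)) \<le> E j + energy p 0 1 (\<lambda>x. - (g x - P (Suc j) x))"
          unfolding E_def by (rule energy_triangle[OF p(1) p' gP]) (use set_integral_diff(1)[OF Pi g] in simp)
        then show ?thesis unfolding neg E_def by simp
      qed
      also have "C * real (16 * a (Suc j)) powr (1 - p) * (E j + E (Suc j)) \<le> C * (64 * (w j + w (Suc j)))"
      proof -
        have b: "x powr (1 - p) \<le> x" if "x \<ge> 1" for x :: real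
        proof -
          have "x powr (1 - p) \<le> x powr 1" using that p by (intro powr_mono) auto
          then show ?thesis using that by simp
        qed
        have "real (16 * a (Suc j)) powr (1 - p) = 64 powr (1 - p) * real (a j) powr (1 - p)"
          using a1[of j] by (simp add: a_def powr_mult[symmetric])
        then have 1: "real (16 * a (Suc j)) powr (1 - p) \<le> 64 * real (a j) powr (1 - p)"
          using b[of 64] by (simp add: mult_right_mono)
        have "real (16 * a (Suc j)) powr (1 - p) = 16 powr (1 - p) * real (a (Suc j)) powr (1 - p)"
          using a1[of "Suc j"] by (simp add: powr_mult[symmetric])
        also have "\<dots> \<le> 64 * real (a (Suc j)) powr (1 - p)"
          using b[of 16] by (intro mult_right_mono) auto
        finally have 2: "real (16 * a (Suc j)) powr (1 - p) \<le> 64 * real (a (Suc j)) powr (1 - p)" .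
        have "real (16 * a (Suc j)) powr (1 - p) * E j + real (16 * a (Suc j)) powr (1 - p) * E (Suc j)
            \<le> 64 * real (a j) powr (1 - p) * E j + 64 * real (a (Suc j)) powr (1 - p) * E (Suc j)"
          by (intro add_mono mult_right_mono 1 2 E0)
        then have "real (16 * a (Suc j)) powr (1 - p) * (E j + E (Suc j)) \<le> 64 * (w j + w (Suc j))"
          by (simp only: w_def distrib_left mult.assoc)
        then show ?thesis using C(1) by (simp add: mult.assoc)
      qed
      finally show ?thesis using C(1) by (simp add: mult_left_mono)
    qed
    have base: "cell_L1 p n (\<lambda>x. P 0 x - T n x) \<le> C * (16 * (real n powr (1 - p) * e n + w 0))"
    proof -
      have an: "16 * a 0 = n * 16" by (simp add: a_def)
      have cp: "pw_polys k (16 * a 0) (\<lambda>x. P 0 x - T n x) (\<lambda>i. Q 0 i - q n (i div 16))"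
        by (rule pw_polys_diff[OF PQ(1)]) (unfold an, rule pw_polys_refine[OF T n], simp_all)
      have di: "(\<lambda>x. P 0 x - T n x) absolutely_integrable_on {0..1}" by (rule set_integral_diff(1)[OF Pi Ti])
      have "cell_L1 p n (\<lambda>x. P 0 x - T n x) \<le> cell_L1 p (n * 16) (\<lambda>x. P 0 x - T n x)"
        by (rule cell_L1_refine[OF p(1) p' di n]) simp
      also have "\<dots> \<le> C * real (16 * a 0) powr (1 - p) * energy p 0 1 (\<lambda>x. P 0 x - T n x)"
        unfolding an[symmetric] by (rule C(2)[OF M1 cp])
      also have "\<dots> \<le> C * (16 * real n powr (1 - p)) * (e n + E 0)"
      proof (intro mult_mono mult_left_mono)
        have "(16::real) powr (1 - p) \<le> 16 powr 1" using p by (intro powr_mono) auto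
        then show "real (16 * a 0) powr (1 - p) \<le> 16 * real n powr (1 - p)"
          by (simp add: a_def powr_mult mult_right_mono)
        have "energy p 0 1 (\<lambda>x. (g x - T n x) + - (g x - P 0 x)) \<le> e n + energy p 0 1 (\<lambda>x. - (g x - P 0 x))"
          unfolding e_def by (rule energy_triangle[OF p(1) p' gT]) (use set_integral_diff(1)[OF Pi g] in simp)
        then show "energy p 0 1 (\<lambda>x. P 0 x - T n x) \<le> e n + E 0" unfolding neg E_def by simp
      qed (use C(1) energy_nonneg in auto)
      also have "\<dots> = C * (16 * (real n powr (1 - p) * e n + w 0))" by (simp add: w_def a_def algebra_simps)
      finally show ?thesis .
    qed
    \<comment> \<open>Each \<open>w j\<close> occurs in at most two of the differences, with factor 64.\<close>
    define B where "B = C * (16 * (real n powr (1 - p) * e n + 8 * Z)) + C * (128 * (8 * Z))"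
    have PT: "cell_L1 p n (\<lambda>x. P J x - T n x) \<le> B" for J
    proof -
      have "cell_L1 p n (\<lambda>x. P J x - T n x) \<le> C * (16 * (real n powr (1 - p) * e n + w 0)) + (\<Sum>j<J. C * (64 * (w j + w (Suc j))))"
      proof (induction J)
        case 0
        show ?case using base by simp
      next
        case (Suc J)
        have "cell_L1 p n (\<lambda>x. (P J x - T n x) + (P (Suc J) x - P J x)) \<le> cell_L1 p n (\<lambda>x. P J x - T n x) + cell_L1 p n (\<lambda>x. P (Suc J) x - P J x)"
          by (rule cell_L1_triangle[OF p(1) p' set_integral_diff(1)[OF Pi Ti] set_integral_diff(1)[OF Pi Pi]])
        then show ?case using Suc step[of J] by simp
      qed
      also have "(\<Sum>j<J. C * (64 * (w j + w (Suc j)))) \<le> C * (128 * (8 * Z))"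
      proof -
        have "(\<Sum>j<J. w (Suc j)) \<le> (\<Sum>j<Suc J. w j)" using w0[of 0] by (subst sum.lessThan_Suc_shift) simp
        then have "(\<Sum>j<J. w j) + (\<Sum>j<J. w (Suc j)) \<le> 2 * (8 * Z)" using wsum[of J] wsum[of "Suc J"] by linarith
        then have "C * (64 * ((\<Sum>j<J. w j) + (\<Sum>j<J. w (Suc j)))) \<le> C * (64 * (2 * (8 * Z)))" using C(1) by simp
        then show ?thesis by (simp add: sum_distrib_left[symmetric] sum.distrib)
      qed
      also have "C * (16 * (real n powr (1 - p) * e n + w 0)) \<le> C * (16 * (real n powr (1 - p) * e n + 8 * Z))"
        using wsum[of 1] C(1) by simp
      finally show ?thesis unfolding B_def by simp
    qed
    have "cell_L1 p n (\<lambda>x. g x - T n x) \<le> B"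
    proof (rule cell_L1_limit[OF p gT n set_integral_diff(1)[OF Pi Ti] PT])
      \<comment> \<open>Since \<open>p < 1\<close>, boundedness of \<open>w j\<close> makes the energy error tend to 0.\<close>
      have Ew: "E j \<le> real (a j) powr (p - 1) * (8 * Z)" for j
      proof -
        have apos: "real (a j) > 0" using a1[of j] by simp
        have "w j \<le> (\<Sum>i<Suc j. w i)" using w0 by (simp add: sum_nonneg)
        then have "w j \<le> 8 * Z" using wsum[of "Suc j"] by linarith
        then have "real (a j) powr (p - 1) * w j \<le> real (a j) powr (p - 1) * (8 * Z)" by (rule mult_left_mono) simp
        moreover have "real (a j) powr (p - 1) * w j = E j"
          unfolding w_def mult.assoc[symmetric] powr_add[symmetric] using apos by simp
        ultimately show ?thesis by simp
      qed
      have "filterlim (\<lambda>j. real (a j)) at_top sequentially"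
      proof (rule filterlim_at_top_mono[OF filterlim_real_sequentially])
        have "j \<le> 4 ^ j" for j :: nat by (intro less_imp_le power_gt_expt) simp
        moreover have "1 * 4 ^ j \<le> a j" for j unfolding a_def using n by (intro mult_le_mono1)
        ultimately have "j \<le> a j" for j using order_trans[of j "4 ^ j" "a j"] by simp
        then show "\<forall>\<^sub>F j in sequentially. real j \<le> real (a j)" by simp
      qed
      then have "(\<lambda>j. real (a j) powr (p - 1)) \<longlonglongrightarrow> 0" by (rule tendsto_neg_powr[rotated]) (use p in simp)
      then have "(\<lambda>j. real (a j) powr (p - 1) * (8 * Z)) \<longlonglongrightarrow> 0 * (8 * Z)" by (intro tendsto_intros)
      then have "(\<lambda>j. real (a j) powr (p - 1) * (8 * Z)) \<longlonglongrightarrow> 0" by simp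
      then have "E \<longlonglongrightarrow> 0"
        by (rule tendsto_sandwich[OF _ _ tendsto_const, rotated 2]) (use E0 Ew in auto)
      then show "(\<lambda>J. energy p 0 1 (\<lambda>x. g x - T n x - (P J x - T n x))) \<longlonglongrightarrow> 0"
        by (simp add: E_def[abs_def])
    qed
    also have "B \<le> C * 2000 * (real n powr (1 - p) * e n + Z)"
    proof -
      have "16 * (real n powr (1 - p) * e n + 8 * Z) + 128 * (8 * Z) \<le> 2000 * (real n powr (1 - p) * e n + Z)"
        using Z0 e0[of n] by (simp add: algebra_simps)
      then have "C * (16 * (real n powr (1 - p) * e n + 8 * Z) + 128 * (8 * Z)) \<le> C * (2000 * (real n powr (1 - p) * e n + Z))"
        using C(1) by (intro mult_left_mono) auto
      then show ?thesis by (simp only: B_def distrib_left mult.assoc)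
    qed
    finally show "cell_L1 p n (\<lambda>x. g x - T n x) \<le> C * 2000 * (real n powr (1 - p) * energy p 0 1 (\<lambda>x. g x - T n x) + Z)"
      unfolding e_def .
  qed
qed


section \<open>Approximating iterated primitives by splines\<close>

text \<open>
  A coefficient of a polynomial is a linear functional, which Lagrange interpolation at \<open>0, \<dots>, d\<close> expresses by values.
\<close>

lemma coeff_from_values:
  obtains c :: "nat \<Rightarrow> real" where
    "\<And>q :: real poly. degree q \<le> d \<Longrightarrow> coeff q t = (\<Sum>s\<le>d. c s * poly q (real s))"
proof -
  define L where "L s = (\<Prod>j\<in>{..d} - {s}. [:- real j / (real s - real j), 1 / (real s - real j):])" for s :: nat
  have Lval: "poly (L s) (real u) = (if u = s then 1 else 0)" if "s \<le> d" "u \<le> d" for s u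
  proof -
    have "poly (L s) (real u) = (\<Prod>j\<in>{..d} - {s}. (real u - real j) / (real s - real j))"
      unfolding L_def poly_prod by (intro prod.cong) (auto simp: diff_divide_distrib)
    also have "\<dots> = (if u = s then 1 else 0)"
    proof (cases "u = s")
      case True
      then show ?thesis by (auto intro!: prod.neutral)
    next
      case False
      then have "\<exists>j\<in>{..d} - {s}. (real u - real j) / (real s - real j) = 0" using that by (intro bexI[of _ u]) auto
      then show ?thesis using False by (simp add: prod_zero_iff)
    qed
    finally show ?thesis .
  qed
  have degL: "degree (L s) \<le> d" if "s \<le> d" for s
  proof -
    have "degree (L s) \<le> (\<Sum>j\<in>{..d} - {s}. degree [:- real j / (real s - real j), 1 / (real s - real j):])"
    proof -
      have "finite ({..d} - {s})" by simp
      from degree_prod_sum_le[OF this] show ?thesis unfolding L_def o_def .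
    qed
    also have "\<dots> \<le> (\<Sum>j\<in>{..d} - {s}. 1)" by (rule sum_mono) simp
    also have "\<dots> = d" using that by simp
    finally show ?thesis .
  qed
  show thesis
  proof (rule that[of "\<lambda>s. coeff (L s) t"])
    fix q :: "real poly" assume q: "degree q \<le> d"
    define q' where "q' = (\<Sum>s\<le>d. smult (poly q (real s)) (L s))"
    have "q = q'"
    proof (rule poly_eqI_degree[where A = "real ` {..d}"])
      show "poly q x = poly q' x" if "x \<in> real ` {..d}" for x
      proof -
        obtain u where u: "u \<le> d" "x = real u" using \<open>x \<in> real ` {..d}\<close> by auto
        have "poly q' x = (\<Sum>s\<le>d. poly q (real s) * (if u = s then 1 else 0))"
          unfolding q'_def poly_sum u(2) by (intro sum.cong) (use Lval u(1) in auto)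
        also have "\<dots> = (\<Sum>s\<le>d. if u = s then poly q (real s) else 0)" by (intro sum.cong) auto
        also have "\<dots> = poly q x" using u by simp
        finally show ?thesis by simp
      qed
      have card: "card (real ` {..d}) = Suc d" by (simp add: card_image)
      show "card (real ` {..d}) > degree q" using q card by simp
      have "degree q' \<le> d" unfolding q'_def
        by (rule degree_sum_le) (auto intro: order_trans[OF degree_smult_le] degL)
      then show "card (real ` {..d}) > degree q'" using card by simp
    qed
    then have "coeff q t = coeff q' t" by (rule arg_cong)
    also have "\<dots> = (\<Sum>s\<le>d. coeff (L s) t * poly q (real s))"
      by (simp add: q'_def coeff_sum mult.commute)
    finally show "coeff q t = (\<Sum>s\<le>d. coeff (L s) t * poly q (real s))" .
  qed
qed

text \<open>
  For fixed \<open>y\<close> read \<open>(y - x)\<^sup>d\<close> as a polynomial in \<open>x\<close>: its coefficient at \<open>x\<^sup>d\<^sup>-\<^sup>l\<close> is a nonzero multiple of \<open>y\<^sup>l\<close>, and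
  by the preceding lemma it is a fixed combination of the values \<open>(y - s)\<^sup>d\<close>.
\<close>

lemma monomial_from_shifted_powers:
  assumes "l \<le> d"
  obtains c :: "nat \<Rightarrow> real" where "\<And>y. y ^ l = (\<Sum>s\<le>d. c s * (y - real s) ^ d)"
proof -
  obtain c where c: "\<And>q :: real poly. degree q \<le> d \<Longrightarrow> coeff q (d - l) = (\<Sum>s\<le>d. c s * poly q (real s))"
    using coeff_from_values by blast
  let ?K = "real (d choose (d - l)) * (- 1) ^ (d - l)"
  have K: "?K \<noteq> 0" using assms by simp
  have "y ^ l = (\<Sum>s\<le>d. c s / ?K * (y - real s) ^ d)" for y
  proof -
    have "degree ([:y, -1:] ^ d) \<le> d" using degree_power_le[of "[:y, -1:]" d] by simp
    from c[OF this] have "coeff ([:y, -1:] ^ d) (d - l) = (\<Sum>s\<le>d. c s * (y - real s) ^ d)"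
      by (simp add: algebra_simps)
    moreover have "coeff ([:y, -1:] ^ d) (d - l) = ?K * y ^ l"
      using assms by (simp add: coeff_linear_poly_power)
    ultimately have "y ^ l = (\<Sum>s\<le>d. c s * (y - real s) ^ d) / ?K" using K by (simp add: field_simps)
    then show ?thesis by (simp add: sum_divide_distrib)
  qed
  then show thesis by (rule that)
qed

lemma energy_sum:
  assumes p: "0 < p" "p \<le> 1" and fin: "finite I" and u: "\<And>i. i \<in> I \<Longrightarrow> u i absolutely_integrable_on {a..b}"
  shows "energy p a b (\<lambda>x. \<Sum>i\<in>I. u i x) \<le> (\<Sum>i\<in>I. energy p a b (u i))"
  using fin u
proof (induction I)
  case empty
  then show ?case using p by (simp add: energy_def)
next
  case (insert j I)
  have "(\<lambda>x. \<Sum>i\<in>I. u i x) absolutely_integrable_on {a..b}"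
    using insert by (intro absolutely_integrable_sum) auto
  then have "energy p a b (\<lambda>x. u j x + (\<Sum>i\<in>I. u i x)) \<le> energy p a b (u j) + energy p a b (\<lambda>x. \<Sum>i\<in>I. u i x)"
    using insert by (intro energy_triangle[OF p]) auto
  then show ?case using insert by simp
qed

lemma energy_local:
  assumes p: "0 < p" "p \<le> 1" and n: "n \<ge> 1" and u: "u absolutely_integrable_on {0..1}"
    and zero: "\<And>x. x \<in> {0..1} \<Longrightarrow> x \<le> real i / real n \<or> real (i + m) / real n \<le> x \<Longrightarrow> u x = 0"
    and bnd: "\<And>x. x \<in> {0..1} \<Longrightarrow> real i / real n \<le> x \<Longrightarrow> x \<le> real (i + m) / real n \<Longrightarrow> \<bar>u x\<bar> \<le> B"
  shows "energy p 0 1 u \<le> real m / real n * B powr p"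
proof -
  have "energy p (real c / real n) (real (Suc c) / real n) u \<le> (if c \<in> {i..<i+m} then 1 / real n * B powr p else 0)"
    if c: "c < n" for c
  proof -
    let ?a = "real c / real n" and ?b = "real (Suc c) / real n"
    have sub: "{?a..?b} \<subseteq> {0..1}" by (rule cell_subset01[OF c])
    have ui: "u absolutely_integrable_on {?a..?b}" by (rule absolutely_integrable_on_subinterval[OF u sub])
    have ab: "?a \<le> ?b" by (intro divide_right_mono) auto
    have len: "?b - ?a = 1 / real n" by (simp add: diff_divide_distrib[symmetric])
    show ?thesis
    proof (cases "c \<in> {i..<i+m}")
      case True
      have "energy p ?a ?b u \<le> (?b - ?a) * B powr p"
      proof (rule energy_bounded[OF p ui ab])
        fix x assume x: "x \<in> {?a..?b}"
        have "real i / real n \<le> ?a" "?b \<le> real (i + m) / real n" using True by (auto intro!: divide_right_mono)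
        moreover have "x \<in> {0..1}" using x sub by blast
        ultimately have "\<bar>u x\<bar> \<le> B" using x by (intro bnd) auto
        then show "\<bar>u x\<bar> powr p \<le> B powr p" using p by (intro powr_mono2) auto
      qed
      then show ?thesis using True len by simp
    next
      case False
      have "energy p ?a ?b u \<le> (?b - ?a) * 0"
      proof (rule energy_bounded[OF p ui ab])
        fix x assume x: "x \<in> {?a..?b}"
        have "?b \<le> real i / real n \<or> real (i + m) / real n \<le> ?a"
        proof (cases "c < i")
          case True
          then have "?b \<le> real i / real n" by (intro divide_right_mono) auto
          then show ?thesis ..
        next
          case F: False
          then have "i + m \<le> c" using False by simp
          then have "real (i + m) / real n \<le> ?a" by (intro divide_right_mono) (auto simp only: of_nat_le_iff of_nat_0_le_iff)
          then show ?thesis ..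
        qed
        moreover have "x \<in> {0..1}" using x sub by blast
        ultimately have "u x = 0" using x by (intro zero) auto
        then show "\<bar>u x\<bar> powr p \<le> 0" using p by simp
      qed
      then show ?thesis by (simp only: False if_False mult_zero_right)
    qed
  qed
  then have "energy p 0 1 u \<le> (\<Sum>c<n. if c \<in> {i..<i+m} then 1 / real n * B powr p else 0)"
    unfolding energy_cells[OF p u n] by (intro sum_mono) auto
  also have "\<dots> = real (card ({..<n} \<inter> {i..<i+m})) * (1 / real n * B powr p)"
    by (simp add: sum.If_cases Int_def)
  also have "\<dots> \<le> real m * (1 / real n * B powr p)"
  proof (rule mult_right_mono)
    have "card ({..<n} \<inter> {i..<i+m}) \<le> card {i..<i+m}" by (rule card_mono) auto
    then show "real (card ({..<n} \<inter> {i..<i+m})) \<le> real m" by simp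
  qed simp
  finally show ?thesis by simp
qed

text \<open>
  Replace the shifted powers in the representation of \<open>y\<^sup>l\<close> by truncated powers. The result vanishes up to 0, and
  agrees with \<open>y\<^sup>l\<close> once all \<open>m\<close> knots are passed.
\<close>

lemma spline_continuing_monomial:
  assumes m: "m \<ge> 2" and l: "l < m"
  obtains w :: "real \<Rightarrow> real" and W :: real where
    "W \<ge> 0" "\<And>y. y \<le> 0 \<Longrightarrow> w y = 0" "\<And>y. real m - 1 \<le> y \<Longrightarrow> w y = y ^ l" "\<And>y. y \<le> real m \<Longrightarrow> \<bar>w y\<bar> \<le> W"
    "\<And>n i. n \<ge> 1 \<Longrightarrow> (\<lambda>x. w (real n * x - real i)) \<in> splines m n"
proof -
  define d where "d = m - 1"
  have d: "d \<ge> 1" "m = Suc d" "l \<le> d" using m l by (auto simp: d_def)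
  obtain c where c: "\<And>y. y ^ l = (\<Sum>s\<le>d. c s * (y - real s) ^ d)" using monomial_from_shifted_powers[OF d(3)] by blast
  define w where "w y = (\<Sum>s\<le>d. c s * trunc_pow d (real s) y)" for y
  show thesis
  proof (rule that[of "\<Sum>s\<le>d. \<bar>c s\<bar> * real m ^ d" w])
    show "0 \<le> (\<Sum>s\<le>d. \<bar>c s\<bar> * real m ^ d)" by (intro sum_nonneg) auto
    show "w y = 0" if "y \<le> 0" for y
      unfolding w_def by (rule sum.neutral) (use that in \<open>auto simp: trunc_pow_def\<close>)
    show "w y = y ^ l" if y: "real m - 1 \<le> y" for y
      unfolding w_def c
    proof (rule sum.cong[OF refl])
      fix s assume "s \<in> {..d}"
      then have "real s \<le> y" using y d by auto
      then show "c s * trunc_pow d (real s) y = c s * (y - real s) ^ d"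
        using d(1) by (cases "real s = y") (auto simp: trunc_pow_def)
    qed
    show "\<bar>w y\<bar> \<le> (\<Sum>s\<le>d. \<bar>c s\<bar> * real m ^ d)" if y: "y \<le> real m" for y
      unfolding w_def
    proof (rule order_trans[OF sum_abs], rule sum_mono)
      fix s
      have "\<bar>trunc_pow d (real s) y\<bar> \<le> real m ^ d"
        using y by (auto simp: trunc_pow_def abs_of_nonneg intro!: power_mono)
      then show "\<bar>c s * trunc_pow d (real s) y\<bar> \<le> \<bar>c s\<bar> * real m ^ d"
        unfolding abs_mult by (rule mult_left_mono) simp
    qed
    fix n i :: nat assume n: "n \<ge> 1"
    have "(\<lambda>x. \<Sum>s\<le>d. (c s * real n ^ d) * trunc_pow d (real (i + s) / real n) x) \<in> splines m n"
    proof (rule splines_sum)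
      show "trunc_pow d (real (i + s) / real n) \<in> splines m n" for s unfolding d(2) by (rule trunc_pow_in_splines[OF n])
    qed (use m in simp)
    moreover have "w (real n * x - real i) = (\<Sum>s\<le>d. (c s * real n ^ d) * trunc_pow d (real (i + s) / real n) x)" for x
      unfolding w_def
    proof (rule sum.cong[OF refl])
      fix s
      have "real s < real n * x - real i \<longleftrightarrow> real (i + s) / real n < x" using n by (auto simp: field_simps)
      moreover have "real n * x - real i - real s = real n * (x - real (i + s) / real n)" using n by (simp add: field_simps)
      ultimately show "c s * trunc_pow d (real s) (real n * x - real i) = (c s * real n ^ d) * trunc_pow d (real (i + s) / real n) x"
        by (simp add: trunc_pow_def power_mult_distrib)
    qed
    ultimately show "(\<lambda>x. w (real n * x - real i)) \<in> splines m n" by simp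
  qed
qed


text \<open>
  The function \<open>D i\<close> is the contribution of the \<open>i\<close>-th cell to the iterated primitive. To the right of this cell
  Taylor's formula makes it a polynomial with coefficients \<open>\<alpha> i l\<close>, which the spline \<open>Q i\<close> cancels \<open>m - 1\<close> knots later. What
  remains is supported on \<open>m\<close> cells and bounded by a constant multiple of \<open>n\<^sup>1\<^sup>-\<^sup>r\<close> times the \<open>L\<^sub>1\<close> norm of \<open>G\<close> on the cell.
\<close>

theorem iter_int_spline_approximation:
  assumes p: "0 < p" "p \<le> 1" and r: "r \<ge> 1" and m: "r < m"
  obtains C where "C > 0"
    "\<And>n G. n \<ge> 1 \<Longrightarrow> G absolutely_integrable_on {0..1} \<Longrightarrow>
      \<exists>Q\<in>splines m n. energy p 0 1 (\<lambda>x. iter_int 0 r G x - Q x) \<le> C * ((1 / real n ^ (r - 1)) powr p / real n) * cell_L1 p n G"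
proof -
  have m2: "m \<ge> 2" using r m by simp
  define P where "P l wW \<longleftrightarrow> (case wW of (w :: real \<Rightarrow> real, W :: real) \<Rightarrow>
    W \<ge> 0 \<and> (\<forall>y. y \<le> 0 \<longrightarrow> w y = 0) \<and> (\<forall>y. real m - 1 \<le> y \<longrightarrow> w y = y ^ l) \<and> (\<forall>y. y \<le> real m \<longrightarrow> \<bar>w y\<bar> \<le> W)
    \<and> (\<forall>n i. n \<ge> 1 \<longrightarrow> (\<lambda>x. w (real n * x - real i)) \<in> splines m n))" for l :: nat and wW
  have exP: "\<exists>wW. P l wW" if l: "l < m" for l
  proof (rule spline_continuing_monomial[OF m2 l])
    fix w W
    assume "W \<ge> 0" "\<And>y. y \<le> 0 \<Longrightarrow> w y = 0" "\<And>y. real m - 1 \<le> y \<Longrightarrow> w y = y ^ l" "\<And>y. y \<le> real m \<Longrightarrow> \<bar>w y\<bar> \<le> W"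
      "\<And>n i. n \<ge> 1 \<Longrightarrow> (\<lambda>x. w (real n * x - real i)) \<in> splines m n"
    then have "P l (w, W)" unfolding P_def by (simp only: prod.case) blast
    then show ?thesis ..
  qed
  define w where "w l = fst (SOME wW. P l wW)" for l
  define W where "W l = snd (SOME wW. P l wW)" for l
  have Pw: "P l (w l, W l)" if "l < m" for l
    unfolding w_def W_def using someI_ex[OF exP[OF that]] by simp
  have w: "W l \<ge> 0" "\<And>y. y \<le> 0 \<Longrightarrow> w l y = 0" "\<And>y. real m - 1 \<le> y \<Longrightarrow> w l y = y ^ l" "\<And>y. y \<le> real m \<Longrightarrow> \<bar>w l y\<bar> \<le> W l"
    "\<And>n i. n \<ge> 1 \<Longrightarrow> (\<lambda>x. w l (real n * x - real i)) \<in> splines m n" if "l < r" for l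
    using Pw[of l] m that unfolding P_def by auto
  define K where "K = 1 + (\<Sum>l<r. real m ^ l) + (\<Sum>l<r. W l)"
  have "0 \<le> (\<Sum>l<r. real m ^ l)" "0 \<le> (\<Sum>l<r. W l)" using w(1) by (auto intro: sum_nonneg)
  then have K: "K \<ge> 1" unfolding K_def by linarith
  show thesis
  proof (rule that[of "real m * K powr p"])
    show "real m * K powr p > 0" using m K by simp
    fix n :: nat and G :: "real \<Rightarrow> real" assume n: "n \<ge> 1" and G: "G absolutely_integrable_on {0..1}"
    have Gi: "G integrable_on {0..1}" using G by (simp add: absolutely_integrable_on_def)
    define B where "B i = integral {real i / real n..real (Suc i) / real n} (\<lambda>x. \<bar>G x\<bar>)" for i
    have B0: "B i \<ge> 0" for i unfolding B_def by (rule integral_abs_nonneg)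
    define H where "H = 1 / real n ^ (r - 1)"
    have H0: "H > 0" using n by (simp add: H_def)
    define D where "D i x = iter_int (real i / real n) r G x - iter_int (real (Suc i) / real n) r G x" for i x
    define \<alpha> where "\<alpha> i l = iter_int (real i / real n) (r - l) G (real (Suc i) / real n) / (real n ^ l * fact l)" for i l
    define Q where "Q i x = (\<Sum>l<r. \<alpha> i l * w l (real n * x - real (Suc i)))" for i x
    obtain s where s: "r = Suc s" using r by (cases r) auto
    have cellpos: "0 \<le> real i / real n" "real i / real n \<le> real (Suc i) / real n" for i
      by (auto intro!: divide_right_mono)
    have cell1: "real (Suc i) / real n \<le> 1" if "i < n" for i using that n by (simp add: field_simps)
    have gap: "real (Suc i) / real n - real i / real n = 1 / real n" for i by (simp add: diff_divide_distrib[symmetric])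
    have alpha: "\<bar>\<alpha> i l\<bar> \<le> H * B i" if i: "i < n" and l: "l < r" for i l
    proof -
      have "r - l = Suc (r - 1 - l)" using l by simp
      then have "\<bar>iter_int (real i / real n) (r - l) G (real (Suc i) / real n)\<bar> \<le> (1 / real n) ^ (r - 1 - l) * B i"
        using iter_int_bound[OF G cellpos(1) cellpos(2) cell1[OF i], of "r - 1 - l"] unfolding gap B_def by simp
      then have "\<bar>\<alpha> i l\<bar> \<le> (1 / real n) ^ (r - 1 - l) * B i / (real n ^ l * fact l)"
        unfolding \<alpha>_def abs_divide using n by (simp add: divide_right_mono)
      also have "\<dots> \<le> (1 / real n) ^ (r - 1 - l) * B i / (real n ^ l * 1)"
        using n B0 fact_ge_1[of l, where 'a = real] by (intro divide_left_mono mult_left_mono) auto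
      also have "\<dots> = (1 / (real n ^ (r - 1 - l) * real n ^ l)) * B i" by (simp add: power_divide)
      also have "real n ^ (r - 1 - l) * real n ^ l = real n ^ (r - 1)"
        using l by (simp add: power_add[symmetric])
      finally show ?thesis by (simp add: H_def)
    qed
    have Dright: "D i x = (\<Sum>l<r. \<alpha> i l * (real n * x - real (Suc i)) ^ l)"
      if i: "i < n" and x: "real (Suc i) / real n \<le> x" "x \<le> 1" for i x
    proof -
      have "D i x = (\<Sum>l\<le>s. iter_int (real i / real n) (r - l) G (real (Suc i) / real n) * (x - real (Suc i) / real n) ^ l / fact l)"
        unfolding D_def s using iter_int_taylor[OF Gi cellpos(1) cellpos(2) x, of s] by simp
      also have "\<dots> = (\<Sum>l<r. \<alpha> i l * (real n * x - real (Suc i)) ^ l)"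
        unfolding s lessThan_Suc_atMost
      proof (rule sum.cong[OF refl])
        fix l
        have "real n * x - real (Suc i) = real n * (x - real (Suc i) / real n)" using n by (simp add: field_simps)
        then show "iter_int (real i / real n) (Suc s - l) G (real (Suc i) / real n) * (x - real (Suc i) / real n) ^ l / fact l
          = \<alpha> i l * (real n * x - real (Suc i)) ^ l"
          using n by (simp add: \<alpha>_def s power_mult_distrib del: of_nat_Suc)
      qed
      finally show ?thesis .
    qed
    have Dmid: "\<bar>D i x\<bar> \<le> H * B i" if i: "i < n" and x: "real i / real n \<le> x" "x \<le> real (Suc i) / real n" for i x
    proof -
      have x1: "x \<le> 1" using x cell1[OF i] by simp
      have "iter_int (real (Suc i) / real n) r G x = 0" unfolding s by (rule iter_int_zero[OF x(2)])
      then have "\<bar>D i x\<bar> = \<bar>iter_int (real i / real n) (Suc s) G x\<bar>" by (simp add: D_def s)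
      also have "\<dots> \<le> (x - real i / real n) ^ s * integral {real i / real n..x} (\<lambda>t. \<bar>G t\<bar>)"
        by (rule iter_int_bound[OF G cellpos(1) x(1) x1])
      also have "\<dots> \<le> (1 / real n) ^ s * B i"
      proof (intro mult_mono power_mono)
        show "x - real i / real n \<le> 1 / real n" using x(2) gap[of i] by linarith
        show "integral {real i / real n..x} (\<lambda>t. \<bar>G t\<bar>) \<le> B i" unfolding B_def
        proof (rule integral_subset_le)
          show "{real i / real n..x} \<subseteq> {real i / real n..real (Suc i) / real n}" using x by auto
          show "(\<lambda>x. \<bar>G x\<bar>) integrable_on {real i / real n..x}"
            by (rule abs_integrable_cell[OF G]) (use x x1 cellpos(1)[of i] in auto)
          show "(\<lambda>x. \<bar>G x\<bar>) integrable_on {real i / real n..real (Suc i) / real n}"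
            by (rule abs_integrable_cell[OF G cell_subset01[OF i]])
        qed auto
      qed (use x integral_abs_nonneg in auto)
      finally show ?thesis by (simp add: H_def s power_divide)
    qed
    have Qspl: "Q i \<in> splines m n" for i
      unfolding Q_def
    proof (rule splines_sum)
      show "(\<lambda>x. w l (real n * x - real (Suc i))) \<in> splines m n" if "l \<in> {..<r}" for l
        by (rule w(5)) (use that n in auto)
    qed (use m2 in simp)
    have Dint: "D i absolutely_integrable_on {0..1}" if i: "i < n" for i
      unfolding D_def s
      by (intro absolutely_integrable_continuous_real continuous_on_diff iter_int_continuous Gi cellpos(1))
         (use cell1[OF i] cellpos(2)[of i] in linarith)+
    have uint: "(\<lambda>x. D i x - Q i x) absolutely_integrable_on {0..1}" if "i < n" for i
      by (rule set_integral_diff(1)[OF Dint[OF that] splines_integrable[OF Qspl _ n]]) (use m2 in simp)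
    have upen: "energy p 0 1 (\<lambda>x. D i x - Q i x) \<le> real m / real n * (K * (H * B i)) powr p" if i: "i < n" for i
    proof (rule energy_local[OF p n uint[OF i]])
      fix x :: real assume x: "x \<in> {0..1}" and out: "x \<le> real i / real n \<or> real (i + m) / real n \<le> x"
      show "D i x - Q i x = 0"
        using out
      proof
        assume le: "x \<le> real i / real n"
        then have "real n * x \<le> real i" using n by (simp add: field_simps)
        then have "Q i x = 0" unfolding Q_def by (intro sum.neutral ballI) (use w(2) in auto)
        moreover have "D i x = 0" unfolding D_def s
          using iter_int_zero[OF le, of s G] iter_int_zero[of x "real (Suc i) / real n" s G] le cellpos(2)[of i] by simp
        ultimately show ?thesis by simp
      next
        assume ge: "real (i + m) / real n \<le> x"
        then have y: "real m - 1 \<le> real n * x - real (Suc i)" using n by (simp add: field_simps)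
        have "real (Suc i) / real n \<le> real (i + m) / real n" using m r by (intro divide_right_mono) auto
        then have "D i x = (\<Sum>l<r. \<alpha> i l * (real n * x - real (Suc i)) ^ l)" using Dright[OF i _ , of x] ge x by auto
        also have "\<dots> = Q i x" unfolding Q_def by (intro sum.cong refl) (use w(3)[OF _ y] in auto)
        finally show ?thesis by simp
      qed
    next
      fix x :: real assume x: "x \<in> {0..1}" "real i / real n \<le> x" "x \<le> real (i + m) / real n"
      have y: "real n * x - real (Suc i) \<le> real m" using x(3) n by (simp add: field_simps)
      have HB: "H * B i \<ge> 0" using H0 B0[of i] by simp
      have "\<bar>Q i x\<bar> \<le> (\<Sum>l<r. (H * B i) * W l)" unfolding Q_def
      proof (rule order_trans[OF sum_abs], rule sum_mono)
        fix l assume "l \<in> {..<r}"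
        then show "\<bar>\<alpha> i l * w l (real n * x - real (Suc i))\<bar> \<le> H * B i * W l"
          unfolding abs_mult using alpha[OF i] w(4)[OF _ y] HB by (intro mult_mono) auto
      qed
      then have Qb: "\<bar>Q i x\<bar> \<le> (H * B i) * (\<Sum>l<r. W l)" by (simp only: sum_distrib_left)
      have Db: "\<bar>D i x\<bar> \<le> (H * B i) * (1 + (\<Sum>l<r. real m ^ l))"
      proof (cases "x \<le> real (Suc i) / real n")
        case True
        have "H * B i * 1 \<le> (H * B i) * (1 + (\<Sum>l<r. real m ^ l))"
          using HB by (intro mult_left_mono) (auto simp: sum_nonneg)
        then show ?thesis using Dmid[OF i x(2) True] by simp
      next
        case False
        then have y0: "0 \<le> real n * x - real (Suc i)" using n by (simp add: field_simps)
        have "\<bar>D i x\<bar> = \<bar>\<Sum>l<r. \<alpha> i l * (real n * x - real (Suc i)) ^ l\<bar>" using Dright[OF i _, of x] False x(1) by auto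
        also have "\<dots> \<le> (\<Sum>l<r. (H * B i) * real m ^ l)"
        proof (rule order_trans[OF sum_abs], rule sum_mono)
          fix l assume l: "l \<in> {..<r}"
          have "\<bar>(real n * x - real (Suc i)) ^ l\<bar> \<le> real m ^ l" using y y0 by (auto simp: abs_of_nonneg intro!: power_mono)
          then show "\<bar>\<alpha> i l * (real n * x - real (Suc i)) ^ l\<bar> \<le> H * B i * real m ^ l"
            unfolding abs_mult using alpha[OF i, of l] l HB by (intro mult_mono) auto
        qed
        also have "\<dots> = (H * B i) * (\<Sum>l<r. real m ^ l)" by (simp only: sum_distrib_left)
        also have "\<dots> \<le> (H * B i) * (1 + (\<Sum>l<r. real m ^ l))" using HB by (intro mult_left_mono) auto
        finally show ?thesis .
      qed
      have "\<bar>D i x - Q i x\<bar> \<le> (H * B i) * (1 + (\<Sum>l<r. real m ^ l)) + (H * B i) * (\<Sum>l<r. W l)" using Qb Db by linarith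
      also have "\<dots> = K * (H * B i)" by (simp add: K_def algebra_simps)
      finally show "\<bar>D i x - Q i x\<bar> \<le> K * (H * B i)" .
    qed
    define S where "S x = (\<Sum>i<n. 1 * Q i x)" for x
    have "S \<in> splines m n" unfolding S_def by (rule splines_sum) (use m2 Qspl in auto)
    moreover have "energy p 0 1 (\<lambda>x. iter_int 0 r G x - S x) \<le> real m * K powr p * (H powr p / real n) * cell_L1 p n G"
    proof -
      have "energy p 0 1 (\<lambda>x. iter_int 0 r G x - S x) = energy p 0 1 (\<lambda>x. \<Sum>i<n. D i x - Q i x)"
      proof (rule energy_cong)
        fix x :: real assume x: "x \<in> {0<..<1}"
        have "(\<Sum>i<n. D i x) = iter_int (real 0 / real n) r G x - iter_int (real n / real n) r G x"
          unfolding D_def by (rule sum_lessThan_telescope')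
        moreover have "iter_int (real n / real n) r G x = 0" unfolding s using iter_int_zero[of x 1 s G] x n by simp
        ultimately show "iter_int 0 r G x - S x = (\<Sum>i<n. D i x - Q i x)" by (simp add: S_def sum_subtractf)
      qed
      also have "\<dots> \<le> (\<Sum>i<n. energy p 0 1 (\<lambda>x. D i x - Q i x))"
        by (rule energy_sum[OF p]) (use uint in auto)
      also have "\<dots> \<le> (\<Sum>i<n. real m / real n * (K * (H * B i)) powr p)" by (rule sum_mono) (use upen in auto)
      also have "\<dots> = (\<Sum>i<n. (real m * K powr p * (H powr p / real n)) * B i powr p)"
        using K H0 B0 by (intro sum.cong refl) (simp add: powr_mult)
      also have "\<dots> = real m * K powr p * (H powr p / real n) * cell_L1 p n G"
        unfolding cell_L1_def B_def by (simp only: sum_distrib_left)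
      finally show ?thesis .
    qed
    ultimately show "\<exists>Q\<in>splines m n. energy p 0 1 (\<lambda>x. iter_int 0 r G x - Q x) \<le> real m * K powr p * ((1 / real n ^ (r - 1)) powr p / real n) * cell_L1 p n G"
      unfolding H_def by blast
  qed
qed


lemma splines_zero: "m \<ge> 1 \<Longrightarrow> (\<lambda>x. 0) \<in> splines m n"
  using splines_sum[of m "{}" "\<lambda>_ _. 0" n "\<lambda>_. 0"] by simp

lemma spline_err_le: "S \<in> splines m n \<Longrightarrow> spline_err m n f p \<le> Lp_norm01 p (\<lambda>x. f x - S x)"
  unfolding spline_err_def
  by (rule cINF_lower) (auto intro!: bdd_belowI2[of _ 0] simp: Lp_norm01_def)

lemma spline_err_nonneg: "m \<ge> 1 \<Longrightarrow> 0 \<le> spline_err m n f p"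
  unfolding spline_err_def
  by (rule cINF_greatest) (use splines_zero in \<open>auto simp: Lp_norm01_def\<close>)

section \<open>The error of the derivative\<close>

text \<open>
  Nearly best splines for \<open>g\<close> avoid the question whether best ones exist; \<open>\<epsilon>\<close> tends to 0 at the end.
\<close>

lemma spline_near_best:
  assumes p: "0 < p" "p \<le> 1" and m: "m \<ge> 1" and n: "n \<ge> 1" and g: "g absolutely_integrable_on {0..1}" and \<epsilon>: "\<epsilon> > 0"
  obtains T where "T \<in> splines m n" "energy p 0 1 (\<lambda>x. g x - T x) \<le> spline_err m n g p powr p + \<epsilon>"
proof -
  let ?E = "spline_err m n g p" and ?d = "\<epsilon> powr (1 / p)"
  have d: "?d > 0" using \<epsilon> by simp
  have "(INF S\<in>splines m n. Lp_norm01 p (\<lambda>x. g x - S x)) < ?E + ?d" using d by (simp add: spline_err_def)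
  then obtain T where T: "T \<in> splines m n" "Lp_norm01 p (\<lambda>x. g x - T x) < ?E + ?d"
    using splines_zero[OF m] by (subst (asm) cINF_less_iff) (auto intro!: bdd_belowI2[of _ 0] simp: Lp_norm01_def)
  have ai: "(\<lambda>x. g x - T x) absolutely_integrable_on {0..1}"
    by (rule set_integral_diff(1)[OF g splines_integrable[OF T(1) m n]])
  have "energy p 0 1 (\<lambda>x. g x - T x) = Lp_norm01 p (\<lambda>x. g x - T x) powr p" by (rule Lp_norm01_powr[OF p ai, symmetric])
  also have "\<dots> \<le> (?E + ?d) powr p" using T(2) p by (intro powr_mono2) (auto simp: Lp_norm01_def)
  also have "\<dots> \<le> ?E powr p + ?d powr p" using powr_add_le[OF p, of ?E ?d] spline_err_nonneg[OF m, of n g p] d by simp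
  also have "?d powr p = \<epsilon>" using p \<epsilon> by (simp add: powr_powr)
  finally show thesis using that[OF T(1)] by simp
qed

lemma pderiv_power_zero:
  fixes q :: "real poly"
  assumes "degree q < r" shows "(pderiv ^^ r) q = 0"
  using assms
proof (induction r arbitrary: q)
  case (Suc r)
  show ?case
  proof (cases r)
    case 0
    then show ?thesis using Suc.prems by (simp add: pderiv_eq_0_iff)
  next
    case (Suc r')
    then have "degree (pderiv q) < r" using Suc.prems by (simp add: degree_pderiv)
    then show ?thesis using Suc.IH[of "pderiv q"] by (simp add: funpow_swap1)
  qed
qed simp

lemma pderiv_power_add: "(pderiv ^^ r) (a + b) = (pderiv ^^ r) a + (pderiv ^^ r) (b :: real poly)"
  by (induction r) (simp_all add: pderiv_add)

lemma pderiv_power_diff: "(pderiv ^^ r) (a - b) = (pderiv ^^ r) a - (pderiv ^^ r) (b :: real poly)"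
  by (induction r) (simp_all add: pderiv_diff)

lemma pw_polys_deriv01:
  assumes S: "pw_polys m n S \<sigma>"
  shows "pw_polys m n (deriv01 r S) (\<lambda>i. (pderiv ^^ r) (\<sigma> i))"
  unfolding pw_polys_def
proof (intro allI impI conjI ballI)
  fix i x assume i: "i < n"
  have "degree ((pderiv ^^ r) q) \<le> degree q" for q :: "real poly"
  proof (induction r)
    case (Suc r) then show ?case using degree_pderiv[of "(pderiv ^^ r) q"] by (simp add: le_diff_conv)
  qed simp
  then show "degree ((pderiv ^^ r) (\<sigma> i)) < m" using S i unfolding pw_polys_def by (meson le_less_trans)
  assume x: "x \<in> {real i / real n<..<real (Suc i) / real n}"
  show "deriv01 r S x = poly ((pderiv ^^ r) (\<sigma> i)) x"
  proof (rule deriv01_piecewise_poly[OF _ _ x])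
    show "S y = poly (\<sigma> i) y" if "y \<in> {real i / real n<..<real (Suc i) / real n}" for y
      using S i that unfolding pw_polys_def by blast
    show "{real i / real n<..<real (Suc i) / real n} \<subseteq> {0..1}"
      using cell_subset01[OF i] greaterThanLessThan_subseteq_atLeastAtMost_iff[of "real i / real n" "real (Suc i) / real n" "real i / real n" "real (Suc i) / real n"] by blast
  qed
qed

text \<open>
  On a cell the Taylor polynomial \<open>\<Lambda>\<close> of \<open>f - R\<close> at the left end point does not change the \<open>r\<close>-th derivative, and it
  reduces \<open>f - R\<close> to the iterated primitive based at that point. This removes the influence of all other cells.
\<close>

theorem derivative_error_local:
  assumes p: "0 < p" "p \<le> 1" and r: "r \<ge> 1"
  obtains C where "C > 0"
    "\<And>n f g G R S \<rho> \<sigma> T q. n \<ge> 1 \<Longrightarrow> G absolutely_integrable_on {0..1} \<Longrightarrow> f absolutely_integrable_on {0..1} \<Longrightarrow>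
       g absolutely_integrable_on {0..1} \<Longrightarrow>
       pw_polys m n R \<rho> \<Longrightarrow> pw_polys m n S \<sigma> \<Longrightarrow> pw_polys k n T q \<Longrightarrow>
       (\<And>i. i < n \<Longrightarrow> (pderiv ^^ r) (\<rho> i) = q i) \<Longrightarrow>
       (\<And>x. x \<in> {0..1} \<Longrightarrow> f x - R x = iter_int 0 r G x) \<Longrightarrow>
       energy p 0 1 (\<lambda>x. g x - deriv01 r S x) \<le> energy p 0 1 (\<lambda>x. g x - T x)
         + C * real n powr (real r * p) * (energy p 0 1 (\<lambda>x. f x - S x) + ((1 / real n ^ (r - 1)) powr p / real n) * cell_L1 p n G)"
proof -
  obtain C where C: "C > 0" "\<And>(q::real poly) a h. degree q \<le> m + r \<Longrightarrow> h > 0 \<Longrightarrow>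
     energy p a (a + h) (poly ((pderiv ^^ r) q)) \<le> C * h powr (- (real r * p)) * energy p a (a + h) (poly q)"
    using poly_markov[OF p, of "m + r" r] by blast
  show thesis
  proof (rule that[OF C(1)])
    fix n and f g G R S T :: "real \<Rightarrow> real" and \<rho> \<sigma> q
    assume n: "n \<ge> (1::nat)" and G: "G absolutely_integrable_on {0..1}" and f: "f absolutely_integrable_on {0..1}"
      and g: "g absolutely_integrable_on {0..1}"
      and R: "pw_polys m n R \<rho>" and S: "pw_polys m n S \<sigma>" and T: "pw_polys k n T q"
      and \<rho>: "\<And>i. i < n \<Longrightarrow> (pderiv ^^ r) (\<rho> i) = q i"
      and fR: "\<And>x. x \<in> {0..1} \<Longrightarrow> f x - R x = iter_int 0 r G x"
    obtain s where s: "r = Suc s" using r by (cases r) auto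
    have Gi: "G integrable_on {0..1}" using G by (simp add: absolutely_integrable_on_def)
    let ?H = "1 / real n ^ (r - 1)"
    have Si: "S absolutely_integrable_on {0..1}" by (rule pw_polys_integrable[OF S n])
    have Ti: "T absolutely_integrable_on {0..1}" by (rule pw_polys_integrable[OF T n])
    have dSi: "deriv01 r S absolutely_integrable_on {0..1}" by (rule pw_polys_integrable[OF pw_polys_deriv01[OF S] n])
    have gT: "(\<lambda>x. g x - T x) absolutely_integrable_on {0..1}" by (rule set_integral_diff(1)[OF g Ti])
    have gS: "(\<lambda>x. g x - deriv01 r S x) absolutely_integrable_on {0..1}" by (rule set_integral_diff(1)[OF g dSi])
    have fS: "(\<lambda>x. f x - S x) absolutely_integrable_on {0..1}" by (rule set_integral_diff(1)[OF f Si])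
    let ?a = "\<lambda>c. real c / real n" and ?b = "\<lambda>c. real (Suc c) / real n"
    define B where "B c = integral {?a c..?b c} (\<lambda>x. \<bar>G x\<bar>)" for c
    have loc: "energy p (?a c) (?b c) (\<lambda>x. g x - deriv01 r S x) \<le> energy p (?a c) (?b c) (\<lambda>x. g x - T x)
        + C * real n powr (real r * p) * (energy p (?a c) (?b c) (\<lambda>x. f x - S x) + (?H powr p / real n) * B c powr p)" if c: "c < n" for c
    proof -
      have sub: "{?a c..?b c} \<subseteq> {0..1}" by (rule cell_subset01[OF c])
      have bh: "?b c = ?a c + 1 / real n" by (simp add: add_divide_distrib)
      have ab: "0 \<le> ?a c" "?a c \<le> ?b c" "?b c \<le> 1"
        using c n by (auto intro!: divide_right_mono simp: field_simps)
      define \<Lambda> where "\<Lambda> = (\<Sum>l\<le>s. smult (iter_int 0 (r - l) G (?a c) / fact l) ([:- ?a c, 1:] ^ l))"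
      have d\<Lambda>: "degree \<Lambda> \<le> s" unfolding \<Lambda>_def
      proof (rule degree_sum_le)
        fix l assume "l \<in> {..s}"
        then show "degree (smult (iter_int 0 (r - l) G (?a c) / fact l) ([:- ?a c, 1:] ^ l)) \<le> s"
          using degree_power_le[of "[:- ?a c, 1:]" l] by (intro order_trans[OF degree_smult_le]) simp
      qed simp
      have \<Lambda>v: "iter_int 0 r G x = poly \<Lambda> x + iter_int (?a c) r G x" if x: "x \<in> {?a c..?b c}" for x
      proof -
        have "iter_int 0 (Suc s) G x = (\<Sum>l\<le>s. iter_int 0 (Suc s - l) G (?a c) * (x - ?a c) ^ l / fact l) + iter_int (?a c) (Suc s) G x"
          by (rule iter_int_taylor[OF Gi order_refl ab(1)]) (use x ab in auto)
        moreover have "poly \<Lambda> x = (\<Sum>l\<le>s. iter_int 0 (Suc s - l) G (?a c) * (x - ?a c) ^ l / fact l)"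
          unfolding \<Lambda>_def poly_sum s by (intro sum.cong refl) simp
        ultimately show ?thesis by (simp add: s)
      qed
      \<comment> \<open>On the cell this is \<open>R + \<Lambda> - S\<close>, hence \<open>(f - S)\<close> minus the local remainder of Taylor's formula.\<close>
      define \<pi> where "\<pi> = \<rho> c + \<Lambda> - \<sigma> c"
      have d\<pi>: "degree \<pi> \<le> m + r"
      proof -
        have "degree (\<rho> c) \<le> m + r" "degree (\<sigma> c) \<le> m + r" "degree \<Lambda> \<le> m + r"
          using R S c d\<Lambda> by (auto simp: pw_polys_def s intro: less_imp_le[THEN trans_le_add1])
        then show ?thesis unfolding \<pi>_def by (intro degree_diff_le degree_add_le)
      qed
      have d\<pi>r: "(pderiv ^^ r) \<pi> = q c - (pderiv ^^ r) (\<sigma> c)"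
        unfolding \<pi>_def pderiv_power_diff pderiv_power_add \<rho>[OF c]
        using pderiv_power_zero[of \<Lambda> r] d\<Lambda> s by simp
      have ioc: "{?a c<..<?b c} \<subseteq> {0..1}" by (rule order_trans[OF _ sub]) auto
      have eq1: "g x - deriv01 r S x = (g x - T x) + poly ((pderiv ^^ r) \<pi>) x" if x: "x \<in> {?a c<..<?b c}" for x
      proof -
        have "deriv01 r S x = poly ((pderiv ^^ r) (\<sigma> c)) x" "T x = poly (q c) x"
          using pw_polys_deriv01[OF S, of r] T c x unfolding pw_polys_def by blast+
        then show ?thesis unfolding d\<pi>r by simp
      qed
      have eq2: "poly \<pi> x = (f x - S x) + - iter_int (?a c) r G x" if x: "x \<in> {?a c<..<?b c}" for x
      proof -
        have "R x = poly (\<rho> c) x" "S x = poly (\<sigma> c) x" using R S c x unfolding pw_polys_def by blast+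
        moreover have "f x - R x = poly \<Lambda> x + iter_int (?a c) r G x" using fR[of x] \<Lambda>v[of x] x ioc by auto
        ultimately show ?thesis by (simp add: \<pi>_def)
      qed
      note ais = absolutely_integrable_on_subinterval[OF _ sub]
      have Ii: "(\<lambda>x. - iter_int (?a c) r G x) absolutely_integrable_on {?a c..?b c}"
      proof (rule ais, rule absolutely_integrable_continuous_real)
        show "continuous_on {0..1} (\<lambda>x. - iter_int (?a c) r G x)" unfolding s
          by (intro continuous_on_minus iter_int_continuous Gi ab(1)) (use ab in linarith)
      qed
      have "energy p (?a c) (?b c) (poly \<pi>) = energy p (?a c) (?b c) (\<lambda>x. (f x - S x) + - iter_int (?a c) r G x)"
        by (rule energy_cong[OF eq2])
      also have "\<dots> \<le> energy p (?a c) (?b c) (\<lambda>x. f x - S x) + energy p (?a c) (?b c) (\<lambda>x. - iter_int (?a c) r G x)"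
        by (rule energy_triangle[OF p ais[OF fS] Ii])
      also have "energy p (?a c) (?b c) (\<lambda>x. - iter_int (?a c) r G x) \<le> (?b c - ?a c) * (?H * B c) powr p"
      proof (rule energy_bounded[OF p Ii ab(2)])
        fix x assume x: "x \<in> {?a c..?b c}"
        have x1: "?a c \<le> x" "x \<le> 1" using x ab by auto
        have "\<bar>iter_int (?a c) (Suc s) G x\<bar> \<le> (x - ?a c) ^ s * integral {?a c..x} (\<lambda>t. \<bar>G t\<bar>)"
          by (rule iter_int_bound[OF G ab(1) x1])
        also have "\<dots> \<le> (1 / real n) ^ s * B c"
        proof (intro mult_mono power_mono)
          show "x - ?a c \<le> 1 / real n" using x bh by auto
          show "integral {?a c..x} (\<lambda>t. \<bar>G t\<bar>) \<le> B c" unfolding B_def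
          proof (rule integral_subset_le)
            show "{?a c..x} \<subseteq> {?a c..?b c}" using x by auto
            show "(\<lambda>x. \<bar>G x\<bar>) integrable_on {?a c..x}"
              by (rule abs_integrable_cell[OF G]) (use x1 ab in auto)
            show "(\<lambda>x. \<bar>G x\<bar>) integrable_on {?a c..?b c}" by (rule abs_integrable_cell[OF G sub])
          qed auto
        qed (use x integral_abs_nonneg in auto)
        also have "\<dots> = ?H * B c" by (simp add: s power_divide)
        finally show "\<bar>- iter_int (?a c) r G x\<bar> powr p \<le> (?H * B c) powr p"
          unfolding s abs_minus_cancel using p by (intro powr_mono2) auto
      qed
      also have "(?b c - ?a c) * (?H * B c) powr p = (?H powr p / real n) * B c powr p"
      proof -
        have "B c \<ge> 0" unfolding B_def by (rule integral_abs_nonneg)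
        then have "(?H * B c) powr p = ?H powr p * B c powr p" by (intro powr_mult)
        moreover have "?b c - ?a c = 1 / real n" unfolding bh by simp
        ultimately show ?thesis by simp
      qed
      finally have \<pi>b: "energy p (?a c) (?b c) (poly \<pi>) \<le> energy p (?a c) (?b c) (\<lambda>x. f x - S x) + (?H powr p / real n) * B c powr p"
        by simp
      have "energy p (?a c) (?b c) (\<lambda>x. g x - deriv01 r S x) = energy p (?a c) (?b c) (\<lambda>x. (g x - T x) + poly ((pderiv ^^ r) \<pi>) x)"
        by (rule energy_cong[OF eq1])
      also have "\<dots> \<le> energy p (?a c) (?b c) (\<lambda>x. g x - T x) + energy p (?a c) (?b c) (poly ((pderiv ^^ r) \<pi>))"
        by (rule energy_triangle[OF p ais[OF gT] poly_absolutely_integrable])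
      also have "energy p (?a c) (?b c) (poly ((pderiv ^^ r) \<pi>)) \<le> C * (1 / real n) powr (- (real r * p)) * energy p (?a c) (?b c) (poly \<pi>)"
        unfolding bh by (rule C(2)[OF d\<pi>]) (use n in simp)
      also have "(1 / real n) powr (- (real r * p)) = real n powr (real r * p)"
        using n by (simp add: powr_divide powr_minus)
      also have "C * real n powr (real r * p) * energy p (?a c) (?b c) (poly \<pi>)
         \<le> C * real n powr (real r * p) * (energy p (?a c) (?b c) (\<lambda>x. f x - S x) + (?H powr p / real n) * B c powr p)"
        using C(1) by (intro mult_left_mono \<pi>b) auto
      finally show ?thesis by simp
    qed
    have "energy p 0 1 (\<lambda>x. g x - deriv01 r S x) = (\<Sum>c<n. energy p (?a c) (?b c) (\<lambda>x. g x - deriv01 r S x))"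
      by (rule energy_cells[OF p gS n])
    also have "\<dots> \<le> (\<Sum>c<n. energy p (?a c) (?b c) (\<lambda>x. g x - T x)
        + C * real n powr (real r * p) * (energy p (?a c) (?b c) (\<lambda>x. f x - S x) + (?H powr p / real n) * B c powr p))"
      by (rule sum_mono) (use loc in auto)
    also have "\<dots> = (\<Sum>c<n. energy p (?a c) (?b c) (\<lambda>x. g x - T x))
        + C * real n powr (real r * p) * ((\<Sum>c<n. energy p (?a c) (?b c) (\<lambda>x. f x - S x)) + (?H powr p / real n) * (\<Sum>c<n. B c powr p))"
      by (simp only: sum.distrib sum_distrib_left[symmetric])
    also have "\<dots> = energy p 0 1 (\<lambda>x. g x - T x) + C * real n powr (real r * p) * (energy p 0 1 (\<lambda>x. f x - S x) + (?H powr p / real n) * cell_L1 p n G)"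
      unfolding energy_cells[OF p gT n, symmetric] energy_cells[OF p fS n, symmetric] cell_L1_def B_def ..
    finally show "energy p 0 1 (\<lambda>x. g x - deriv01 r S x) \<le> energy p 0 1 (\<lambda>x. g x - T x)
         + C * real n powr (real r * p) * (energy p 0 1 (\<lambda>x. f x - S x) + (?H powr p / real n) * cell_L1 p n G)" .
  qed
qed


lemma powr_inverse_add_le:
  fixes A B p :: real
  assumes p: "0 < p" and "0 \<le> A" "0 \<le> B"
  shows "(A + B) powr (1 / p) \<le> 2 powr (1 / p) * (A powr (1 / p) + B powr (1 / p))"
proof -
  have "(A + B) powr (1 / p) \<le> (2 * max A B) powr (1 / p)" using assms by (intro powr_mono2) auto
  also have "\<dots> = 2 powr (1 / p) * max A B powr (1 / p)" using assms by (simp add: powr_mult)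
  also have "\<dots> \<le> 2 powr (1 / p) * (A powr (1 / p) + B powr (1 / p))"
    by (intro mult_left_mono) (auto simp: max_def)
  finally show ?thesis .
qed

lemma geometric_half_sum_le: "(\<Sum>\<nu>\<in>{n<..N}. (1 / 2 :: real) ^ \<nu>) \<le> 1"
proof -
  have "(\<Sum>\<nu>\<in>{n<..N}. (1 / 2 :: real) ^ \<nu>) \<le> (\<Sum>\<nu>\<in>{1..<Suc N}. (1 / 2) ^ \<nu>)"
    by (rule sum_mono2) auto
  also have "\<dots> = 1 - (1 / 2) ^ N" by (induction N) (auto simp: field_simps)
  also have "\<dots> \<le> 1" by simp
  finally show ?thesis .
qed

text \<open>
  The three estimates combined, for the \<open>p\<close>-th powers. The choice \<open>\<epsilon> 2\<^sup>-\<^sup>\<nu>\<close> of the accuracy of the \<open>\<nu>\<close>-th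
  nearly best spline makes the total loss in the series at most \<open>\<epsilon>\<close>.
\<close>

theorem powered_derivative_error:
  fixes p :: real and r m :: nat
  assumes p: "0 < p" "p < 1" and r: "1 \<le> r" and m: "r < m"
  obtains C where "C > 0"
    "\<And>(f :: real \<Rightarrow> real) S n. n \<ge> 1 \<Longrightarrow> differentiable_times01 (r - 1) f \<Longrightarrow> AC01 (deriv01 (r - 1) f) \<Longrightarrow>
     summable (\<lambda>\<nu>. real (\<nu> + n + 1) powr (- p) * spline_err (m - r) (\<nu> + n + 1) (deriv01 r f) p powr p) \<Longrightarrow>
     S \<in> splines m n \<Longrightarrow> Lp_norm01 p (\<lambda>x. f x - S x) = spline_err m n f p \<Longrightarrow>
     energy p 0 1 (\<lambda>x. deriv01 r f x - deriv01 r S x) \<le> C * (spline_err (m - r) n (deriv01 r f) p powr p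
       + real n powr (p - 1) * (\<Sum>\<nu>. real (\<nu> + n + 1) powr (- p) * spline_err (m - r) (\<nu> + n + 1) (deriv01 r f) p powr p))"
proof -
  have p': "p \<le> 1" using p by simp
  define k where "k = m - r"
  have k: "k \<ge> 1" "k + r = m" using m by (auto simp: k_def)
  have m1: "m \<ge> 1" using m by simp
  show thesis
  proof (rule cell_L1_spline_error[OF p, of k], goal_cases)
  case (1 C1)
  note C1 = this
  show thesis
  proof (rule iter_int_spline_approximation[OF p(1) p' r m], goal_cases)
  case (1 C2)
  note C2 = this
  show thesis
  proof (rule derivative_error_local[OF p(1) p' r, of m k], goal_cases)
  case (1 C3)
  note C3 = this
  define K where "K = C3 * (C2 + 1) * C1"
  have K: "K > 0" using C1(1) C2(1) C3(1) by (simp add: K_def)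
  show thesis
  proof (rule that[of "1 + K"])
    show "1 + K > 0" using K by simp
    fix f :: "real \<Rightarrow> real" and S n
    assume n: "n \<ge> (1::nat)" and f: "differentiable_times01 (r - 1) f" "AC01 (deriv01 (r - 1) f)"
      and sm: "summable (\<lambda>\<nu>. real (\<nu> + n + 1) powr (- p) * spline_err (m - r) (\<nu> + n + 1) (deriv01 r f) p powr p)"
      and S: "S \<in> splines m n" "Lp_norm01 p (\<lambda>x. f x - S x) = spline_err m n f p"
    define g where "g = deriv01 r f"
    define e where "e \<nu> = spline_err k \<nu> g p powr p" for \<nu>
    define Z where "Z = (\<Sum>\<nu>. real (\<nu> + n + 1) powr (- p) * e (\<nu> + n + 1))"
    have sm': "summable (\<lambda>\<nu>. real (\<nu> + n + 1) powr (- p) * e (\<nu> + n + 1))"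
      using sm by (simp add: e_def g_def k_def)
    have e0: "e \<nu> \<ge> 0" for \<nu> by (simp add: e_def)
    have g: "g absolutely_integrable_on {0..1}" unfolding g_def by (rule AC01_iterated_FTC(1)[OF r f])
    have fi: "f absolutely_integrable_on {0..1}"
    proof (rule absolutely_integrable_continuous_real)
      show "continuous_on {0..1} f"
      proof (cases "r = 1")
        case True then show ?thesis using AC01_continuous[OF f(2)] by simp
      next
        case False
        then have "0 < r - 1" using r by simp
        then have "deriv01 0 f differentiable_on {0..1}" using f(1) unfolding differentiable_times01_def by blast
        then show ?thesis using differentiable_imp_continuous_on by simp
      qed
    qed
    obtain \<sigma> where \<sigma>: "pw_polys m n S \<sigma>" using S(1) splines_iff[OF m1] by blast
    have main: "energy p 0 1 (\<lambda>x. g x - deriv01 r S x) \<le> (1 + K) * (e n + real n powr (p - 1) * Z) + (1 + 2 * K) * \<epsilon>"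
      if \<epsilon>: "\<epsilon> > 0" for \<epsilon>
    proof -
      have "\<exists>T q. T \<in> splines k \<nu> \<and> pw_polys k \<nu> T q \<and> energy p 0 1 (\<lambda>x. g x - T x) \<le> e \<nu> + \<epsilon> * (1 / 2) ^ \<nu>" if \<nu>: "\<nu> \<ge> 1" for \<nu>
      proof -
        have "\<epsilon> * (1 / 2) ^ \<nu> > 0" using \<epsilon> by simp
        then obtain T where T: "T \<in> splines k \<nu>" "energy p 0 1 (\<lambda>x. g x - T x) \<le> e \<nu> + \<epsilon> * (1 / 2) ^ \<nu>"
          using spline_near_best[OF p(1) p' k(1) \<nu> g] unfolding e_def by metis
        moreover obtain q where "pw_polys k \<nu> T q" using T(1) splines_iff[OF k(1)] by blast
        ultimately show ?thesis by blast
      qed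
      then obtain T q where T: "\<And>\<nu>. \<nu> \<ge> 1 \<Longrightarrow> T \<nu> \<in> splines k \<nu>" "\<And>\<nu>. \<nu> \<ge> 1 \<Longrightarrow> pw_polys k \<nu> (T \<nu>) (q \<nu>)"
        "\<And>\<nu>. \<nu> \<ge> 1 \<Longrightarrow> energy p 0 1 (\<lambda>x. g x - T \<nu> x) \<le> e \<nu> + \<epsilon> * (1 / 2) ^ \<nu>" by metis
      let ?G = "\<lambda>x. g x - T n x"
      let ?\<eta> = "(1 / real n ^ (r - 1)) powr p / real n"
      have Ti: "T n absolutely_integrable_on {0..1}" by (rule pw_polys_integrable[OF T(2)[OF n] n])
      have G: "?G absolutely_integrable_on {0..1}" by (rule set_integral_diff(1)[OF g Ti])
      have eps_n: "\<epsilon> * (1 / 2) ^ n \<le> \<epsilon>" using \<epsilon> by (simp add: power_le_one mult_left_le)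
      have en: "energy p 0 1 ?G \<le> e n + \<epsilon>" using T(3)[OF n] eps_n by linarith
      have Zb: "(\<Sum>\<nu>\<in>{n<..N}. real \<nu> powr (- p) * energy p 0 1 (\<lambda>x. g x - T \<nu> x)) \<le> Z + \<epsilon>" for N
      proof -
        have "(\<Sum>\<nu>\<in>{n<..N}. real \<nu> powr (- p) * energy p 0 1 (\<lambda>x. g x - T \<nu> x))
            \<le> (\<Sum>\<nu>\<in>{n<..N}. real \<nu> powr (- p) * e \<nu> + \<epsilon> * (1 / 2) ^ \<nu>)"
        proof (rule sum_mono)
          fix \<nu> assume "\<nu> \<in> {n<..N}"
          then have \<nu>: "\<nu> \<ge> 1" using n by auto
          have "real \<nu> powr (- p) \<le> real \<nu> powr 0" using \<nu> p by (intro powr_mono) auto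
          then have le1: "real \<nu> powr (- p) \<le> 1" using \<nu> by simp
          have "real \<nu> powr (- p) * energy p 0 1 (\<lambda>x. g x - T \<nu> x) \<le> real \<nu> powr (- p) * (e \<nu> + \<epsilon> * (1 / 2) ^ \<nu>)"
            by (rule mult_left_mono[OF T(3)[OF \<nu>]]) simp
          also have "\<dots> = real \<nu> powr (- p) * e \<nu> + real \<nu> powr (- p) * (\<epsilon> * (1 / 2) ^ \<nu>)" by (rule distrib_left)
          also have "real \<nu> powr (- p) * (\<epsilon> * (1 / 2) ^ \<nu>) \<le> 1 * (\<epsilon> * (1 / 2) ^ \<nu>)"
            by (rule mult_right_mono[OF le1]) (use \<epsilon> in simp)
          finally show "real \<nu> powr (- p) * energy p 0 1 (\<lambda>x. g x - T \<nu> x) \<le> real \<nu> powr (- p) * e \<nu> + \<epsilon> * (1 / 2) ^ \<nu>" by simp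
        qed
        also have "\<dots> = (\<Sum>\<nu>\<in>{n<..N}. real \<nu> powr (- p) * e \<nu>) + \<epsilon> * (\<Sum>\<nu>\<in>{n<..N}. (1 / 2) ^ \<nu>)"
          by (simp add: sum.distrib sum_distrib_left)
        also have "(\<Sum>\<nu>\<in>{n<..N}. real \<nu> powr (- p) * e \<nu>) = (\<Sum>\<nu><N - n. real (\<nu> + n + 1) powr (- p) * e (\<nu> + n + 1))"
          by (rule sum.reindex_bij_witness[of _ "\<lambda>\<nu>. \<nu> + n + 1" "\<lambda>\<nu>. \<nu> - n - 1"]) auto
        also have "\<dots> \<le> Z" unfolding Z_def by (rule sum_le_suminf[OF sm']) (use e0 in auto)
        also have "\<epsilon> * (\<Sum>\<nu>\<in>{n<..N}. (1 / 2) ^ \<nu>) \<le> \<epsilon> * 1"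
          using \<epsilon> geometric_half_sum_le by (intro mult_left_mono) auto
        finally show ?thesis by simp
      qed
      show ?thesis
      proof (rule spline_with_given_derivative[OF r f T(1)[OF n] T(2)[OF n] k(1) n], goal_cases)
      case (1 R \<rho>)
      note R = this[folded g_def]
      obtain Q where Q: "Q \<in> splines m n" "energy p 0 1 (\<lambda>x. iter_int 0 r ?G x - Q x) \<le> C2 * ?\<eta> * cell_L1 p n ?G"
        using C2(2)[OF n G] by blast
      have L: "cell_L1 p n ?G \<le> C1 * (real n powr (1 - p) * energy p 0 1 ?G + (Z + \<epsilon>))"
        by (rule C1(2)[OF n g _ Zb, where q = q]) (rule T(2), use n in simp)
      have fS: "energy p 0 1 (\<lambda>x. f x - S x) \<le> C2 * ?\<eta> * cell_L1 p n ?G"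
      proof -
        \<comment> \<open>A competitor for the best approximation of \<open>f\<close>.\<close>
        define V where "V x = 1 * R x + 1 * Q x" for x
        have V: "V \<in> splines m n" unfolding V_def by (rule splines_linear[OF m1]) (use R(1) Q(1) k(2) in auto)
        have fSi: "(\<lambda>x. f x - S x) absolutely_integrable_on {0..1}"
          by (rule set_integral_diff(1)[OF fi splines_integrable[OF S(1) m1 n]])
        have fVi: "(\<lambda>x. f x - V x) absolutely_integrable_on {0..1}"
          by (rule set_integral_diff(1)[OF fi splines_integrable[OF V m1 n]])
        have "energy p 0 1 (\<lambda>x. f x - S x) = spline_err m n f p powr p"
          using Lp_norm01_powr[OF p(1) p' fSi] S(2) by simp
        also have "\<dots> \<le> Lp_norm01 p (\<lambda>x. f x - V x) powr p"
          using spline_err_le[OF V] spline_err_nonneg[OF m1] p by (intro powr_mono2) auto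
        also have "\<dots> = energy p 0 1 (\<lambda>x. f x - V x)" by (rule Lp_norm01_powr[OF p(1) p' fVi])
        also have "\<dots> = energy p 0 1 (\<lambda>x. iter_int 0 r ?G x - Q x)"
        proof (rule energy_cong)
          fix x :: real assume "x \<in> {0<..<1}"
          then show "f x - V x = iter_int 0 r ?G x - Q x" using R(4)[of x] by (simp add: V_def)
        qed
        finally show ?thesis using Q(2) by simp
      qed
      have \<eta>: "real n powr (real r * p) * ?\<eta> = real n powr (p - 1)"
      proof -
        have pos: "real n > 0" using n by simp
        have inv: "1 / real n = real n powr (- 1)" using pos by (simp add: powr_minus divide_inverse)
        have pw: "1 / real n ^ (r - 1) = real n powr (- real (r - 1))" using pos by (simp add: powr_minus powr_realpow divide_inverse)
        have "?\<eta> = (1 / real n ^ (r - 1)) powr p * (1 / real n)" by simp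
        also have "\<dots> = real n powr (- real (r - 1) * p) * real n powr (- 1)"
          unfolding pw inv powr_powr ..
        finally have "real n powr (real r * p) * ?\<eta> = real n powr (real r * p + (- real (r - 1) * p + - 1))"
          by (simp only: powr_add)
        also have "real r * p + (- real (r - 1) * p + - 1) = p - 1" using r by (simp add: of_nat_diff algebra_simps)
        finally show ?thesis .
      qed
      have "energy p 0 1 (\<lambda>x. g x - deriv01 r S x) \<le> energy p 0 1 ?G
         + C3 * real n powr (real r * p) * (energy p 0 1 (\<lambda>x. f x - S x) + ?\<eta> * cell_L1 p n ?G)"
        by (rule C3(2)[OF n G fi g _ \<sigma> T(2)[OF n] R(3) R(4)]) (use R(2) k(2) in auto)
      also have "C3 * real n powr (real r * p) * (energy p 0 1 (\<lambda>x. f x - S x) + ?\<eta> * cell_L1 p n ?G)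
          \<le> C3 * real n powr (real r * p) * (C2 * ?\<eta> * cell_L1 p n ?G + ?\<eta> * cell_L1 p n ?G)"
        using fS C3(1) by (intro mult_left_mono) auto
      also have "\<dots> = C3 * (C2 + 1) * (real n powr (real r * p) * ?\<eta>) * cell_L1 p n ?G" by (simp only: algebra_simps)
      also have "\<dots> = C3 * (C2 + 1) * real n powr (p - 1) * cell_L1 p n ?G" unfolding \<eta> ..
      also have "\<dots> \<le> C3 * (C2 + 1) * real n powr (p - 1) * (C1 * (real n powr (1 - p) * energy p 0 1 ?G + (Z + \<epsilon>)))"
        using C2(1) C3(1) by (intro mult_left_mono L) auto
      also have "\<dots> = K * (real n powr (p - 1) * real n powr (1 - p) * energy p 0 1 ?G + real n powr (p - 1) * (Z + \<epsilon>))"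
        by (simp only: K_def algebra_simps)
      also have "real n powr (p - 1) * real n powr (1 - p) = 1" using n by (simp add: powr_add[symmetric])
      also have "K * (1 * energy p 0 1 ?G + real n powr (p - 1) * (Z + \<epsilon>)) \<le> K * ((e n + \<epsilon>) + (real n powr (p - 1) * Z + \<epsilon>))"
      proof (intro mult_left_mono add_mono)
        have "real n powr (p - 1) \<le> real n powr 0" using n p by (intro powr_mono) auto
        then have "real n powr (p - 1) * \<epsilon> \<le> 1 * \<epsilon>" using n \<epsilon> by (intro mult_right_mono) auto
        then show "real n powr (p - 1) * (Z + \<epsilon>) \<le> real n powr (p - 1) * Z + \<epsilon>" by (simp add: distrib_left)
      qed (use en K in auto)
      finally have "energy p 0 1 (\<lambda>x. g x - deriv01 r S x) \<le> (e n + \<epsilon>) + K * ((e n + \<epsilon>) + (real n powr (p - 1) * Z + \<epsilon>))"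
        using en by simp
      moreover have "0 \<le> real n powr (p - 1) * Z"
        unfolding Z_def by (intro mult_nonneg_nonneg suminf_nonneg[OF sm']) (use e0 in auto)
      ultimately show ?thesis by (simp add: algebra_simps)
      qed
    qed
    have "energy p 0 1 (\<lambda>x. g x - deriv01 r S x) \<le> (1 + K) * (e n + real n powr (p - 1) * Z)"
    proof (rule field_le_epsilon)
      fix \<delta> :: real assume \<delta>: "\<delta> > 0"
      have K2: "1 + 2 * K > 0" using K by simp
      then have "(1 + 2 * K) * (\<delta> / (1 + 2 * K)) = \<delta>" by simp
      then show "energy p 0 1 (\<lambda>x. g x - deriv01 r S x) \<le> (1 + K) * (e n + real n powr (p - 1) * Z) + \<delta>"
        using main[of "\<delta> / (1 + 2 * K)"] \<delta> K2 by simp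
    qed
    then show "energy p 0 1 (\<lambda>x. deriv01 r f x - deriv01 r S x) \<le> (1 + K) * (spline_err (m - r) n (deriv01 r f) p powr p
       + real n powr (p - 1) * (\<Sum>\<nu>. real (\<nu> + n + 1) powr (- p) * spline_err (m - r) (\<nu> + n + 1) (deriv01 r f) p powr p))"
      unfolding e_def Z_def g_def k_def .
  qed
  qed
  qed
  qed
qed

theorem theorem3p3:
  fixes p :: real and r m :: nat
  assumes "0 < p" and "p < 1" and "1 \<le> r" and "r < m"
  shows "\<exists>C::real. \<forall>(f :: real \<Rightarrow> real) (S :: nat \<Rightarrow> real \<Rightarrow> real).
    differentiable_times01 (r - 1) f \<and> AC01 (deriv01 (r - 1) f) \<and>
    summable (\<lambda>\<nu>. real (\<nu> + 1) powr (- p) * spline_err (m - r) (\<nu> + 1) (deriv01 r f) p powr p) \<and>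
    (\<forall>n\<ge>1. S n \<in> splines m n \<and> Lp_norm01 p (\<lambda>x. f x - S n x) = spline_err m n f p)
    \<longrightarrow> (\<forall>n\<ge>1. Lp_norm01 p (\<lambda>x. deriv01 r f x - deriv01 r (S n) x)
          \<le> C * (spline_err (m - r) n (deriv01 r f) p
                 + real n powr (1 - 1 / p) *
                   (\<Sum>\<nu>. real (\<nu> + n + 1) powr (- p)
                         * spline_err (m - r) (\<nu> + n + 1) (deriv01 r f) p powr p) powr (1 / p)))"
proof -
  have p: "0 < p" "p \<le> 1" and m1: "m \<ge> 1" "m - r \<ge> 1" using assms by auto
  show ?thesis
  proof (rule powered_derivative_error[OF assms], goal_cases)
  case (1 C)
  note C = this
  show ?thesis
  proof (intro exI[of _ "C powr (1 / p) * 2 powr (1 / p)"] allI impI, elim conjE)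
    fix f :: "real \<Rightarrow> real" and S :: "nat \<Rightarrow> real \<Rightarrow> real" and n :: nat
    assume f: "differentiable_times01 (r - 1) f" "AC01 (deriv01 (r - 1) f)"
      and sm: "summable (\<lambda>\<nu>. real (\<nu> + 1) powr (- p) * spline_err (m - r) (\<nu> + 1) (deriv01 r f) p powr p)"
      and S: "\<forall>n\<ge>1. S n \<in> splines m n \<and> Lp_norm01 p (\<lambda>x. f x - S n x) = spline_err m n f p"
      and n: "1 \<le> n"
    let ?E = "spline_err (m - r) n (deriv01 r f) p"
    let ?Z = "\<Sum>\<nu>. real (\<nu> + n + 1) powr (- p) * spline_err (m - r) (\<nu> + n + 1) (deriv01 r f) p powr p"
    have Sn: "S n \<in> splines m n" "Lp_norm01 p (\<lambda>x. f x - S n x) = spline_err m n f p" using S n by auto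
    have sm': "summable (\<lambda>\<nu>. real (\<nu> + n + 1) powr (- p) * spline_err (m - r) (\<nu> + n + 1) (deriv01 r f) p powr p)"
      using summable_ignore_initial_segment[OF sm, of n] .
    have Z0: "?Z \<ge> 0" by (rule suminf_nonneg[OF sm']) simp
    have E0: "?E \<ge> 0" by (rule spline_err_nonneg[OF m1(2)])
    obtain \<sigma> where \<sigma>: "pw_polys m n (S n) \<sigma>" using Sn(1) splines_iff[OF m1(1)] by blast
    have di: "(\<lambda>x. deriv01 r f x - deriv01 r (S n) x) absolutely_integrable_on {0..1}"
      by (rule set_integral_diff(1)[OF AC01_iterated_FTC(1)[OF assms(3) f] pw_polys_integrable[OF pw_polys_deriv01[OF \<sigma>] n]])
    have "Lp_norm01 p (\<lambda>x. deriv01 r f x - deriv01 r (S n) x) = energy p 0 1 (\<lambda>x. deriv01 r f x - deriv01 r (S n) x) powr (1 / p)"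
      by (rule Lp_norm01_eq[OF p di])
    also have "\<dots> \<le> (C * (?E powr p + real n powr (p - 1) * ?Z)) powr (1 / p)"
      using C(2)[OF n f sm' Sn] energy_nonneg p by (intro powr_mono2) auto
    also have "\<dots> = C powr (1 / p) * (?E powr p + real n powr (p - 1) * ?Z) powr (1 / p)"
      by (rule powr_mult)
    also have "\<dots> \<le> C powr (1 / p) * (2 powr (1 / p) * ((?E powr p) powr (1 / p) + (real n powr (p - 1) * ?Z) powr (1 / p)))"
      using Z0 by (intro mult_left_mono powr_inverse_add_le p(1)) auto
    also have "(?E powr p) powr (1 / p) = ?E" using p E0 by (simp add: powr_powr)
    also have "(real n powr (p - 1) * ?Z) powr (1 / p) = real n powr (1 - 1 / p) * ?Z powr (1 / p)"
    proof -
      have "(p - 1) * (1 / p) = 1 - 1 / p" using p by (simp add: field_simps)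
      then show ?thesis using Z0 by (simp only: powr_mult powr_powr powr_ge_zero)
    qed
    finally show "Lp_norm01 p (\<lambda>x. deriv01 r f x - deriv01 r (S n) x)
          \<le> C powr (1 / p) * 2 powr (1 / p) * (?E + real n powr (1 - 1 / p) * ?Z powr (1 / p))"
      by (simp only: mult.assoc)
  qed
qed
qed

end
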